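(* Let $G$ be a graph with $\mathrm{Mad}(G) < \frac{18}{7}$ and $g(G)\ge 6$. Then there exists a vertex partition $V(G) = F \,\dot{\cup}\, I_1 \,\dot{\cup}\, I_2$ such that: (P1) $F$ induces a forest in $G$; (P2) $I_1$ is an independent set such that for all distinct $x,y \in I_1$, $d_{G[F\cup I_1]}(x,y)> 2$; and (P3) $I_2$ is an independent set such that for all distinct $x,y \in I_2$, $d_{G}(x,y)> 2$.
   Context: Graphs are finite and simple. The maximum average degree is $\mathrm{Mad}(G)=\max\{2|E(H)|/|V(H)| : H\subseteq G\}$, the maximum being over subgraphs $H$ with at least one vertex. The girth $g(G)$ is the length of a shortest cycle in $G$ (with $g(G)=\infty$ if $G$ has no cycle). $G[S]$ is the subgraph of $G$ induced by $S\subseteq V(G)$. $d_H(x,y)$ is the distance in the graph $H$ between $x$ and $y$ (the number of edges of a shortest path; infinite if there is none). $\dot\cup$ denotes disjoint union; parts of the partition may be empty. *)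

theory Defs
  imports Complex_Main "HOL-Library.Extended_Nat"
begin

record 'a sgraph =
  verts :: "'a set"
  edges :: "'a set set"

definition simple_graph :: "'a sgraph \<Rightarrow> bool" where
  "simple_graph G \<longleftrightarrow> finite (verts G) \<and> (\<forall>e \<in> edges G. e \<subseteq> verts G \<and> card e = 2)"

definition is_subgraph :: "'a sgraph \<Rightarrow> 'a sgraph \<Rightarrow> bool" where
  "is_subgraph H G \<longleftrightarrow> simple_graph H \<and> verts H \<subseteq> verts G \<and> edges H \<subseteq> edges G"

definition induced :: "'a sgraph \<Rightarrow> 'a set \<Rightarrow> 'a sgraph" where
  "induced G S = \<lparr> verts = S, edges = {e \<in> edges G. e \<subseteq> S} \<rparr>"

(* The maximum is over an empty set exactly when G has no vertices; the value 0 there is a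
   convention. Otherwise the set is finite and nonempty, see densities_finite_nonempty below. *)
definition mad :: "'a sgraph \<Rightarrow> real" where
  "mad G = (if verts G = {} then 0
            else Max {2 * real (card (edges H)) / real (card (verts H)) | H.
                        is_subgraph H G \<and> verts H \<noteq> {}})"

(* Paths and cycles are given by their vertex lists. A path with vertex list p has
   length p - 1 edges; a cycle is closed by the edge from its last to its first vertex,
   so it has length p edges. *)
definition is_path :: "'a sgraph \<Rightarrow> 'a list \<Rightarrow> bool" where
  "is_path G p \<longleftrightarrow> p \<noteq> [] \<and> distinct p \<and> set p \<subseteq> verts G \<and>
     successively (\<lambda>u v. {u, v} \<in> edges G) p"

definition is_cycle :: "'a sgraph \<Rightarrow> 'a list \<Rightarrow> bool" where
  "is_cycle G p \<longleftrightarrow> is_path G p \<and> 3 \<le> length p \<and> {last p, hd p} \<in> edges G"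

(* In enat the infimum of the empty set is \<infinity>. *)
definition girth :: "'a sgraph \<Rightarrow> enat" where
  "girth G = (INF p \<in> {p. is_cycle G p}. enat (length p))"

definition graph_dist :: "'a sgraph \<Rightarrow> 'a \<Rightarrow> 'a \<Rightarrow> enat" where
  "graph_dist G x y = (INF p \<in> {p. is_path G p \<and> hd p = x \<and> last p = y}. enat (length p - 1))"

definition is_forest :: "'a sgraph \<Rightarrow> bool" where
  "is_forest G \<longleftrightarrow> (\<nexists>p. is_cycle G p)"

definition independent_set :: "'a sgraph \<Rightarrow> 'a set \<Rightarrow> bool" where
  "independent_set G S \<longleftrightarrow> S \<subseteq> verts G \<and> (\<forall>x \<in> S. \<forall>y \<in> S. {x, y} \<notin> edges G)"

lemma simple_graph_induced:
  assumes "simple_graph G" "S \<subseteq> verts G"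
  shows "simple_graph (induced G S)"
  using assms by (auto simp: simple_graph_def induced_def intro: finite_subset)

lemma finite_subgraphs:
  assumes "simple_graph G"
  shows "finite {H. is_subgraph H G}"
proof -
  have "edges G \<subseteq> Pow (verts G)"
    using assms by (auto simp: simple_graph_def)
  then have "finite (edges G)"
    using assms by (meson finite_Pow_iff finite_subset simple_graph_def)
  then have "finite ((\<lambda>(V, E). \<lparr> verts = V, edges = E \<rparr>) ` (Pow (verts G) \<times> Pow (edges G)))"
    using assms by (auto simp: simple_graph_def)
  moreover have "H \<in> (\<lambda>(V, E). \<lparr> verts = V, edges = E \<rparr>) ` (Pow (verts G) \<times> Pow (edges G))"
    if "is_subgraph H G" for H
    using that by (intro image_eqI[of _ _ "(verts H, edges H)"]) (auto simp: is_subgraph_def)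
  ultimately show ?thesis
    by (auto elim: finite_subset[rotated])
qed

lemma densities_finite_nonempty:
  assumes "simple_graph G" "verts G \<noteq> {}"
  defines "D \<equiv> {2 * real (card (edges H)) / real (card (verts H)) | H.
                  is_subgraph H G \<and> verts H \<noteq> {}}"
  shows "finite D" "D \<noteq> {}"
proof -
  have "D \<subseteq> (\<lambda>H. 2 * real (card (edges H)) / real (card (verts H))) ` {H. is_subgraph H G}"
    unfolding D_def by auto
  then show "finite D"
    using finite_subgraphs[OF assms(1)] by (meson finite_imageI finite_subset)
  have "is_subgraph G G"
    using assms(1) by (simp add: is_subgraph_def)
  then show "D \<noteq> {}"
    using assms(2) unfolding D_def by blast
qed

end

theory Submission
  imports Defs
begin

text \<open>
  Consider a minimal graph without such a partition. Two adjacent vertices of degree 2 form a link between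
  two vertices of degree at least 4. A removed link can be put back as soon as one of its two ends is
  flexible: it is outside the forest, or some colour is missing on its coloured neighbours, for instance
  because it has at most two of them. This makes many local configurations reducible.
  After discharging, the only vertices of negative charge have degree 4 and three links, or are
  neighbours of such vertices. They can be joined by links to arbitrarily large trees, which no bounded
  configuration excludes. But a cycle of links through one of them is reducible: colour the graph without the links
  of the cycle, and put these back one after the other, each served by an end which still
  misses the preceding link. Hence there are at most as many links as such vertices or clusters, and this
  global count, together with the charge lost to the remaining vertices, contradicts the density.
\<close>

section \<open>Partial colourings\<close>

text \<open>The balance behind the global count is exact. Let t be the number of vertices of degree
  4 with two or three links, p of them with three, and q the number of clusters, that is, of
  vertices with two links whose two other neighbours both have degree 4 and three links. The t
  vertices carry 2t + p link ends. Contracting each cluster of three vertices to one node leaves t -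
  2q nodes, so links inside this set use at most 2(t - 2q) ends, and at least p + 4q ends belong to
  links that leave the set. Each of these is covered by one unit of surplus at the other end of its
  link, which matches the deficits: 1 per vertex with three links, 4 per cluster center. The
  argument cannot open a cycle of links everywhere: at a vertex with exactly two links that is no
  cluster center it has no way to prepare the link that is closed last. The cycle is therefore
  opened at a node with a third link end. Such a cycle exists once there are more links than nodes,
  whereas equality still allows a bare cycle; this is why the bound on the links is the number of
  nodes.\<close>

(* Fo, On and Tw stand for the parts F, I1 and I2. *)
datatype hue = Fo | On | Tw

text \<open>A closed walk of length 5 without loops is a 5-cycle or contains a triangle, so
  \<open>no5\<close> can speak of walks. A closed walk of length 4 may run back and forth, hence the
  two inequalities in \<open>no4\<close>.\<close>

locale girth6_graph =
  fixes V :: "'a set" and adj :: "'a \<Rightarrow> 'a \<Rightarrow> bool"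
  assumes finV: "finite V"
    and adjV: "adj x y \<Longrightarrow> x \<in> V"
    and sym: "adj x y \<Longrightarrow> adj y x"
    and irr: "\<not> adj x x"
    and no3: "adj a b \<Longrightarrow> adj b c \<Longrightarrow> adj c a \<Longrightarrow> False"
    and no4: "adj a b \<Longrightarrow> adj b c \<Longrightarrow> adj c d \<Longrightarrow> adj d a \<Longrightarrow> a \<noteq> c \<Longrightarrow> b \<noteq> d \<Longrightarrow> False"
    and no5: "adj a b \<Longrightarrow> adj b c \<Longrightarrow> adj c d \<Longrightarrow> adj d e \<Longrightarrow> adj e a \<Longrightarrow> False"
begin

definition nb :: "'a \<Rightarrow> 'a set" where "nb v = {x. adj v x}"

definition acyc :: "'a set \<Rightarrow> bool" where
  "acyc S \<longleftrightarrow> \<not> (\<exists>p. distinct p \<and> 3 \<le> length p \<and> set p \<subseteq> S \<and> successively adj p \<and> adj (last p) (hd p))"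

text \<open>All conditions look inside \<open>W\<close> only: an uncoloured vertex neither conflicts
  nor connects, so colouring it must also be checked as the creation of a new middle vertex. The
  exception for \<open>On\<close> with \<open>c z = Tw\<close> reflects that distances in
  \<open>I1\<close> ignore paths through \<open>I2\<close>, while distances in \<open>I2\<close> are
  taken in the whole graph.\<close>

definition valid :: "('a \<Rightarrow> hue) \<Rightarrow> 'a set \<Rightarrow> bool" where
  "valid c W \<longleftrightarrow> W \<subseteq> V \<and>
     (\<forall>x\<in>W. \<forall>y\<in>W. adj x y \<and> c x = c y \<longrightarrow> c x = Fo) \<and>
     (\<forall>z\<in>W. \<forall>x\<in>W. \<forall>y\<in>W. adj z x \<and> adj z y \<and> x \<noteq> y \<and> c x = c y \<longrightarrow> c x = Fo \<or> c x = On \<and> c z = Tw) \<and>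
     acyc {x \<in> W. c x = Fo}"

section \<open>Extending a partial colouring vertex by vertex\<close>

lemma in_nb [simp]: "x \<in> nb v \<longleftrightarrow> adj v x"
  by (simp add: nb_def)

lemma adjV2: "adj x y \<Longrightarrow> y \<in> V"
  using adjV sym by blast

lemma nb_sub: "nb v \<subseteq> V"
  using adjV2 by auto

lemma fin_nb [simp]: "finite (nb v)"
  using finite_subset[OF nb_sub finV] .

lemma acyc_mono: "acyc S \<Longrightarrow> S' \<subseteq> S \<Longrightarrow> acyc S'"
  unfolding acyc_def by blast

text \<open>A cycle through \<open>v\<close> uses two neighbours of \<open>v\<close>, and each of
  them has a further neighbour on the cycle inside \<open>S\<close>. Hence it suffices that of any
  two neighbours one is isolated in \<open>S\<close>.\<close>

lemma acyc_insert:
  assumes S: "acyc S"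
    and iso: "\<And>x y. \<lbrakk>x \<in> S; y \<in> S; adj v x; adj v y; x \<noteq> y\<rbrakk> \<Longrightarrow> (\<forall>z\<in>S. \<not> adj x z) \<or> (\<forall>z\<in>S. \<not> adj y z)"
  shows "acyc (insert v S)"
  unfolding acyc_def
proof
  assume "\<exists>p. distinct p \<and> 3 \<le> length p \<and> set p \<subseteq> insert v S \<and> successively adj p \<and> adj (last p) (hd p)"
  then obtain p where p: "distinct p" "3 \<le> length p" "set p \<subseteq> insert v S" "successively adj p" "adj (last p) (hd p)"
    by blast
  show False
  proof (cases "v \<in> set p")
    case False
    then have "set p \<subseteq> S" using p(3) by auto
    then show False using S p unfolding acyc_def by blast
  next
    case True
    then obtain a b where ab: "p = a @ v # b" by (meson split_list)
    \<comment> \<open>The cycle is cut at \<open>v\<close>: \<open>q\<close> is the remaining path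
      in \<open>S\<close>, whose two ends are neighbours of \<open>v\<close>.\<close>
    define q where "q = b @ a"
    have len: "length q \<ge> 2" using p(2) ab by (simp add: q_def)
    have dq: "distinct q" "v \<notin> set q" using p(1) ab by (auto simp: q_def)
    have sq: "set q \<subseteq> S" using p(1,3) ab by (auto simp: q_def)
    have suc: "successively adj q"
      using p(4,5) ab unfolding q_def
      by (cases "a = []"; cases "b = []") (auto simp: successively_append_iff successively_Cons)
    have hq: "adj v (hd q)"
      using p(4,5) ab len unfolding q_def
      by (cases "a = []"; cases "b = []") (auto simp: successively_append_iff successively_Cons)
    have lq: "adj (last q) v"
      using p(4,5) ab len unfolding q_def
      by (cases "a = []"; cases "b = []") (auto simp: successively_append_iff successively_Cons)
    obtain x r where q: "q = x # r" "r \<noteq> []"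
      using len by (cases q; cases "tl q") auto
    obtain r' y where r: "r = r' @ [y]" using q(2) by (metis rev_exhaust)
    have xy: "x \<noteq> y" "x \<in> S" "y \<in> S" "adj v x" "adj v y"
      using dq sq q r hq lq sym by auto
    have "adj x (hd r)" "hd r \<in> S" using suc q sq by (auto simp: successively_Cons)
    moreover have "adj y (last (x # r'))" "last (x # r') \<in> S"
      using suc q r sq sym by (auto simp: successively_append_iff successively_Cons split: if_splits)
    ultimately show False using iso[OF xy(2,3,4,5,1)] by blast
  qed
qed

lemma valid_sub: "valid c W \<Longrightarrow> W \<subseteq> V"
  by (simp add: valid_def)

lemma valid_mono: "valid c W \<Longrightarrow> W' \<subseteq> W \<Longrightarrow> valid c W'"
  unfolding valid_def by (intro conjI) (blast intro: acyc_mono | auto elim!: acyc_mono)+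

text \<open>A vertex of the forest part matters only as a middle vertex and for cycles. So equally
  coloured neighbours must be \<open>Fo\<close>, and of any two such neighbours one must be isolated
  in the forest.\<close>

lemma addFo:
  assumes c: "valid c W" and v: "v \<in> V" "v \<notin> W"
    and h: "\<And>x y. \<lbrakk>x \<in> W; y \<in> W; adj v x; adj v y; x \<noteq> y; c x = c y\<rbrakk> \<Longrightarrow>
       c x = Fo \<and> ((\<forall>z\<in>W. adj x z \<longrightarrow> c z \<noteq> Fo) \<or> (\<forall>z\<in>W. adj y z \<longrightarrow> c z \<noteq> Fo))"
  shows "valid (c(v := Fo)) (insert v W)"
proof -
  have s: "{x \<in> insert v W. (c(v := Fo)) x = Fo} = insert v {x \<in> W. c x = Fo}" using v by auto
  have "acyc (insert v {x \<in> W. c x = Fo})"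
  proof (rule acyc_insert)
    show "acyc {x \<in> W. c x = Fo}" using c by (simp add: valid_def)
    fix x y assume "x \<in> {x \<in> W. c x = Fo}" "y \<in> {x \<in> W. c x = Fo}" "adj v x" "adj v y" "x \<noteq> y"
    then show "(\<forall>z\<in>{x \<in> W. c x = Fo}. \<not> adj x z) \<or> (\<forall>z\<in>{x \<in> W. c x = Fo}. \<not> adj y z)"
      using h[of x y] by auto
  qed
  moreover have "\<And>x. x \<in> W \<Longrightarrow> x \<noteq> v" using v by auto
  ultimately show ?thesis
    using c v(1) unfolding valid_def s
    apply (intro conjI)
       apply blast
      apply (auto simp: irr)[1]
     apply (intro ballI impI)
    subgoal for z x y
      apply (cases "z = v")
      subgoal using h[of x y] irr by auto
      apply (cases "x = v"; cases "y = v")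
      by auto
    by blast
qed

text \<open>\<open>h2\<close> skips neighbours coloured \<open>Tw\<close>, since paths through them
  do not count between \<open>On\<close> vertices; \<open>h3\<close> is there because
  \<open>v\<close> itself becomes a middle vertex between neighbours coloured
  \<open>Tw\<close>.\<close>

lemma addOn:
  assumes c: "valid c W" and v: "v \<in> V" "v \<notin> W"
    and h1: "\<And>x. \<lbrakk>x \<in> W; adj v x\<rbrakk> \<Longrightarrow> c x \<noteq> On"
    and h2: "\<And>x z. \<lbrakk>x \<in> W; adj v x; c x = Fo; z \<in> W; adj x z\<rbrakk> \<Longrightarrow> c z \<noteq> On"
    and h3: "\<And>x y. \<lbrakk>x \<in> W; y \<in> W; adj v x; adj v y; x \<noteq> y; c x = Tw\<rbrakk> \<Longrightarrow> c y \<noteq> Tw"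
  shows "valid (c(v := On)) (insert v W)"
proof -
  have s: "{x \<in> insert v W. (c(v := On)) x = Fo} = {x \<in> W. c x = Fo}" using v by auto
  have n: "\<And>x. x \<in> W \<Longrightarrow> x \<noteq> v" using v by auto
  show ?thesis
    using c v(1) n unfolding valid_def s
    apply (intro conjI)
       apply blast
    subgoal using irr h1 sym by (smt (verit) fun_upd_apply insertE)
     apply (intro ballI impI)
    subgoal for z x y
      apply (cases "z = v")
      subgoal using h1[of x] h3[of x y] irr by (cases "c x") auto
      apply (cases "x = v"; cases "y = v")
         apply simp
      subgoal using h2[of z y] h1[of z] sym[of z v] by (cases "c z") auto
      subgoal using h2[of z x] h1[of z] sym[of z v] by (cases "c z") auto
      by auto
    by blast
qed

text \<open>Here every middle vertex counts, so \<open>h2\<close> has no restriction on the colour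
  of \<open>x\<close>. In return two neighbours of \<open>v\<close> may both be
  \<open>On\<close>.\<close>

lemma addTw:
  assumes c: "valid c W" and v: "v \<in> V" "v \<notin> W"
    and h1: "\<And>x. \<lbrakk>x \<in> W; adj v x\<rbrakk> \<Longrightarrow> c x \<noteq> Tw"
    and h2: "\<And>x z. \<lbrakk>x \<in> W; adj v x; z \<in> W; adj x z\<rbrakk> \<Longrightarrow> c z \<noteq> Tw"
  shows "valid (c(v := Tw)) (insert v W)"
proof -
  have s: "{x \<in> insert v W. (c(v := Tw)) x = Fo} = {x \<in> W. c x = Fo}" using v by auto
  have n: "\<And>x. x \<in> W \<Longrightarrow> x \<noteq> v" using v by auto
  show ?thesis
    using c v(1) n unfolding valid_def s
    apply (intro conjI)
       apply blast
    subgoal using irr h1 sym by (smt (verit) fun_upd_apply insertE)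
     apply (intro ballI impI)
    subgoal for z x y
      apply (cases "z = v")
      subgoal using h1[of x] h1[of y] irr by (cases "c x") auto
      apply (cases "x = v"; cases "y = v")
         apply simp
      subgoal using h2[of z y] sym[of z v] by auto
      subgoal using h2[of z x] sym[of z v] by auto
      by auto
    by blast
qed

text \<open>Differently coloured neighbours include at most one in the forest, so \<open>v\<close>
  is a leaf or isolated there.\<close>

lemma leafFo:
  assumes "valid c W" "v \<in> V" "v \<notin> W"
    and "\<And>x y. \<lbrakk>x \<in> W; y \<in> W; adj v x; adj v y; c x = c y\<rbrakk> \<Longrightarrow> x = y"
  shows "valid (c(v := Fo)) (insert v W)"
  by (rule addFo) (use assms in blast)+

text \<open>A removed link can be put back at a flexible end, see \<open>add_bad_path\<close>.\<close>

definition flex :: "('a \<Rightarrow> hue) \<Rightarrow> 'a set \<Rightarrow> 'a \<Rightarrow> bool" where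
  "flex c W v \<longleftrightarrow> c v \<noteq> Fo \<or> (\<exists>k. \<forall>x\<in>W. adj v x \<longrightarrow> c x \<noteq> k)"

lemma flex_card:
  assumes "card (nb v \<inter> W) \<le> 2" shows "flex c W v"
proof (rule ccontr)
  assume "\<not> flex c W v"
  then have "\<forall>k. \<exists>x\<in>W. adj v x \<and> c x = k" unfolding flex_def by blast
  then have "k \<in> c ` (nb v \<inter> W)" for k by (metis IntI image_eqI in_nb)
  then have "{Fo, On, Tw} \<subseteq> c ` (nb v \<inter> W)" by auto
  then have "card {Fo, On, Tw} \<le> card (c ` (nb v \<inter> W))" by (intro card_mono) auto
  also have "\<dots> \<le> card (nb v \<inter> W)" by (intro card_image_le) auto
  finally show False using assms by simp
qed

text \<open>Both inner vertices can go to the forest if one of the ends is outside it or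
  \<open>v\<close> is isolated in it, since then no cycle runs through the link. Otherwise both ends
  are \<open>Fo\<close>, and a colour missing around \<open>v\<close> goes on \<open>u\<close>: the
  only coloured neighbour of \<open>u\<close> is \<open>v\<close>, so a conflict could come only
  from neighbours of \<open>v\<close>.\<close>

lemma add_bad_path:
  assumes c: "valid c W" and u: "u \<notin> W" "u' \<notin> W" and nu: "nb u = {v, u'}" "nb u' = {u, w}"
    and vw: "v \<in> W" "w \<in> W" and fl: "flex c W v"
  obtains c' where "valid c' (insert u (insert u' W))" "\<And>x. x \<in> W \<Longrightarrow> c' x = c x"
proof -
  have au: "adj u x \<longleftrightarrow> x = v \<or> x = u'" and au': "adj u' x \<longleftrightarrow> x = u \<or> x = w" for x
    using nu in_nb by blast+
  have V: "u \<in> V" "u' \<in> V" using au au' adjV by blast+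
  have au2: "adj x u \<longleftrightarrow> x = v \<or> x = u'" and au2': "adj x u' \<longleftrightarrow> x = u \<or> x = w" for x
    using au[of x] au'[of x] sym[of x u] sym[of u x] sym[of x u'] sym[of u' x] by auto
  have ne: "u \<noteq> u'" "v \<noteq> u" "v \<noteq> u'" "w \<noteq> u" "w \<noteq> u'" using au irr u vw by auto
  have "v \<noteq> w" using au[of u'] au'[of w] no3[of u u' w] au2[of w] by auto
  note ne = ne this
  note th = that
  have A: ?thesis if "c v \<noteq> Fo \<or> (\<forall>x\<in>W. adj v x \<longrightarrow> c x \<noteq> Fo)"
  proof -
    have 1: "valid (c(u' := Fo)) (insert u' W)"
      by (rule leafFo) (use c u V au' in auto)
    have "valid (c(u' := Fo, u := Fo)) (insert u (insert u' W))"
      by (rule addFo[OF 1]) (use that u V ne au au' au2 au2' vw irr in auto)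
    then show ?thesis using that u by (intro th[of "c(u' := Fo, u := Fo)"]) auto
  qed
  have B: ?thesis if "c w \<noteq> Fo"
  proof -
    have 1: "valid (c(u := Fo)) (insert u W)"
      by (rule leafFo) (use c u V au in auto)
    have "valid (c(u := Fo, u' := Fo)) (insert u' (insert u W))"
      by (rule leafFo[OF 1]) (use that u V ne au au' au2 au2' vw irr in auto)
    then show ?thesis using that u by (intro th[of "c(u := Fo, u' := Fo)"]) (auto simp: insert_commute)
  qed
  have C: ?thesis if k: "k \<noteq> Fo" "c v = Fo" "\<forall>x\<in>W. adj v x \<longrightarrow> c x \<noteq> k" "c w = Fo" for k
  proof -
    have 1: "valid (c(u := k)) (insert u W)"
    proof (cases k)
      case On
      show ?thesis unfolding On by (rule addOn) (use c u V au k On in auto)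
    next
      case Tw
      show ?thesis unfolding Tw by (rule addTw) (use c u V au k Tw in auto)
    qed (use k in auto)
    have "valid (c(u := k, u' := Fo)) (insert u' (insert u W))"
      by (rule leafFo[OF 1]) (use k u V ne au au' au2 au2' vw irr in auto)
    then show ?thesis using that u by (intro th[of "c(u := k, u' := Fo)"]) (auto simp: insert_commute)
  qed
  show ?thesis
  proof (cases "c v \<noteq> Fo \<or> c w \<noteq> Fo")
    case True then show ?thesis using A B by blast
  next
    case False
    then obtain k where "\<forall>x\<in>W. adj v x \<longrightarrow> c x \<noteq> k" using fl unfolding flex_def by blast
    then show ?thesis using A C[of k] False by (cases k) auto
  qed
qed

end

section \<open>Minimal uncolourable graphs\<close>

text \<open>Smaller graphs appear as vertex subsets of one fixed graph, so reductions remove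
  vertices without ever changing the adjacency; \<open>valid_supergraph\<close> justifies this
  view.\<close>

locale critical_graph = girth6_graph +
  assumes crit: "W \<subset> V \<Longrightarrow> \<exists>c. valid c W"
    and uncol: "\<not> valid c V"
begin

lemma add_isolated:
  assumes "valid c W" "v \<in> V" "v \<notin> W" "nb v \<inter> W = {}"
  shows "valid (c(v := k)) (insert v W)"
proof -
  have n: "\<And>x. x \<in> W \<Longrightarrow> \<not> adj v x" using assms(4) by auto
  show ?thesis
  proof (cases k)
    case Fo show ?thesis unfolding Fo by (rule leafFo) (use assms n in blast)+
  next
    case On show ?thesis unfolding On by (rule addOn) (use assms n in blast)+
  next
    case Tw show ?thesis unfolding Tw by (rule addTw) (use assms n in blast)+
  qed
qed

lemma colouring_off:
  assumes "S \<noteq> {}" "S \<subseteq> V" obtains c where "valid c (V - S)"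
  using crit[of "V - S"] assms by blast

lemma deg_ge2:
  assumes "v \<in> V" shows "2 \<le> card (nb v)"
proof (rule ccontr)
  assume "\<not> ?thesis"
  then have n: "\<And>x y. adj v x \<Longrightarrow> adj v y \<Longrightarrow> x = y"
    using card_le_Suc0_iff_eq[of "nb v"] by auto
  obtain c where "valid c (V - {v})" using colouring_off[of "{v}"] assms by auto
  then have "valid (c(v := Fo)) (insert v (V - {v}))"
    by (rule leafFo) (use assms n in auto)
  then show False using uncol assms by (simp add: insert_absorb)
qed

lemma deg2_nb:
  assumes "card (nb u) = 2" "adj u a" obtains b where "nb u = {a, b}" "a \<noteq> b"
proof -
  obtain x y where xy: "nb u = {x, y}" "x \<noteq> y" using assms(1) unfolding card_2_iff by blast
  have "a \<in> {x, y}" using assms(2) unfolding xy(1)[symmetric] by simp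
  then consider "a = x" | "a = y" by blast
  then show ?thesis
  proof cases
    case 1 then show ?thesis using that[of y] xy by simp
  next
    case 2 then show ?thesis using that[of x] xy by (simp add: insert_commute)
  qed
qed

text \<open>Once \<open>u\<close> is removed, a vertex \<open>v\<close> of degree at most 3 has at
  most two coloured neighbours. It is then flexible and the link can be put back.\<close>

lemma end_deg:
  assumes nu: "nb u = {v, u'}" "nb u' = {u, w}"
  shows "4 \<le> card (nb v)"
proof (rule ccontr)
  assume c4: "\<not> ?thesis"
  have au: "adj u x \<longleftrightarrow> x = v \<or> x = u'" and au': "adj u' x \<longleftrightarrow> x = u \<or> x = w" for x
    using nu in_nb by blast+
  have V: "u \<in> V" "u' \<in> V" "v \<in> V" "w \<in> V" using au au' adjV adjV2 by blast+
  have "u \<noteq> v" "u \<noteq> u'" "u' \<noteq> w" using au au' irr by blast+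
  moreover have "v \<noteq> u'"
    using deg_ge2[of u] V nu by auto
  moreover have "w \<noteq> u" using deg_ge2[of u'] V nu by auto
  moreover obtain c where c: "valid c (V - {u, u'})" using colouring_off[of "{u,u'}"] V by auto
  have "u \<in> nb v" using au sym by auto
  then have "nb v \<inter> (V - {u, u'}) \<subseteq> nb v - {u}" "card (nb v - {u}) \<le> 2" using c4 by auto
  then have "card (nb v \<inter> (V - {u, u'})) \<le> 2"
    by (meson card_mono fin_nb finite_Diff le_trans)
  then have "flex c (V - {u, u'}) v" by (rule flex_card)
  ultimately obtain c' where "valid c' (insert u (insert u' (V - {u, u'})))"
    using add_bad_path[OF c _ _ nu] V by auto
  moreover have "insert u (insert u' (V - {u, u'})) = V" using V by auto
  ultimately show False using uncol by simp
qed

text \<open>A link is represented by its two inner vertices. Each of them also stands for the link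
  directed away from its \<open>anchor\<close>, and \<open>partner\<close> reverses the
  direction.\<close>

definition bad :: "'a \<Rightarrow> bool" where
  "bad u \<longleftrightarrow> card (nb u) = 2 \<and> (\<exists>x. adj u x \<and> card (nb x) = 2)"

definition partner :: "'a \<Rightarrow> 'a" where
  "partner u = (SOME x. adj u x \<and> card (nb x) = 2)"

definition anchor :: "'a \<Rightarrow> 'a" where
  "anchor u = (SOME x. adj u x \<and> x \<noteq> partner u)"

definition bad_nb :: "'a \<Rightarrow> 'a set" where
  "bad_nb v = {u \<in> nb v. bad u}"

text \<open>That \<open>partner\<close> is an involution rests on \<open>end_deg\<close>: the
  neighbours outside the link have degree at least 4, so the choice in \<open>partner\<close> is
  forced.\<close>

lemma bad_facts:
  assumes "bad u"
  shows "nb u = {anchor u, partner u}" "nb (partner u) = {u, anchor (partner u)}" "card (nb u) = 2" "card (nb (partner u)) = 2"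
    "bad (partner u)" "partner (partner u) = u" "4 \<le> card (nb (anchor u))"
proof -
  show cu: "card (nb u) = 2" using assms unfolding bad_def by blast
  have p: "adj u (partner u) \<and> card (nb (partner u)) = 2"
    using assms unfolding bad_def partner_def by (metis (mono_tags, lifting) someI_ex)
  obtain e where e: "nb u = {partner u, e}" "partner u \<noteq> e" using deg2_nb[OF cu] p by blast
  have "anchor u = e" unfolding anchor_def
    by (rule some_equality) (use e in \<open>auto simp flip: in_nb\<close>)
  then show nu: "nb u = {anchor u, partner u}" using e by auto
  show cp: "card (nb (partner u)) = 2" using p by blast
  have au: "adj (partner u) u" using p sym by blast
  show bp: "bad (partner u)" using cp cu au unfolding bad_def by blast
  obtain w where w: "nb (partner u) = {u, w}" "u \<noteq> w" using deg2_nb[OF cp au] by blast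
  show "4 \<le> card (nb (anchor u))" using end_deg[OF nu w(1)] .
  have "4 \<le> card (nb w)" using end_deg[of "partner u" w u "anchor u"] w nu by auto
  then have "card (nb w) \<noteq> 2" by auto
  then show pp: "partner (partner u) = u" unfolding partner_def[of "partner u"]
    by (intro some_equality) (use w cu au in \<open>auto simp flip: in_nb\<close>)
  have "anchor (partner u) = w" unfolding anchor_def[of "partner u"] pp
    by (rule some_equality) (use w in \<open>auto simp flip: in_nb\<close>)
  then show "nb (partner u) = {u, anchor (partner u)}" using w by auto
qed

lemma bad_V: "bad u \<Longrightarrow> u \<in> V"
  using bad_facts(1) adjV in_nb by blast

lemma bad_adj:
  assumes "bad u"
  shows "adj u x \<longleftrightarrow> x = anchor u \<or> x = partner u" "adj x u \<longleftrightarrow> x = anchor u \<or> x = partner u"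
proof -
  show "adj u x \<longleftrightarrow> x = anchor u \<or> x = partner u" using bad_facts(1)[OF assms] in_nb by blast
  then show "adj x u \<longleftrightarrow> x = anchor u \<or> x = partner u" using sym by blast
qed

lemma anchor_V: "bad u \<Longrightarrow> anchor u \<in> V"
  using bad_adj adjV by blast

lemma not_bad_deg: "card (nb v) \<noteq> 2 \<Longrightarrow> \<not> bad v"
  by (auto simp: bad_def)

lemma anchor_not_bad: "bad u \<Longrightarrow> \<not> bad (anchor u)"
  using bad_facts(7) not_bad_deg by fastforce

lemma anchor_eq: "bad u \<Longrightarrow> adj v u \<Longrightarrow> card (nb v) \<noteq> 2 \<Longrightarrow> anchor u = v"
  using bad_adj(2)[of u v] bad_facts(4)[of u] by auto

lemma partner_ne: "bad u \<Longrightarrow> partner u \<noteq> u" "bad u \<Longrightarrow> partner u \<noteq> anchor u"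
  using bad_adj(1)[of u "partner u"] irr apply auto[1]
  using bad_facts(5)[of u] anchor_not_bad[of u] by auto

text \<open>Every link is served from its end \<open>anchor d\<close>, and the order is irrelevant:
  an anchor in the forest with at most three neighbours in the final set has at most two coloured
  ones as long as \<open>d\<close> itself is missing.\<close>

lemma add_bad_paths:
  assumes c: "valid c W" and fE: "finite E"
    and E: "\<And>d. d \<in> E \<Longrightarrow> bad d \<and> d \<notin> W \<and> partner d \<notin> W \<and> anchor d \<in> W \<and> anchor (partner d) \<in> W"
    and sv: "\<And>d. d \<in> E \<Longrightarrow> c (anchor d) \<noteq> Fo \<or> card (nb (anchor d) \<inter> (W \<union> E \<union> partner ` E)) \<le> 3"
  obtains c' where "valid c' (W \<union> E \<union> partner ` E)" "\<And>x. x \<in> W \<Longrightarrow> c' x = c x"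
proof -
  have ex: "\<exists>c'. valid c' (W \<union> E' \<union> partner ` E') \<and> (\<forall>x\<in>W. c' x = c x)" if "E' \<subseteq> E" for E'
    using finite_subset[OF that fE] that
  proof (induction E' rule: finite_induct)
    case empty
    then show ?case using c by auto
  next
    case (insert d D)
    then obtain c1 where c1: "valid c1 (W \<union> D \<union> partner ` D)" "\<forall>x\<in>W. c1 x = c x" by auto
    have d: "bad d" "d \<notin> W" "partner d \<notin> W" "anchor d \<in> W" "anchor (partner d) \<in> W" using E insert.prems by auto
    let ?W = "W \<union> D \<union> partner ` D"
    have DE: "\<And>x. x \<in> D \<Longrightarrow> bad x" using E insert.prems by auto
    have m: "partner x \<in> ?W" if mx: "x \<in> ?W" "x \<notin> W" for x
    proof (cases "x \<in> D")
      case False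
      then obtain y where "y \<in> D" "x = partner y" using mx by blast
      then show ?thesis using bad_facts(6)[OF DE] by auto
    qed auto
    have eq: "W \<union> insert d D \<union> partner ` insert d D = insert d (insert (partner d) ?W)" by auto
    show ?case
    proof (cases "d \<in> ?W \<or> partner d \<in> ?W")
      \<comment> \<open>\<open>E\<close> may contain both inner vertices of a link; at the second
        one the link is already back.\<close>
      case True
      then have "d \<in> ?W" "partner d \<in> ?W" using m[of d] m[of "partner d"] d bad_facts(6) by auto
      then have "insert d (insert (partner d) ?W) = ?W" by blast
      then show ?thesis using c1 eq by auto
    next
      case False
      have "flex c1 ?W (anchor d)"
      proof (cases "c (anchor d) = Fo")
        case True
        then have 3: "card (nb (anchor d) \<inter> (W \<union> E \<union> partner ` E)) \<le> 3" using sv[of d] insert.prems by auto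
        have "nb (anchor d) \<inter> ?W \<subset> nb (anchor d) \<inter> (W \<union> E \<union> partner ` E)"
        proof
          show "nb (anchor d) \<inter> ?W \<subseteq> nb (anchor d) \<inter> (W \<union> E \<union> partner ` E)" using insert.prems by auto
          have "d \<in> nb (anchor d) \<inter> (W \<union> E \<union> partner ` E)" using insert.prems bad_adj[OF d(1)] by auto
          then show "nb (anchor d) \<inter> ?W \<noteq> nb (anchor d) \<inter> (W \<union> E \<union> partner ` E)" using False by blast
        qed
        then have "card (nb (anchor d) \<inter> ?W) < card (nb (anchor d) \<inter> (W \<union> E \<union> partner ` E))"
          by (intro psubset_card_mono) auto
        then show ?thesis using 3 by (intro flex_card) linarith
      next
        case False
        then show ?thesis using c1 d unfolding flex_def by auto
      qed
      then obtain c' where "valid c' (insert d (insert (partner d) ?W))" "\<And>x. x \<in> ?W \<Longrightarrow> c' x = c1 x"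
        by (rule add_bad_path[OF c1(1) _ _ bad_facts(1,2)[OF d(1)], rotated 4]) (use False d in auto)
      then show ?thesis using c1 eq by auto
    qed
  qed
  obtain c' where "valid c' (W \<union> E \<union> partner ` E)" "\<forall>x\<in>W. c' x = c x" using ex[OF subset_refl] by blast
  then show ?thesis using that[of c'] by blast
qed

text \<open>A vertex outside the forest stays flexible whatever happens around it. So a
  configuration is refuted as soon as one end of each removed link has been coloured outside the
  forest.\<close>

lemma no_bad_path_completion:
  assumes c: "valid c (V - (B \<union> partner ` B))" and B: "\<And>d. d \<in> B \<Longrightarrow> bad d \<and> c (anchor d) \<noteq> Fo"
  shows False
proof -
  have BV: "B \<union> partner ` B \<subseteq> V" using B bad_V bad_facts(5) by blast
  have bb: "\<And>x. x \<in> B \<union> partner ` B \<Longrightarrow> bad x" using B bad_facts(5) by blast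
  have "finite B" using BV finV finite_subset by blast
  have anchor: "anchor d \<in> V - (B \<union> partner ` B)" "anchor (partner d) \<in> V - (B \<union> partner ` B)" if "d \<in> B" for d
    using that B bb anchor_not_bad anchor_V bad_facts(5) by blast+
  obtain c' where "valid c' ((V - (B \<union> partner ` B)) \<union> B \<union> partner ` B)"
  proof (rule add_bad_paths[OF c \<open>finite B\<close>])
    fix d assume "d \<in> B"
    then show "bad d \<and> d \<notin> V - (B \<union> partner ` B) \<and> partner d \<notin> V - (B \<union> partner ` B) \<and> anchor d \<in> V - (B \<union> partner ` B) \<and> anchor (partner d) \<in> V - (B \<union> partner ` B)"
      using B anchor by blast
    show "c (anchor d) \<noteq> Fo \<or> card (nb (anchor d) \<inter> (V - (B \<union> partner ` B) \<union> B \<union> partner ` B)) \<le> 3"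
      using B \<open>d \<in> B\<close> by blast
  qed blast
  moreover have "(V - (B \<union> partner ` B)) \<union> B \<union> partner ` B = V" using BV by auto
  ultimately show False using uncol by simp
qed

text \<open>Without its links \<open>v\<close> hangs at \<open>q\<close> alone and is easy to colour
  outside the forest. As \<open>q\<close> may be bad as well, the case that all neighbours of
  \<open>v\<close> are bad is included.\<close>

definition almost_bad :: "'a \<Rightarrow> 'a \<Rightarrow> bool" where
  "almost_bad v q \<longleftrightarrow> adj v q \<and> 4 \<le> card (nb v) \<and> (\<forall>u\<in>nb v. u \<noteq> q \<longrightarrow> bad u)"

lemma almost_bad_facts:
  assumes "almost_bad v q" defines "B \<equiv> nb v - {q}"
  shows "v \<in> V" "q \<in> V" "v \<noteq> q" "\<And>d. d \<in> B \<Longrightarrow> bad d \<and> anchor d = v" "\<And>d. d \<in> B \<union> partner ` B \<Longrightarrow> bad d"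
    "v \<notin> B \<union> partner ` B" "q \<notin> B \<union> partner ` B" "\<And>x. adj v x \<longleftrightarrow> x = q \<or> x \<in> B" "B \<union> partner ` B \<subseteq> V"
proof -
  have a: "adj v q" "4 \<le> card (nb v)" "\<forall>u\<in>nb v. u \<noteq> q \<longrightarrow> bad u" using assms by (auto simp: almost_bad_def)
  show "v \<in> V" "q \<in> V" "v \<noteq> q" using a adjV adjV2 irr by auto
  show b1: "bad d \<and> anchor d = v" if "d \<in> B" for d using that a anchor_eq[of d v] by (auto simp: B_def)
  then show b2: "bad d" if "d \<in> B \<union> partner ` B" for d using that bad_facts(5) by blast
  have nv: "\<not> bad v" using a not_bad_deg by force
  then show "v \<notin> B \<union> partner ` B" using b2 by blast
  show "q \<notin> B \<union> partner ` B"
  proof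
    assume "q \<in> B \<union> partner ` B"
    moreover have "q \<notin> B" by (simp add: B_def)
    ultimately obtain d where d: "d \<in> B" "q = partner d" by blast
    then have "adj v d" "adj d q" using bad_adj[of d] b1 by auto
    then show False using no3[of v d q] a(1) sym by blast
  qed
  show "adj v x \<longleftrightarrow> x = q \<or> x \<in> B" for x using a by (auto simp: B_def)
  show "B \<union> partner ` B \<subseteq> V" using b2 bad_V by blast
qed

text \<open>\<open>v\<close> takes a colour outside the forest that differs from the colour of the
  other neighbour \<open>z\<close> of \<open>q\<close>. Then \<open>q\<close> fits into the forest,
  and the links return at \<open>v\<close>.\<close>

lemma almost_bad_not_deg2:
  assumes A: "almost_bad v q" shows "card (nb q) \<noteq> 2"
proof
  assume "card (nb q) = 2"
  define B where "B = nb v - {q}"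
  note f = almost_bad_facts[OF A, folded B_def]
  have "adj q v" using f(8) sym by blast
  then obtain z where z: "nb q = {v, z}" "v \<noteq> z" using deg2_nb \<open>card (nb q) = 2\<close> by blast
  have aq: "adj q x \<longleftrightarrow> x = v \<or> x = z" for x using z in_nb by blast
  define W where "W = V - (insert v (insert q (B \<union> partner ` B)))"
  have "insert v (insert q (B \<union> partner ` B)) \<subseteq> V" using f(1,2,9) by auto
  then obtain c where c: "valid c W" using colouring_off[of "insert v (insert q (B \<union> partner ` B))"] unfolding W_def by auto
  define k where "k = (if c z = On then Tw else On)"
  have zq: "z \<noteq> q" using aq irr by blast
  have 1: "valid (c(v := k)) (insert v W)"
    by (rule add_isolated[OF c]) (use f in \<open>auto simp: W_def\<close>)
  have 2: "valid (c(v := k, q := Fo)) (insert q (insert v W))"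
    by (rule leafFo[OF 1]) (use f(2,3) aq z in \<open>auto simp: W_def k_def split: if_splits\<close>)
  have "insert q (insert v W) = V - (B \<union> partner ` B)" using f(1,2,6,7) by (auto simp: W_def)
  with 2 have "valid (c(v := k, q := Fo)) (V - (B \<union> partner ` B))" by simp
  then show False by (rule no_bad_path_completion) (use f(3,4) in \<open>auto simp: k_def\<close>)
qed

text \<open>If neither \<open>On\<close> nor \<open>Tw\<close> is possible at \<open>v\<close>, then
  \<open>q\<close> is \<open>Fo\<close> and its two other neighbours carry \<open>On\<close> and
  \<open>Tw\<close>; this is \<open>main\<close>. For degree 4, \<open>q\<close> is uncoloured and
  \<open>v\<close> becomes \<open>Fo\<close>: it now has only three neighbours, its links return,
  and \<open>q\<close> is attached to \<open>v\<close> as a leaf of the forest. If a neighbour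
  \<open>a\<close> of \<open>q\<close> has degree 2, it moves to the forest and \<open>v\<close>
  inherits its old colour.\<close>

lemma almost_bad_deg3:
  assumes A: "almost_bad v q" and q3: "card (nb q) = 3"
  shows "card (nb v) \<noteq> 4" "adj q a \<Longrightarrow> card (nb a) \<noteq> 2"
proof -
  define B where "B = nb v - {q}"
  note f = almost_bad_facts[OF A, folded B_def]
  define W where "W = V - (insert v (B \<union> partner ` B))"
  have qv: "adj q v" using f(8) sym by blast
  have nb: "\<not> bad q" using not_bad_deg q3 by auto
  have inW: "x \<in> W" if "adj q x" "x \<noteq> v" for x
  proof -
    have "\<not> bad x" using that q3 anchor_eq[of x q] bad_facts(7)[of x] by auto
    then show ?thesis using that f(5)[of x] adjV2[of q x] unfolding W_def by blast
  qed
  have main: "\<exists>c. valid c W \<and> c q = Fo \<and> c a \<noteq> c b \<and> c a \<noteq> Fo \<and> c b \<noteq> Fo"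
    if n: "nb q = {v, a, b}" "a \<noteq> b" "v \<noteq> a" "v \<noteq> b" for a b
  proof (rule ccontr)
    assume H: "\<not> ?thesis"
    have aq: "adj q x \<longleftrightarrow> x = v \<or> x = a \<or> x = b" for x using n in_nb by blast
    have ne: "a \<noteq> q" "b \<noteq> q" using aq irr by blast+
    have ab: "a \<in> W" "b \<in> W" "q \<in> W" "v \<notin> W" using inW aq n f(2,3,7) by (auto simp: W_def)
    have nv: "x = q" if "x \<in> W" "adj v x" for x using that f(8) by (auto simp: W_def)
    have fin: False if "valid (c(v := k)) (insert v W)" "k \<noteq> Fo" for c k
    proof -
      have "insert v W = V - (B \<union> partner ` B)" using f(1,6) by (auto simp: W_def)
      then show False using no_bad_path_completion[of "c(v := k)" B] that f(4) by auto
    qed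
    have "insert v (B \<union> partner ` B) \<subseteq> V" using f(1,9) by auto
    then obtain c where c: "valid c W" using colouring_off[of "insert v (B \<union> partner ` B)"] unfolding W_def by auto
    consider "c q = Tw" | "c q = On" | "c q = Fo" by (cases "c q") auto
    then show False
    proof cases
      case 1
      have "valid (c(v := On)) (insert v W)"
        by (rule addOn[OF c]) (use f(1) 1 nv ab in auto)
      then show False by (rule fin) simp
    next
      case 2
      show False
      proof (cases "c a \<noteq> Tw \<and> c b \<noteq> Tw")
        case True
        have "valid (c(v := Tw)) (insert v W)"
          by (rule addTw[OF c]) (use f(1) 2 nv ab aq True in auto)
        then show False by (rule fin) simp
      next
        case False
        \<comment> \<open>Next to \<open>q\<close> coloured \<open>On\<close> there is no second
          \<open>On\<close>, and two \<open>Tw\<close> would share the neighbour \<open>q\<close>.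
          So one of \<open>a\<close> and \<open>b\<close> is \<open>Tw\<close> and the other
          \<open>Fo\<close>, and \<open>q\<close> can be recoloured as a leaf.\<close>
        have no: "c a \<noteq> On" "c b \<noteq> On" "\<not> (c a = Tw \<and> c b = Tw)"
          using c 2 ab aq n(2) unfolding valid_def by (metis hue.distinct)+
        have "valid c (W - {q})" using c valid_mono by blast
        then have "valid (c(q := Fo)) (insert q (W - {q}))"
          by (rule leafFo) (use f(2) no False ne aq ab in auto)
        moreover have "insert q (W - {q}) = W" using ab by auto
        ultimately have c1: "valid (c(q := Fo)) W" by simp
        have "valid (c(q := Fo, v := On)) (insert v W)"
          by (rule addOn[OF c1]) (use f(1) no nv ab aq ne in auto)
        then show False by (rule fin) simp
      qed
    next
      case 3
      have "valid (c(v := On)) (insert v W)" if "c a \<noteq> On" "c b \<noteq> On"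
        by (rule addOn[OF c]) (use f(1) 3 nv ab that aq in auto)
      moreover have "valid (c(v := Tw)) (insert v W)" if "c a \<noteq> Tw" "c b \<noteq> Tw"
        by (rule addTw[OF c]) (use f(1) 3 nv ab that aq in auto)
      ultimately have "(c a = On \<or> c b = On) \<and> (c a = Tw \<or> c b = Tw)" using fin by blast
      then show False using H c 3 by auto
    qed
  qed
  obtain S where S: "nb q = insert v S" "v \<notin> S" "card S = 2"
  proof (rule that)
    show "nb q = insert v (nb q - {v})" using qv by auto
    show "card (nb q - {v}) = 2" using q3 qv by simp
  qed simp
  obtain a0 b0 where ab0: "S = {a0, b0}" "a0 \<noteq> b0" using S(3) unfolding card_2_iff by blast
  show "card (nb v) \<noteq> 4"
  proof
    assume v4: "card (nb v) = 4"
    obtain c where c: "valid c W" "c q = Fo" "c a0 \<noteq> c b0" "c a0 \<noteq> Fo" "c b0 \<noteq> Fo"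
      using main[of a0 b0] S ab0 by auto
    have aq: "adj q x \<longleftrightarrow> x = v \<or> x = a0 \<or> x = b0" for x using S ab0 in_nb by blast
    have ab: "a0 \<in> W" "b0 \<in> W" "q \<in> W" "v \<notin> W" using inW aq S ab0 f(2,3,7) by (auto simp: W_def)
    have ne: "a0 \<noteq> q" "b0 \<noteq> q" using aq irr by blast+
    have "valid c (W - {q})" using c(1) valid_mono by blast
    then have c1: "valid (c(v := Fo)) (insert v (W - {q}))"
      by (rule add_isolated) (use f(1,8) in \<open>auto simp: W_def\<close>)
    have Wq: "insert v (W - {q}) \<union> B \<union> partner ` B = V - {q}" using f by (auto simp: W_def)
    have card3: "card (nb v \<inter> (V - {q})) \<le> 3"
    proof -
      have "nb v \<inter> (V - {q}) \<subseteq> nb v - {q}" by auto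
      then have "card (nb v \<inter> (V - {q})) \<le> card (nb v - {q})" by (intro card_mono) auto
      also have "\<dots> = 3" using v4 f(8) by auto
      finally show ?thesis .
    qed
    obtain c2 where c2: "valid c2 (insert v (W - {q}) \<union> B \<union> partner ` B)" "\<And>x. x \<in> insert v (W - {q}) \<Longrightarrow> c2 x = (c(v := Fo)) x"
    proof (rule add_bad_paths[OF c1, of B])
      show "finite B" unfolding B_def by auto
      fix d assume d: "d \<in> B"
      then have e: "anchor d = v" "bad d" "bad (partner d)" using f(4) bad_facts(5) by blast+
      have "d \<in> B \<union> partner ` B" "partner d \<in> B \<union> partner ` B" using d by auto
      then have dW: "d \<notin> W" "partner d \<notin> W" "d \<noteq> v" "partner d \<noteq> v" using f(6) by (auto simp: W_def)
      have "anchor (partner d) \<noteq> q"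
      proof
        assume "anchor (partner d) = q"
        then have "adj (partner d) q" "adj v d" "adj d (partner d)" using e bad_adj by blast+
        then show False using no4[of v d "partner d" q] qv d f(6,7) by blast
      qed
      moreover have "anchor (partner d) \<in> V" "\<not> bad (anchor (partner d))" using e anchor_V anchor_not_bad by blast+
      ultimately have "anchor (partner d) \<in> insert v (W - {q})" using f(5) by (auto simp: W_def)
      then show "bad d \<and> d \<notin> insert v (W - {q}) \<and> partner d \<notin> insert v (W - {q}) \<and> anchor d \<in> insert v (W - {q}) \<and> anchor (partner d) \<in> insert v (W - {q})"
        using e dW by auto
      show "(c(v := Fo)) (anchor d) \<noteq> Fo \<or> card (nb (anchor d) \<inter> (insert v (W - {q}) \<union> B \<union> partner ` B)) \<le> 3"
        using card3 e Wq by simp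
    qed (use that in blast)
    have cc: "c2 v = Fo" "c2 a0 = c a0" "c2 b0 = c b0" using c2(2) ab ne by auto
    have "valid (c2(q := Fo)) (insert q (V - {q}))"
    proof (rule leafFo)
      show "valid c2 (V - {q})" using c2(1) Wq by simp
    qed (use f(2) aq c cc in auto)
    then show False using uncol f(2) by (simp add: insert_absorb)
  qed
  show "card (nb a) \<noteq> 2" if "adj q a"
  proof
    assume a2: "card (nb a) = 2"
    have "a \<noteq> v" using a2 A by (auto simp: almost_bad_def)
    then have "a \<in> S" using that S(1) in_nb by blast
    define b where "b = (if a = a0 then b0 else a0)"
    have "S = {a, b}" "a \<noteq> b" using ab0 \<open>a \<in> S\<close> by (auto simp: b_def)
    then have ab: "nb q = {v, a, b}" "a \<noteq> b" "v \<noteq> a" "v \<noteq> b" using S by auto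
    obtain c where c: "valid c W" "c q = Fo" "c a \<noteq> c b" "c a \<noteq> Fo" "c b \<noteq> Fo"
      using main[OF ab] by auto
    have aq: "adj q x \<longleftrightarrow> x = v \<or> x = a \<or> x = b" for x using ab in_nb by blast
    have inn: "a \<in> W" "b \<in> W" "q \<in> W" "v \<notin> W" using inW aq ab f(2,3,7) by (auto simp: W_def)
    have ne: "a \<noteq> q" "b \<noteq> q" using aq irr by blast+
    have "adj a q" using that sym by blast
    then obtain r where r: "nb a = {q, r}" "q \<noteq> r" using deg2_nb[OF a2] by blast
    have aa: "adj a x \<longleftrightarrow> x = q \<or> x = r" for x using r in_nb by blast
    have nv: "x = q" if "x \<in> W" "adj v x" for x using that f(8) by (auto simp: W_def)
    have "valid c (W - {a})" using c(1) valid_mono by blast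
    then have "valid (c(a := Fo)) (insert a (W - {a}))"
      by (rule addFo) (use inn valid_sub[OF c(1)] aa aq c ne in auto)
    moreover have "insert a (W - {a}) = W" using inn by auto
    ultimately have c1: "valid (c(a := Fo)) W" by simp
    have "valid (c(a := Fo, v := c a)) (insert v W)"
    proof (cases "c a")
      case On
      show ?thesis unfolding On
        by (rule addOn[OF c1]) (use f(1) inn nv aq c On ne in auto)
    next
      case Tw
      show ?thesis unfolding Tw
        by (rule addTw[OF c1]) (use f(1) inn nv aq c Tw ne in auto)
    qed (use c in auto)
    moreover have "insert v W = V - (B \<union> partner ` B)" using f(1,6) by (auto simp: W_def)
    ultimately show False using no_bad_path_completion[of "c(a := Fo, v := c a)" B] c f(4) by auto
  qed
qed

text \<open>Without the links at both vertices the edge between \<open>v\<close> and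
  \<open>x\<close> is a component of its own and takes \<open>On\<close> and \<open>Tw\<close>,
  which serves all the links.\<close>

lemma almost_bad_asym:
  assumes A: "almost_bad v x" "almost_bad x v" shows False
proof -
  define B1 where "B1 = nb v - {x}"
  define B2 where "B2 = nb x - {v}"
  note f = almost_bad_facts[OF A(1), folded B1_def]
  note g = almost_bad_facts[OF A(2), folded B2_def]
  define B where "B = B1 \<union> B2"
  have pB: "partner ` B = partner ` B1 \<union> partner ` B2" by (auto simp: B_def)
  define W where "W = V - (insert v (insert x (B \<union> partner ` B)))"
  have "insert v (insert x (B \<union> partner ` B)) \<subseteq> V" using f(1,2,9) g(9) B_def by auto
  then obtain c where c: "valid c W" using colouring_off[of "insert v (insert x (B \<union> partner ` B))"] unfolding W_def by auto
  have 1: "valid (c(v := On)) (insert v W)"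
    by (rule add_isolated[OF c]) (use f(1,8) B_def in \<open>auto simp: W_def\<close>)
  have 2: "valid (c(v := On, x := Tw)) (insert x (insert v W))"
    by (rule addTw[OF 1]) (use f(2,3,8) g(8) irr B_def in \<open>auto simp: W_def\<close>)
  have "insert x (insert v W) = V - (B \<union> partner ` B)"
    using f(1,2,6,7) g(6,7) unfolding W_def pB B_def by blast
  with 2 have "valid (c(v := On, x := Tw)) (V - (B \<union> partner ` B))" by simp
  then show False by (rule no_bad_path_completion) (use f(3,4) g(4) in \<open>auto simp: B_def\<close>)
qed

section \<open>Reducible configurations\<close>

lemma add_deg2:
  assumes c: "valid c W" and v: "v \<notin> W" "nb v = {a, b}"
    and h: "\<lbrakk>a \<in> W; b \<in> W; c a = c b\<rbrakk> \<Longrightarrow> c a = Fo \<and> (\<forall>z\<in>W. adj a z \<longrightarrow> c z \<noteq> Fo)"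
  shows "valid (c(v := Fo)) (insert v W)"
proof -
  have av: "adj v x \<longleftrightarrow> x = a \<or> x = b" for x using v in_nb by blast
  show ?thesis
  proof (rule addFo[OF c _ v(1)])
    show "v \<in> V" using av[of a] adjV by blast
    fix x y assume a: "x \<in> W" "y \<in> W" "adj v x" "adj v y" "x \<noteq> y" "c x = c y"
    then consider "x = a" "y = b" | "x = b" "y = a" unfolding av by blast
    then show "c x = Fo \<and> ((\<forall>z\<in>W. adj x z \<longrightarrow> c z \<noteq> Fo) \<or> (\<forall>z\<in>W. adj y z \<longrightarrow> c z \<noteq> Fo))"
      by cases (use a h in auto)
  qed
qed

text \<open>The order matters: \<open>t1\<close> may rely on \<open>y\<close> being isolated in the
  forest, but it destroys this, so \<open>t2\<close> must rely on \<open>s2\<close> having another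
  colour than \<open>y\<close>.\<close>

lemma leaves2_aux:
  assumes c: "valid c W" and t: "t1 \<noteq> t2" "t1 \<notin> W" "t2 \<notin> W"
    and n: "nb t1 = {y, s1}" "nb t2 = {y, s2}" and W: "y \<in> W" "s1 \<in> W" "s2 \<in> W"
    and h: "c s2 \<noteq> c y" "c s1 = c y \<Longrightarrow> c y = Fo \<and> (\<forall>z\<in>W. adj y z \<longrightarrow> c z \<noteq> Fo)"
  shows "valid (c(t1 := Fo, t2 := Fo)) (insert t2 (insert t1 W))"
proof -
  have a1: "adj t1 x \<longleftrightarrow> x = y \<or> x = s1" and a2: "adj t2 x \<longleftrightarrow> x = y \<or> x = s2" for x using n in_nb by blast+
  have V: "t1 \<in> V" "t2 \<in> V" using a1[of y] a2[of y] adjV by auto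
  have ne: "y \<noteq> t1" "y \<noteq> t2" "s1 \<noteq> t1" "s1 \<noteq> t2" "s2 \<noteq> t1" "s2 \<noteq> t2" using t W by auto
  have 1: "valid (c(t1 := Fo)) (insert t1 W)"
    by (rule addFo[OF c V(1) t(2)]) (use a1 h(2) in auto)
  show ?thesis
    by (rule leafFo[OF 1 V(2)]) (use a2 ne t W h in auto)
qed

text \<open>In both alternatives at least one outer end differs in colour from \<open>y\<close>; its
  vertex is inserted last.\<close>

lemma leaves2:
  assumes c: "valid c W" and t: "t1 \<noteq> t2" "t1 \<notin> W" "t2 \<notin> W"
    and n: "nb t1 = {y, s1}" "nb t2 = {y, s2}" and W: "y \<in> W" "s1 \<in> W" "s2 \<in> W"
    and h: "c y \<noteq> Fo \<and> c s1 \<noteq> c y \<and> c s2 \<noteq> c y \<or>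
      c y = Fo \<and> (\<forall>z\<in>W. adj y z \<longrightarrow> c z \<noteq> Fo) \<and> \<not> (c s1 = Fo \<and> c s2 = Fo)"
  shows "valid (c(t1 := Fo, t2 := Fo)) (W \<union> {t1, t2})"
proof (cases "c s2 = c y")
  case False
  have "valid (c(t1 := Fo, t2 := Fo)) (insert t2 (insert t1 W))"
    by (rule leaves2_aux[OF c t n W]) (use False h in auto)
  then show ?thesis by (simp add: insert_commute)
next
  case True
  have "valid (c(t2 := Fo, t1 := Fo)) (insert t1 (insert t2 W))"
    by (rule leaves2_aux[OF c t(1)[symmetric] t(3,2) n(2,1) W(1,3,2)]) (use True h in auto)
  then show ?thesis using t(1) by (simp add: fun_upd_twist)
qed

text \<open>The only neighbour of \<open>y\<close> that need not have degree 2 is \<open>x\<close>; the ends \<open>s1\<close> and \<open>s2\<close> may be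
  assumed to have larger degree because links end in vertices of degree at least 4.\<close>

definition twig :: "'a \<Rightarrow> 'a \<Rightarrow> 'a \<Rightarrow> 'a \<Rightarrow> 'a \<Rightarrow> 'a \<Rightarrow> bool" where
  "twig x y t1 t2 s1 s2 \<longleftrightarrow> nb y = {x, t1, t2} \<and> x \<noteq> t1 \<and> x \<noteq> t2 \<and> t1 \<noteq> t2 \<and>
     nb t1 = {y, s1} \<and> nb t2 = {y, s2} \<and> y \<noteq> s1 \<and> y \<noteq> s2 \<and> card (nb s1) \<noteq> 2 \<and> card (nb s2) \<noteq> 2"

lemma bad_end_deg3:
  assumes "card (nb y) = 3" "adj y t" shows "\<not> bad t"
  using anchor_eq[of t y] bad_facts(7)[of t] assms by fastforce

lemma other_end_not_deg2:
  assumes "card (nb y) = 3" "nb t = {y, s}" "y \<noteq> s" shows "card (nb s) \<noteq> 2"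
proof
  assume "card (nb s) = 2"
  moreover have "adj t s" "adj y t" using assms(2) in_nb sym by blast+
  ultimately have "bad t" using assms by (auto simp: bad_def)
  then show False using bad_end_deg3[OF assms(1) \<open>adj y t\<close>] by blast
qed

lemma deg3_nb:
  assumes "card (nb y) = 3" "adj y x"
  obtains a b where "nb y = {x, a, b}" "x \<noteq> a" "x \<noteq> b" "a \<noteq> b"
proof -
  have "card (nb y - {x}) = 2" using assms by simp
  then obtain a b where "nb y - {x} = {a, b}" "a \<noteq> b" unfolding card_2_iff by blast
  then show ?thesis using that[of a b] assms(2) by (metis DiffD2 in_nb insertCI insert_Diff)
qed

lemma twigI:
  assumes y: "card (nb y) = 3" "adj y x" and o: "\<And>z. adj y z \<Longrightarrow> z \<noteq> x \<Longrightarrow> card (nb z) = 2"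
  obtains t1 t2 s1 s2 where "twig x y t1 t2 s1 s2"
proof -
  obtain a b where ab: "nb y = {x, a, b}" "x \<noteq> a" "x \<noteq> b" "a \<noteq> b" using deg3_nb[OF y] by blast
  have adj: "adj y a" "adj y b" using ab in_nb by blast+
  have ay: "adj a y" "adj b y" using adj sym by blast+
  have c2: "card (nb a) = 2" "card (nb b) = 2" using o adj ab by auto
  obtain s1 where s1: "nb a = {y, s1}" "y \<noteq> s1" using deg2_nb[OF c2(1) ay(1)] by blast
  obtain s2 where s2: "nb b = {y, s2}" "y \<noteq> s2" using deg2_nb[OF c2(2) ay(2)] by blast
  show ?thesis using that[of a b s1 s2] ab s1 s2 other_end_not_deg2[OF y(1) s1] other_end_not_deg2[OF y(1) s2]
    by (simp add: twig_def)
qed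

lemma twigD:
  assumes "twig x y t1 t2 s1 s2"
  shows "adj y z \<longleftrightarrow> z = x \<or> z = t1 \<or> z = t2" "adj t1 z \<longleftrightarrow> z = y \<or> z = s1" "adj t2 z \<longleftrightarrow> z = y \<or> z = s2"
    "x \<noteq> y" "x \<noteq> t1" "x \<noteq> t2" "y \<noteq> t1" "y \<noteq> t2" "t1 \<noteq> t2" "s1 \<noteq> x" "s2 \<noteq> x" "s1 \<noteq> y" "s2 \<noteq> y"
    "card (nb t1) = 2" "card (nb t2) = 2" "card (nb y) = 3" "card (nb s1) \<noteq> 2" "card (nb s2) \<noteq> 2"
    "\<not> bad t1" "\<not> bad t2" "\<not> bad y" "nb t1 = {y, s1}" "nb t2 = {y, s2}" "y \<in> V" "t1 \<in> V" "t2 \<in> V" "s1 \<in> V" "s2 \<in> V"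
    "adj x y"
proof -
  note a = assms[unfolded twig_def]
  show ay: "adj y z \<longleftrightarrow> z = x \<or> z = t1 \<or> z = t2" for z using a in_nb by blast
  show a1: "adj t1 z \<longleftrightarrow> z = y \<or> z = s1" for z using a in_nb by blast
  show a2: "adj t2 z \<longleftrightarrow> z = y \<or> z = s2" for z using a in_nb by blast
  show n: "x \<noteq> y" "x \<noteq> t1" "x \<noteq> t2" "y \<noteq> t1" "y \<noteq> t2" "t1 \<noteq> t2" "s1 \<noteq> y" "s2 \<noteq> y" "card (nb s1) \<noteq> 2" "card (nb s2) \<noteq> 2"
    using a ay[of y] irr by auto
  show "nb t1 = {y, s1}" "nb t2 = {y, s2}" using a by auto
  show "card (nb t1) = 2" "card (nb t2) = 2" "card (nb y) = 3" using a n by auto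
  show "s1 \<noteq> x" using no3[of y t1 x] ay[of t1] a1[of s1] sym[of y x] ay[of x] by auto
  show "s2 \<noteq> x" using no3[of y t2 x] ay[of t2] a2[of s2] sym[of y x] ay[of x] by auto
  show "\<not> bad t1" "\<not> bad t2" using bad_end_deg3[OF \<open>card (nb y) = 3\<close>] ay by auto
  show "\<not> bad y" using not_bad_deg \<open>card (nb y) = 3\<close> by auto
  show "y \<in> V" "t1 \<in> V" "t2 \<in> V" using ay[of t1] ay[of t2] adjV adjV2 by auto
  show "s1 \<in> V" "s2 \<in> V" using a1[of s1] a2[of s2] adjV2 by auto
  show "adj x y" using ay[of x] sym by auto
qed

text \<open>A neighbour \<open>y\<close> of degree 3 whose other neighbours have degree 2 never obstructs a vertex \<open>x\<close>
  coloured \<open>Tw\<close>: colour \<open>y\<close> with \<open>On\<close> or \<open>Fo\<close>.\<close>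

lemma add_twig:
  assumes T: "twig x y t1 t2 s1 s2" and c: "valid c W" and W: "y \<notin> W" "t1 \<notin> W" "t2 \<notin> W" "x \<in> W" "s1 \<in> W" "s2 \<in> W"
    and cx: "c x \<noteq> Fo" and h: "c s1 = Fo \<Longrightarrow> c s2 = Fo \<Longrightarrow> c x = Tw \<or> (\<forall>z\<in>W. adj x z \<longrightarrow> c z \<noteq> Tw)"
  obtains c' where "valid c' (W \<union> {y, t1, t2})" "\<And>z. z \<in> W \<Longrightarrow> c' z = c z"
proof -
  note d = twigD[OF T]
  have ne: "s1 \<noteq> t1" "s1 \<noteq> t2" "s2 \<noteq> t1" "s2 \<noteq> t2" using W by auto
  \<comment> \<open>\<open>Fo\<close> suits \<open>y\<close> unless both outer ends are
    \<open>Fo\<close>, where the two leaves might close a cycle through \<open>y\<close>. In that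
    case \<open>y\<close> takes \<open>On\<close> beside \<open>Tw\<close>, since no path through
    \<open>x\<close> counts for \<open>On\<close>, or \<open>Tw\<close> beside \<open>On\<close>,
    which is where the condition \<open>h\<close> enters.\<close>
  have "\<exists>k. valid (c(y := k)) (insert y W) \<and>
     ((k \<noteq> Fo \<and> c s1 \<noteq> k \<and> c s2 \<noteq> k) \<or> k = Fo \<and> \<not> (c s1 = Fo \<and> c s2 = Fo))"
  proof (cases "c s1 = Fo \<and> c s2 = Fo")
    case False
    have "valid (c(y := Fo)) (insert y W)"
      by (rule leafFo[OF c d(24) W(1)]) (use W d(1) in auto)
    then show ?thesis using False by blast
  next
    case True
    show ?thesis
    proof (cases "c x = Tw")
      case Tw: True
      have "valid (c(y := On)) (insert y W)"
        by (rule addOn[OF c d(24) W(1)]) (use W d(1) Tw in auto)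
      then show ?thesis using True by auto
    next
      case False
      have "valid (c(y := Tw)) (insert y W)"
        by (rule addTw[OF c d(24) W(1)]) (use W d(1) False h True in auto)
      then show ?thesis using True by auto
    qed
  qed
  then obtain k where k: "valid (c(y := k)) (insert y W)"
    "(k \<noteq> Fo \<and> c s1 \<noteq> k \<and> c s2 \<noteq> k) \<or> k = Fo \<and> \<not> (c s1 = Fo \<and> c s2 = Fo)" by blast
  have "valid (c(y := k, t1 := Fo, t2 := Fo)) (insert y W \<union> {t1, t2})"
    by (rule leaves2[OF k(1) d(9) _ _ d(22,23)]) (use W k(2) cx d(1,4,7,8,12,13) irr in auto)
  moreover have "insert y W \<union> {t1, t2} = W \<union> {y, t1, t2}" by auto
  moreover have "(c(y := k, t1 := Fo, t2 := Fo)) z = c z" if "z \<in> W" for z using that W by auto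
  ultimately show ?thesis using that[of "c(y := k, t1 := Fo, t2 := Fo)"] by metis
qed

text \<open>If \<open>On\<close> or \<open>Tw\<close> is absent from the three outer ends, it goes
  on \<open>x\<close>. If both occur, two outer ends are outside the forest and \<open>x\<close>
  becomes \<open>Fo\<close>. The last conclusion keeps \<open>x\<close> flexible: it is outside the
  forest or sees only \<open>Fo\<close> on the three rays.\<close>

lemma add_star:
  assumes c: "valid c W" and x: "x \<in> V" "x \<notin> W" "nb x \<inter> W = {}"
    and u: "u1 \<notin> W" "u2 \<notin> W" "u3 \<notin> W" "u1 \<noteq> u2" "u1 \<noteq> u3" "u2 \<noteq> u3" "x \<noteq> u1" "x \<noteq> u2" "x \<noteq> u3"
    and n: "nb u1 = {x, z1}" "nb u2 = {x, z2}" "nb u3 = {x, z3}" and z: "z1 \<in> W" "z2 \<in> W" "z3 \<in> W"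
  obtains c' where "valid c' (W \<union> {x, u1, u2, u3})" "\<And>w. w \<in> W \<Longrightarrow> c' w = c w"
    "c' x \<noteq> Fo \<or> c' u1 = Fo \<and> c' u2 = Fo \<and> c' u3 = Fo"
proof -
  \<comment> \<open>\<open>k\<close> is the colour of \<open>x\<close>. The ray through
    \<open>d\<close> is inserted first, while \<open>x\<close> is still isolated, so for
    \<open>k = Fo\<close> its outer end may have any colour.\<close>
  have A: "\<exists>c'. valid c' (W \<union> {x, a, b, d}) \<and> (\<forall>w\<in>W. c' w = c w) \<and> (c' x \<noteq> Fo \<or> c' a = Fo \<and> c' b = Fo \<and> c' d = Fo)"
    if H: "a \<notin> W" "b \<notin> W" "d \<notin> W" "a \<noteq> b" "a \<noteq> d" "b \<noteq> d" "x \<noteq> a" "x \<noteq> b" "x \<noteq> d"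
      "nb a = {x, p}" "nb b = {x, q}" "nb d = {x, r}" "p \<in> W" "q \<in> W" "r \<in> W"
      and k: "c p \<noteq> k" "c q \<noteq> k" "k = Fo \<or> c r \<noteq> k" for a b d p q r k
  proof -
    have aj: "adj a w \<longleftrightarrow> w = x \<or> w = p" "adj b w \<longleftrightarrow> w = x \<or> w = q" "adj d w \<longleftrightarrow> w = x \<or> w = r" for w
      using H in_nb by blast+
    have V: "a \<in> V" "b \<in> V" "d \<in> V" using aj(1)[of x] aj(2)[of x] aj(3)[of x] adjV by auto
    have nx: "\<And>w. w \<in> W \<Longrightarrow> \<not> adj x w" using x by auto
    have ne: "p \<noteq> x" "q \<noteq> x" "r \<noteq> x" "p \<noteq> a" "p \<noteq> b" "p \<noteq> d" "q \<noteq> a" "q \<noteq> b" "q \<noteq> d" "r \<noteq> a" "r \<noteq> b" "r \<noteq> d"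
      using H x by auto
    have 1: "valid (c(x := k)) (insert x W)" by (rule add_isolated[OF c x])
    have 2: "valid (c(x := k, d := Fo)) (insert d (insert x W))"
      by (rule add_deg2[OF 1 _ H(12)]) (use H(3,9) k(3) nx irr ne(3) in auto)
    have 3: "valid (c(x := k, d := Fo, a := Fo)) (insert a (insert d (insert x W)))"
      by (rule add_deg2[OF 2 _ H(10)]) (use H(1,5,7,9) k(1) ne(1,4,6) in auto)
    have 4: "valid (c(x := k, d := Fo, a := Fo, b := Fo)) (insert b (insert a (insert d (insert x W))))"
      by (rule add_deg2[OF 3 _ H(11)]) (use H(2,4,6,7,8,9) k(2) ne(2,7,8,9) in auto)
    have "insert b (insert a (insert d (insert x W))) = W \<union> {x, a, b, d}" by auto
    with 4 show ?thesis using H x by (intro exI[of _ "c(x := k, d := Fo, a := Fo, b := Fo)"]) auto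
  qed
  have s: "{x, u1, u3, u2} = {x, u1, u2, u3}" "{x, u2, u3, u1} = {x, u1, u2, u3}" by auto
  have "\<exists>c'. valid c' (W \<union> {x, u1, u2, u3}) \<and> (\<forall>w\<in>W. c' w = c w) \<and> (c' x \<noteq> Fo \<or> c' u1 = Fo \<and> c' u2 = Fo \<and> c' u3 = Fo)"
  proof -
    consider k where "k \<noteq> Fo" "c z1 \<noteq> k" "c z2 \<noteq> k" "c z3 \<noteq> k" | "c z1 \<noteq> Fo" "c z2 \<noteq> Fo"
      | "c z1 \<noteq> Fo" "c z3 \<noteq> Fo" | "c z2 \<noteq> Fo" "c z3 \<noteq> Fo"
      by (cases "c z1"; cases "c z2"; cases "c z3") auto
    then show ?thesis
    proof cases
      case (1 k)
      then show ?thesis using A[of u1 u2 u3 z1 z2 z3 k] u n z by auto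
    next
      case 2
      then show ?thesis using A[of u1 u2 u3 z1 z2 z3 Fo] u n z by auto
    next
      case 3
      then show ?thesis using A[of u1 u3 u2 z1 z3 z2 Fo] u n z s by auto
    next
      case 4
      then show ?thesis using A[of u2 u3 u1 z2 z3 z1 Fo] u n z s by auto
    qed
  qed
  then show ?thesis using that by blast
qed

section \<open>Excluded neighbourhoods\<close>

lemma deg3_not_all_deg2:
  assumes v3: "card (nb v) = 3" and all: "\<And>u. adj v u \<Longrightarrow> card (nb u) = 2" shows False
proof -
  obtain u1 where "adj v u1" using v3 by (metis card.empty ex_in_conv in_nb zero_neq_numeral)
  then obtain u2 u3 where u: "nb v = {u1, u2, u3}" "u1 \<noteq> u2" "u1 \<noteq> u3" "u2 \<noteq> u3"
    using deg3_nb[OF v3] by metis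
  have av: "adj v w \<longleftrightarrow> w = u1 \<or> w = u2 \<or> w = u3" for w using u in_nb by blast
  have au: "adj u1 v" "adj u2 v" "adj u3 v" using av[of u1] av[of u2] av[of u3] sym by auto
  have c2: "card (nb u1) = 2" "card (nb u2) = 2" "card (nb u3) = 2" using all av by auto
  obtain z1 where z1: "nb u1 = {v, z1}" "v \<noteq> z1" using deg2_nb[OF c2(1) au(1)] by blast
  obtain z2 where z2: "nb u2 = {v, z2}" "v \<noteq> z2" using deg2_nb[OF c2(2) au(2)] by blast
  obtain z3 where z3: "nb u3 = {v, z3}" "v \<noteq> z3" using deg2_nb[OF c2(3) au(3)] by blast
  have d: "card (nb z1) \<noteq> 2" "card (nb z2) \<noteq> 2" "card (nb z3) \<noteq> 2"
    using other_end_not_deg2[OF v3 z1] other_end_not_deg2[OF v3 z2] other_end_not_deg2[OF v3 z3] by auto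
  have az: "adj u1 z1" "adj u2 z2" "adj u3 z3" using z1 z2 z3 in_nb by blast+
  have V: "v \<in> V" "u1 \<in> V" "u2 \<in> V" "u3 \<in> V" "z1 \<in> V" "z2 \<in> V" "z3 \<in> V"
    using au az adjV adjV2 by blast+
  define W where "W = V - {v, u1, u2, u3}"
  have "{v, u1, u2, u3} \<subseteq> V" using V by auto
  then obtain c where c: "valid c W" using colouring_off[of "{v, u1, u2, u3}"] unfolding W_def by auto
  have zW: "z1 \<in> W" "z2 \<in> W" "z3 \<in> W" using V d c2 z1 z2 z3 by (auto simp: W_def)
  have ne: "v \<noteq> u1" "v \<noteq> u2" "v \<noteq> u3" using au irr by blast+
  have "nb v \<inter> W = {}" using u by (auto simp: W_def)
  obtain c' where "valid c' (W \<union> {v, u1, u2, u3})"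
    by (rule add_star[OF c V(1) _ \<open>nb v \<inter> W = {}\<close> _ _ _ u(2,3,4) ne z1(1) z2(1) z3(1) zW]) (auto simp: W_def)
  moreover have "W \<union> {v, u1, u2, u3} = V" using V by (auto simp: W_def)
  ultimately show False using uncol by simp
qed

text \<open>With the link at \<open>d\<close> removed, \<open>add_star\<close> colours
  \<open>x\<close> and its three other neighbours. Afterwards \<open>x\<close> is outside the forest
  or sees no \<open>On\<close>, so it is flexible and takes the link back.\<close>

lemma deg4_not_all_deg2:
  assumes x4: "card (nb x) = 4" and all: "\<And>u. adj x u \<Longrightarrow> card (nb u) = 2" and d: "bad d" "adj x d" shows False
proof -
  have anchor: "anchor d = x" using anchor_eq d x4 by auto
  have "card (nb x - {d}) = 3" using x4 d by simp
  then obtain u1 u2 u3 where u: "nb x - {d} = {u1, u2, u3}" "u1 \<noteq> u2" "u1 \<noteq> u3" "u2 \<noteq> u3"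
    by (auto simp: card_3_iff)
  have "u1 \<in> nb x - {d}" "u2 \<in> nb x - {d}" "u3 \<in> nb x - {d}" unfolding u(1) by simp_all
  then have ux: "adj x u1" "adj x u2" "adj x u3" "u1 \<noteq> d" "u2 \<noteq> d" "u3 \<noteq> d" by auto
  have "nb x = insert d (nb x - {d})" using d(2) by (simp add: insert_absorb)
  then have "nb x = {d, u1, u2, u3}" by (simp only: u(1))
  then have ax: "adj x w \<longleftrightarrow> w = d \<or> w = u1 \<or> w = u2 \<or> w = u3" for w using in_nb[of w x] by simp
  have au: "adj u1 x" "adj u2 x" "adj u3 x" using ux sym by auto
  have c2: "card (nb u1) = 2" "card (nb u2) = 2" "card (nb u3) = 2" using all ux by auto
  obtain z1 where z1: "nb u1 = {x, z1}" "x \<noteq> z1" using deg2_nb[OF c2(1) au(1)] by blast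
  obtain z2 where z2: "nb u2 = {x, z2}" "x \<noteq> z2" using deg2_nb[OF c2(2) au(2)] by blast
  obtain z3 where z3: "nb u3 = {x, z3}" "x \<noteq> z3" using deg2_nb[OF c2(3) au(3)] by blast
  have az: "adj u1 z1" "adj u2 z2" "adj u3 z3" using z1 z2 z3 in_nb by blast+
  let ?S = "{x, d, partner d, u1, u2, u3}"
  note bd = bad_adj[OF d(1)] bad_adj[OF bad_facts(5)[OF d(1)]] bad_facts(6)[OF d(1)]
  \<comment> \<open>The other neighbours of \<open>x\<close> may lie on links too, so degrees cannot
    separate their outer ends from the removed vertices; the girth does.\<close>
  have nz: "z \<notin> ?S" if a: "adj x u" "u \<noteq> d" "adj u z" "z \<noteq> x" for u z
  proof
    assume "z \<in> ?S"
    then consider "z = partner d" | "adj x z" using a(4) ux d by auto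
    then show False
    proof cases
      case 1
      have "adj z d" "adj d x" "x \<noteq> z" using 1 bd anchor a(4) by auto
      then show False using no4[of x u z d] a by blast
    next
      case 2
      then show False using no3[of x u z] a sym by blast
    qed
  qed
  have V: "?S \<subseteq> V" using ux adjV2 adjV d bad_V bad_facts(5) by blast
  define W where "W = V - ?S"
  obtain c where c: "valid c W" using colouring_off[OF _ V] unfolding W_def by auto
  have zW: "z1 \<in> W" "z2 \<in> W" "z3 \<in> W"
    using nz[OF ux(1,4) az(1)] nz[OF ux(2,5) az(2)] nz[OF ux(3,6) az(3)] z1 z2 z3 az adjV2 by (auto simp: W_def)
  have ne: "x \<noteq> u1" "x \<noteq> u2" "x \<noteq> u3" using au irr by blast+
  have nW: "x \<in> V" "x \<notin> W" "u1 \<notin> W" "u2 \<notin> W" "u3 \<notin> W" using V by (auto simp: W_def)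
  have "\<not> adj x w" if "w \<in> W" for w using that ax[of w] unfolding W_def by blast
  then have nx: "nb x \<inter> W = {}" by auto
  obtain c1 where c1: "valid c1 (W \<union> {x, u1, u2, u3})" "c1 x \<noteq> Fo \<or> c1 u1 = Fo \<and> c1 u2 = Fo \<and> c1 u3 = Fo"
    by (rule add_star[OF c nW(1,2) nx nW(3,4,5) u(2,3,4) ne z1(1) z2(1) z3(1) zW])
  let ?W = "W \<union> {x, u1, u2, u3}"
  have dW: "d \<notin> ?W" using ux d irr by (auto simp: W_def)
  have pW: "partner d \<notin> ?W"
    using no3[of x _ d] ux anchor bd sym partner_ne[OF d(1)] d(2) by (auto simp: W_def)
  have ep: "anchor (partner d) \<in> V" "\<not> bad (anchor (partner d))" "4 \<le> card (nb (anchor (partner d)))"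
    using anchor_V anchor_not_bad bad_facts(5,7) d(1) by blast+
  then have eW: "anchor (partner d) \<in> ?W" using d(1) bad_facts(5)[OF d(1)] by (auto simp: W_def)
  have "flex c1 ?W x"
  proof (cases "c1 x = Fo")
    case True
    have "c1 w \<noteq> On" if w: "w \<in> ?W" "adj x w" for w
    proof -
      have "w \<noteq> d" using w(1) dW by blast
      then have "w = u1 \<or> w = u2 \<or> w = u3" using ax[of w] w(2) by simp
      then have "c1 w = Fo" using c1(2) True by presburger
      then show ?thesis by simp
    qed
    then show ?thesis unfolding flex_def by blast
  qed (simp add: flex_def)
  then have fl: "flex c1 ?W (anchor d)" using anchor by simp
  obtain c' where "valid c' (insert d (insert (partner d) ?W))"
    by (rule add_bad_path[OF c1(1) dW pW bad_facts(1,2)[OF d(1)] _ eW fl]) (use anchor in auto)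
  moreover have "insert d (insert (partner d) ?W) = V" using V by (auto simp: W_def)
  ultimately show False using uncol by simp
qed

text \<open>If \<open>On\<close> or \<open>Tw\<close> is absent from \<open>s3\<close> and
  \<open>s4\<close>, it goes on \<open>x\<close>, and \<open>add_twig\<close> restores the other
  side. By symmetry all four outer ends may be assumed outside the forest; then the six removed
  vertices, which form a tree, all become \<open>Fo\<close>.\<close>

lemma no_adjacent_twigs:
  assumes T: "twig x y t1 t2 s1 s2" "twig y x t3 t4 s3 s4" shows False
proof -
  note d = twigD[OF T(1)] and e = twigD[OF T(2)]
  let ?S = "{x, y, t1, t2, t3, t4}"
  have S: "?S \<subseteq> V" using d(24-26) e(24-26) by auto
  define W where "W = V - ?S"
  obtain c where c: "valid c W" using colouring_off[OF _ S] unfolding W_def by auto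
  have sW: "s1 \<in> W" "s2 \<in> W" "s3 \<in> W" "s4 \<in> W"
    using d(10-18,27,28) e(10-18,27,28) by (auto simp: W_def)
  have tt: "t \<noteq> t'" if "t \<in> {t1, t2}" "t' \<in> {t3, t4}" for t t'
    using that no3[of x y t] d(1)[of t] e(1)[of t'] d(29) sym[of x t] by auto
  have ne: "t1 \<noteq> t3" "t1 \<noteq> t4" "t2 \<noteq> t3" "t2 \<noteq> t4"
    using tt[of t1 t3] tt[of t1 t4] tt[of t2 t3] tt[of t2 t4] by blast+
  have nW: "x \<notin> W" "y \<notin> W" "t1 \<notin> W" "t2 \<notin> W" "t3 \<notin> W" "t4 \<notin> W" by (auto simp: W_def)
  have Wn: "w \<noteq> x \<and> w \<noteq> y \<and> w \<noteq> t1 \<and> w \<noteq> t2 \<and> w \<noteq> t3 \<and> w \<noteq> t4" if "w \<in> W" for w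
    using that nW by blast
  note sn = Wn[OF sW(1)] Wn[OF sW(2)] Wn[OF sW(3)] Wn[OF sW(4)]
  have main: False if T: "twig x y t1 t2 s1 s2" "twig y x t3 t4 s3 s4" and sW: "s1 \<in> W" "s2 \<in> W" "s3 \<in> W" "s4 \<in> W"
    and nW: "x \<notin> W" "y \<notin> W" "t1 \<notin> W" "t2 \<notin> W" "t3 \<notin> W" "t4 \<notin> W"
    and ne: "t1 \<noteq> t3" "t1 \<noteq> t4" "t2 \<noteq> t3" "t2 \<noteq> t4" and W: "W = V - {x, y, t1, t2, t3, t4}"
    and k: "k \<noteq> Fo" "c s3 \<noteq> k" "c s4 \<noteq> k" for x y t1 t2 t3 t4 s1 s2 s3 s4 k
  proof -
    note d = twigD[OF T(1)] and e = twigD[OF T(2)]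
    have nx: "\<not> adj x w" if "w \<in> W" for w using that e(1)[of w] nW by blast
    then have "nb x \<inter> W = {}" by auto
    then have 1: "valid (c(x := k)) (insert x W)"
      by (rule add_isolated[OF c e(24) nW(1)])
    have 2: "valid (c(x := k, t3 := Fo, t4 := Fo)) (insert x W \<union> {t3, t4})"
      by (rule leaves2[OF 1 e(9) _ _ e(22,23)]) (use nW sW k e(7,8) in auto)
    obtain c' where "valid c' ((insert x W \<union> {t3, t4}) \<union> {y, t1, t2})"
      by (rule add_twig[OF T(1) 2]) (use nW sW k ne d(4-8) e(4-8) nx in \<open>auto simp: e(1)\<close>)
    moreover have "(insert x W \<union> {t3, t4}) \<union> {y, t1, t2} = V" using d(24-26) e(24-26) W by auto
    ultimately show False using uncol by simp
  qed
  have "\<not> (c s3 \<noteq> k \<and> c s4 \<noteq> k)" if "k \<noteq> Fo" for k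
    using main[OF T sW nW ne W_def that] by blast
  \<comment> \<open>Both \<open>On\<close> and \<open>Tw\<close> occur on these two vertices, which
    leaves none for \<open>Fo\<close>.\<close>
  then have k1: "c s3 \<noteq> Fo" "c s4 \<noteq> Fo" by (metis hue.distinct hue.exhaust)+
  have W2: "W = V - {y, x, t3, t4, t1, t2}" unfolding W_def by auto
  have "\<not> (c s1 \<noteq> k \<and> c s2 \<noteq> k)" if "k \<noteq> Fo" for k
    using main[OF T(2,1) sW(3,4,1,2) nW(2,1,5,6,3,4) ne(1,3,2,4)[symmetric] W2 that] by blast
  then have k2: "c s1 \<noteq> Fo" "c s2 \<noteq> Fo" by (metis hue.distinct hue.exhaust)+
  have nx: "\<not> adj x w" if "w \<in> W" for w using that e(1)[of w] nW by blast
  then have "nb x \<inter> W = {}" by auto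
  then have 1: "valid (c(x := Fo)) (insert x W)"
    by (rule add_isolated[OF c e(24) nW(1)])
  have 2: "valid (c(x := Fo, t3 := Fo, t4 := Fo)) (insert x W \<union> {t3, t4})"
    by (rule leaves2[OF 1 e(9) _ _ e(22,23)]) (use nW sW k1 nx irr e(7,8) in auto)
  have 3: "valid (c(x := Fo, t3 := Fo, t4 := Fo, y := Fo)) (insert y (insert x W \<union> {t3, t4}))"
    by (rule leafFo[OF 2]) (use nW d(24) e(4-8) ne in \<open>auto simp: d(1)\<close>)
  have 4: "valid (c(x := Fo, t3 := Fo, t4 := Fo, y := Fo, t1 := Fo)) (insert t1 (insert y (insert x W \<union> {t3, t4})))"
    by (rule add_deg2[OF 3 _ d(22)]) (use nW sn d(4-8) e(4-9) ne k2 in auto)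
  have 5: "valid (c(x := Fo, t3 := Fo, t4 := Fo, y := Fo, t1 := Fo, t2 := Fo)) (insert t2 (insert t1 (insert y (insert x W \<union> {t3, t4}))))"
    by (rule add_deg2[OF 4 _ d(23)]) (use nW sn d(4-9) e(4-9) ne k2 in auto)
  have "insert t2 (insert t1 (insert y (insert x W \<union> {t3, t4}))) = V" using S by (auto simp: W_def)
  with 5 show False using uncol by simp
qed

text \<open>With \<open>z\<close> outside the forest, a twig needs \<open>Tw\<close> only if
  \<open>z\<close> is \<open>On\<close> and both its outer ends are \<open>Fo\<close>. One such twig
  is harmless if it is restored before the other (\<open>two\<close>). Two of them are a problem
  only if \<open>z\<close> cannot be \<open>Tw\<close>, that is, if \<open>w\<close> is
  \<open>Tw\<close>; in this case \<open>z\<close> and \<open>u\<close> become \<open>Fo\<close>,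
  and the roots of the twigs take \<open>On\<close> and \<open>Tw\<close>.\<close>

lemma no_two_twigs:
  assumes T: "twig z v t1 t2 s1 s2" "twig z y t3 t4 s3 s4" and vy: "v \<noteq> y"
    and z3: "card (nb z) = 3" and u: "adj z u" "u \<noteq> v" "u \<noteq> y" "card (nb u) = 2"
  shows False
proof -
  note d = twigD[OF T(1)] and e = twigD[OF T(2)]
  have "nb z = {u, v, y}"
  proof (rule card_seteq[symmetric])
    show "{u, v, y} \<subseteq> nb z" using u(1) d(29) e(29) by auto
    show "card (nb z) \<le> card {u, v, y}" using z3 vy u by auto
  qed simp
  then have az: "adj z x \<longleftrightarrow> x = u \<or> x = v \<or> x = y" for x using in_nb[of x z] by simp
  have uz: "adj u z" using u(1) sym by blast
  then obtain w where w: "nb u = {z, w}" "z \<noteq> w" using deg2_nb[OF u(4)] by blast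
  have w2: "card (nb w) \<noteq> 2" using other_end_not_deg2[OF z3 w] .
  have uw: "adj u w" using w in_nb by blast
  have "w \<noteq> v" using no3[of z u v] u(1) uw az[of v] d(29) sym[of z v] by blast
  have "w \<noteq> y" using no3[of z u y] u(1) uw az[of y] e(29) sym[of z y] by blast
  have sv: "s1 \<noteq> y" "s2 \<noteq> y" "s3 \<noteq> v" "s4 \<noteq> v"
    using no4[of z v t1 y] no4[of z v t2 y] no4[of z y t3 v] no4[of z y t4 v] vy
      d(1)[of t1] d(1)[of t2] e(1)[of t3] e(1)[of t4] d(2)[of s1] d(3)[of s2] e(2)[of s3] e(3)[of s4]
      d(29) e(29) sym[of z v] sym[of z y] d(5,6) e(5,6) by auto
  have tt: "t1 \<noteq> t3" "t1 \<noteq> t4" "t2 \<noteq> t3" "t2 \<noteq> t4"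
    using d(2)[of y] d(3)[of y] e(2)[of y] e(3)[of y] vy sv by auto
  have ut: "u \<noteq> t1" "u \<noteq> t2" "u \<noteq> t3" "u \<noteq> t4"
    using uz d(2)[of z] d(3)[of z] e(2)[of z] e(3)[of z] d(4,10,11) e(4,10,11) by auto
  have vt: "v \<noteq> t3" "v \<noteq> t4" "y \<noteq> t1" "y \<noteq> t2" using d(14-16) e(14-16) by auto
  have uzz: "u \<noteq> z" using u(1) irr by blast
  note ne = tt ut vt uzz vy u(2,3) d(4-9) e(4-9)
  let ?S = "{z, u, v, y, t1, t2, t3, t4}"
  have S: "?S \<subseteq> V" using d(24-26) e(24-26) adjV[OF uz] adjV[OF u(1)] by auto
  define W where "W = V - ?S"
  obtain c where c: "valid c W" using colouring_off[OF _ S] unfolding W_def by auto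
  have ss: "s1 \<in> W" "s2 \<in> W" "s3 \<in> W" "s4 \<in> W"
    using d(10-18,27,28) e(10-18,27,28) sv u(4) by (auto simp: W_def)
  have ww: "w \<in> W" using adjV2[OF uw] w(2) w2 \<open>w \<noteq> v\<close> \<open>w \<noteq> y\<close> u(4) d(14,15) e(14,15) by (auto simp: W_def)
  have nW: "z \<notin> W" "u \<notin> W" "v \<notin> W" "y \<notin> W" "t1 \<notin> W" "t2 \<notin> W" "t3 \<notin> W" "t4 \<notin> W" by (auto simp: W_def)
  have Wn: "x \<noteq> z \<and> x \<noteq> u \<and> x \<noteq> v \<and> x \<noteq> y \<and> x \<noteq> t1 \<and> x \<noteq> t2 \<and> x \<noteq> t3 \<and> x \<noteq> t4" if "x \<in> W" for x
    using that nW by blast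
  note sn = Wn[OF ss(1)] Wn[OF ss(2)] Wn[OF ss(3)] Wn[OF ss(4)] Wn[OF ww]
  have nz: "\<not> adj z x" if "x \<in> W" for x using that az[of x] nW by blast
  then have nzW: "nb z \<inter> W = {}" by auto
  have zV: "z \<in> V" using S by auto
  have base: "valid (c(z := k, u := Fo)) (insert u (insert z W))" if k: "c w \<noteq> k" for k
  proof -
    have 1: "valid (c(z := k)) (insert z W)" by (rule add_isolated[OF c zV nW(1) nzW])
    show ?thesis
      by (rule add_deg2[OF 1 _ w(1)]) (use nW ne sn k in auto)
  qed
  let ?W = "insert u (insert z W)"
  have full: "?W \<union> {v, t1, t2} \<union> {y, t3, t4} = V" "?W \<union> {y, t3, t4} \<union> {v, t1, t2} = V"
    using S by (auto simp: W_def)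
  have two: False if c1: "valid c1 ?W" "c1 z \<noteq> Fo" and cu: "c1 u = Fo"
    and h: "c1 z = Tw \<or> \<not> (c1 s1 = Fo \<and> c1 s2 = Fo) \<or> \<not> (c1 s3 = Fo \<and> c1 s4 = Fo)" for c1
  proof -
    have zu: "\<forall>x\<in>?W. adj z x \<longrightarrow> c1 x \<noteq> Tw" using nz irr cu by auto
    show False
    proof (cases "c1 z = Tw \<or> \<not> (c1 s3 = Fo \<and> c1 s4 = Fo)")
      case True
      obtain c2 where c2: "valid c2 (?W \<union> {v, t1, t2})" "\<And>x. x \<in> ?W \<Longrightarrow> c2 x = c1 x"
        by (rule add_twig[OF T(1) c1(1)]) (use nW ne ss c1(2) zu in auto)
      have c2e: "c2 z = c1 z" "c2 s3 = c1 s3" "c2 s4 = c1 s4" using c2(2) ss by auto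
      obtain c3 where "valid c3 (?W \<union> {v, t1, t2} \<union> {y, t3, t4})"
        by (rule add_twig[OF T(2) c2(1)]) (use nW ne ss c1(2) True c2e in auto)
      then show False using full(1) uncol by metis
    next
      case False
      obtain c2 where c2: "valid c2 (?W \<union> {y, t3, t4})" "\<And>x. x \<in> ?W \<Longrightarrow> c2 x = c1 x"
        by (rule add_twig[OF T(2) c1(1)]) (use nW ne ss c1(2) zu in auto)
      have c2e: "c2 z = c1 z" "c2 s1 = c1 s1" "c2 s2 = c1 s2" using c2(2) ss by auto
      obtain c3 where "valid c3 (?W \<union> {y, t3, t4} \<union> {v, t1, t2})"
        by (rule add_twig[OF T(1) c2(1)]) (use nW ne ss c1(2) False h c2e in auto)
      then show False using full(2) uncol by metis
    qed
  qed
  show False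
  proof (cases "c w = Tw")
    case False
    show False by (rule two[OF base[of Tw]]) (use False ne in auto)
  next
    case True
    show False
    proof (cases "c s1 = Fo \<and> c s2 = Fo \<and> c s3 = Fo \<and> c s4 = Fo")
      case False
      show False by (rule two[OF base[of On]]) (use True False ne sn in auto)
    next
      case all: True
      let ?c1 = "c(z := Fo, u := Fo)"
      have 1: "valid ?c1 ?W" by (rule base) (use True in auto)
      have 2: "valid (?c1(v := On)) (insert v ?W)"
      proof (rule addOn[OF 1])
        show "v \<in> V" "v \<notin> ?W" using d(24) nW ne by auto
        show "?c1 x \<noteq> On" if "x \<in> ?W" "adj v x" for x using that d(1)[of x] nW ne by auto
        show "?c1 y' \<noteq> On" if "x \<in> ?W" "adj v x" "?c1 x = Fo" "y' \<in> ?W" "adj x y'" for x y'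
          using that d(1)[of x] az[of y'] nW ne by auto
        show "?c1 y' \<noteq> Tw" if "x \<in> ?W" "y' \<in> ?W" "adj v x" "adj v y'" "x \<noteq> y'" "?c1 x = Tw" for x y'
          using that d(1)[of x] d(1)[of y'] nW ne by auto
      qed
      have 3: "valid (?c1(v := On, t1 := Fo, t2 := Fo)) (insert v ?W \<union> {t1, t2})"
        by (rule leaves2[OF 2 d(9) _ _ d(22,23)]) (use nW ne sn ss all in auto)
      let ?W3 = "insert v ?W \<union> {t1, t2}" and ?c3 = "?c1(v := On, t1 := Fo, t2 := Fo)"
      have 4: "valid (?c3(y := Tw)) (insert y ?W3)"
      proof (rule addTw[OF 3])
        show "y \<in> V" "y \<notin> ?W3" using e(24) nW ne by auto
        show "?c3 x \<noteq> Tw" if "x \<in> ?W3" "adj y x" for x using that e(1)[of x] nW ne by auto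
        show "?c3 y' \<noteq> Tw" if "x \<in> ?W3" "adj y x" "y' \<in> ?W3" "adj x y'" for x y'
          using that e(1)[of x] az[of y'] nW ne by auto
      qed
      have 5: "valid (?c3(y := Tw, t3 := Fo, t4 := Fo)) (insert y ?W3 \<union> {t3, t4})"
        by (rule leaves2[OF 4 e(9) _ _ e(22,23)]) (use nW ne sn ss all in auto)
      have "insert y ?W3 \<union> {t3, t4} = V" using S by (auto simp: W_def)
      then show False using 5 uncol by simp
    qed
  qed
qed

text \<open>\<open>x\<close> is coloured outside the forest and unlike the far end \<open>w\<close>
  of \<open>u\<close>. This admits \<open>u\<close> into the forest, meets the condition of
  \<open>add_twig\<close> because \<open>u\<close> is the only coloured neighbour of
  \<open>x\<close>, and serves all links at \<open>x\<close>.\<close>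

lemma no_deg2_twig_hub:
  assumes x4: "4 \<le> card (nb x)" and u: "adj x u" "card (nb u) = 2" and T: "twig x y t1 t2 s1 s2"
    and o: "\<And>b. adj x b \<Longrightarrow> b \<noteq> u \<Longrightarrow> b \<noteq> y \<Longrightarrow> bad b"
  shows False
proof -
  note d = twigD[OF T]
  define B where "B = nb x - {u, y}"
  define P where "P = B \<union> partner ` B"
  have Bb: "bad b \<and> anchor b = x" if "b \<in> B" for b
    using that o[of b] anchor_eq[of b x] x4 by (auto simp: B_def)
  have Pb: "bad b" if "b \<in> P" for b using that Bb bad_facts(5) by (auto simp: P_def)
  have PV: "P \<subseteq> V" using Pb bad_V by blast
  have uB: "u \<notin> B" by (simp add: B_def)
  have uP: "u \<notin> P"
  proof
    assume "u \<in> P"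
    then obtain b where b: "b \<in> B" "u = partner b" using uB by (auto simp: P_def)
    then have "adj b u" "adj x b" using bad_adj[of b] Bb by auto
    then show False using no3[of x b u] u(1) sym by blast
  qed
  have nP: "x \<notin> P" "y \<notin> P" "t1 \<notin> P" "t2 \<notin> P" "s1 \<notin> P" "s2 \<notin> P"
    using Pb d(19-21) not_bad_deg[OF d(17)] not_bad_deg[OF d(18)] not_bad_deg[of x] x4 by auto
  have ux: "adj u x" using u sym by blast
  then obtain w where w: "nb u = {x, w}" "x \<noteq> w" using deg2_nb[OF u(2)] by blast
  have ax: "adj x z \<longleftrightarrow> z = u \<or> z = y \<or> z \<in> B" for z using u d(29) by (auto simp: B_def)
  have ut: "u \<noteq> t1" "u \<noteq> t2" "u \<noteq> y" "u \<noteq> x"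
    using ux d(2)[of x] d(3)[of x] d(4,10,11,16) u(2) irr by auto
  note ne = ut d(4-9)
  define W where "W = V - ({x, u, y, t1, t2} \<union> P)"
  have S: "{x, u, y, t1, t2} \<union> P \<subseteq> V" using PV d(24-26) adjV[OF u(1)] adjV[OF ux] by auto
  obtain c where c: "valid c W" using colouring_off[OF _ S] unfolding W_def by auto
  have nW: "x \<notin> W" "u \<notin> W" "y \<notin> W" "t1 \<notin> W" "t2 \<notin> W" by (auto simp: W_def)
  have ss: "s1 \<in> W" "s2 \<in> W" using d(10-18,27,28) u(2) nP by (auto simp: W_def)
  define k where "k = (if c w = Tw then On else Tw)"
  have nx: "\<not> adj x z" if "z \<in> W" for z using that ax[of z] unfolding W_def P_def by blast
  then have "nb x \<inter> W = {}" by auto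
  then have 1: "valid (c(x := k)) (insert x W)" by (rule add_isolated[OF c adjV[OF u(1)] nW(1)])
  have 2: "valid (c(x := k, u := Fo)) (insert u (insert x W))"
    by (rule add_deg2[OF 1 _ w(1)]) (use nW ne w(2) in \<open>auto simp: k_def split: if_splits\<close>)
  let ?W = "insert u (insert x W)"
  obtain c' where c': "valid c' (?W \<union> {y, t1, t2})" "\<And>z. z \<in> ?W \<Longrightarrow> c' z = (c(x := k, u := Fo)) z"
    by (rule add_twig[OF T 2]) (use nW ne ss nx irr in \<open>auto simp: k_def split: if_splits\<close>)
  have eq: "?W \<union> {y, t1, t2} = V - (B \<union> partner ` B)" using S nP uP by (auto simp: W_def P_def)
  have "c' x \<noteq> Fo" using c'(2)[of x] ne by (auto simp: k_def)
  then show False using no_bad_path_completion[OF c'(1)[unfolded eq]] Bb by auto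
qed

text \<open>\<open>x\<close> takes \<open>Tw\<close>, for which a twig is always restorable, and
  \<open>v\<close> takes \<open>On\<close>; every link then has an end outside the forest.\<close>

lemma no_almost_bad_twig_hub:
  assumes x4: "4 \<le> card (nb x)" and A: "almost_bad v x" and T: "twig x y t1 t2 s1 s2"
    and o: "\<And>b. adj x b \<Longrightarrow> b \<noteq> v \<Longrightarrow> b \<noteq> y \<Longrightarrow> bad b"
  shows False
proof -
  note d = twigD[OF T] and f = almost_bad_facts[OF A]
  have v4: "4 \<le> card (nb v)" "adj v x" using A by (auto simp: almost_bad_def)
  define Bx where "Bx = nb x - {v, y}"
  define Bv where "Bv = nb v - {x}"
  define B where "B = Bx \<union> Bv"
  define P where "P = B \<union> partner ` B"
  have Bb: "bad b \<and> (anchor b = x \<or> anchor b = v)" if "b \<in> B" for b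
  proof (cases "b \<in> Bv")
    case True then show ?thesis using f(4)[of b] by (simp add: Bv_def)
  next
    case False
    then have "adj x b" "b \<noteq> v" "b \<noteq> y" using that by (auto simp: B_def Bx_def)
    then show ?thesis using o[of b] anchor_eq[of b x] x4 by auto
  qed
  have Pb: "bad b" if "b \<in> P" for b using that Bb bad_facts(5) by (auto simp: P_def)
  have PV: "P \<subseteq> V" using Pb bad_V by blast
  have nP: "x \<notin> P" "v \<notin> P" "y \<notin> P" "t1 \<notin> P" "t2 \<notin> P" "s1 \<notin> P" "s2 \<notin> P"
    using Pb d(19-21) not_bad_deg[OF d(17)] not_bad_deg[OF d(18)] not_bad_deg[of x] not_bad_deg[of v] x4 v4 by auto
  have ax: "adj x z \<Longrightarrow> z = v \<or> z = y \<or> z \<in> B" for z by (auto simp: B_def Bx_def)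
  have av: "adj v z \<Longrightarrow> z = x \<or> z \<in> B" for z by (auto simp: B_def Bv_def)
  have vt: "v \<noteq> t1" "v \<noteq> t2" "v \<noteq> y" "v \<noteq> x" using v4 d(14-16) f(3) by auto
  have nadj: "\<not> adj v t" if "\<not> bad t" "t \<noteq> x" for t using that f(4)[of t] by auto
  have "\<not> adj t1 v" "\<not> adj t2 v" using nadj[OF d(19)] nadj[OF d(20)] d(5,6) sym by blast+
  then have sv: "s1 \<noteq> v" "s2 \<noteq> v" using d(2)[of s1] d(3)[of s2] by auto
  note ne = vt d(4-9)
  define W where "W = V - ({x, v, y, t1, t2} \<union> P)"
  have S: "{x, v, y, t1, t2} \<union> P \<subseteq> V" using PV d(24-26) f(1,2) by auto
  obtain c where c: "valid c W" using colouring_off[OF _ S] unfolding W_def by auto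
  have nW: "x \<notin> W" "v \<notin> W" "y \<notin> W" "t1 \<notin> W" "t2 \<notin> W" by (auto simp: W_def)
  have ss: "s1 \<in> W" "s2 \<in> W" using d(10-18,27,28) sv nP by (auto simp: W_def)
  have nx: "\<not> adj x z" if "z \<in> W" for z using that ax[of z] unfolding W_def P_def by blast
  have nv: "\<not> adj v z" if "z \<in> W" for z using that av[of z] unfolding W_def P_def by blast
  have "nb x \<inter> W = {}" using nx by auto
  then have 1: "valid (c(x := Tw)) (insert x W)" by (rule add_isolated[OF c f(2) nW(1)])
  have 2: "valid (c(x := Tw, v := On)) (insert v (insert x W))"
    by (rule addOn[OF 1 f(1)]) (use nW ne nv in auto)
  let ?W = "insert v (insert x W)"
  obtain c' where c': "valid c' (?W \<union> {y, t1, t2})" "\<And>z. z \<in> ?W \<Longrightarrow> c' z = (c(x := Tw, v := On)) z"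
    by (rule add_twig[OF T 2]) (use nW ne ss in auto)
  have eq: "?W \<union> {y, t1, t2} = V - (B \<union> partner ` B)" using S nP by (auto simp: W_def P_def)
  have "c' x \<noteq> Fo" "c' v \<noteq> Fo" using c'(2)[of x] c'(2)[of v] ne by auto
  then show False using no_bad_path_completion[OF c'(1)[unfolded eq]] Bb by metis
qed

text \<open>\<open>x\<close> and \<open>v\<close> share out \<open>On\<close> and \<open>Tw\<close>
  so that \<open>x\<close> differs from the far end \<open>w\<close> of \<open>u\<close>. Then
  \<open>u\<close> fits into the forest and all links have an end outside it.\<close>

lemma no_almost_bad_deg2_hub:
  assumes x4: "4 \<le> card (nb x)" and A: "almost_bad v x" and u: "adj x u" "card (nb u) = 2"
    and o: "\<And>b. adj x b \<Longrightarrow> b \<noteq> v \<Longrightarrow> b \<noteq> u \<Longrightarrow> bad b"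
  shows False
proof -
  note f = almost_bad_facts[OF A]
  have v4: "4 \<le> card (nb v)" "adj v x" using A by (auto simp: almost_bad_def)
  have xv: "adj x v" using v4 sym by blast
  define Bx where "Bx = nb x - {v, u}"
  define Bv where "Bv = nb v - {x}"
  define B where "B = Bx \<union> Bv"
  define P where "P = B \<union> partner ` B"
  have Bb: "bad b \<and> (anchor b = x \<or> anchor b = v)" if "b \<in> B" for b
  proof (cases "b \<in> Bv")
    case True then show ?thesis using f(4)[of b] by (simp add: Bv_def)
  next
    case False
    then have "adj x b" "b \<noteq> v" "b \<noteq> u" using that by (auto simp: B_def Bx_def)
    then show ?thesis using o[of b] anchor_eq[of b x] x4 by auto
  qed
  have Pb: "bad b" if "b \<in> P" for b using that Bb bad_facts(5) by (auto simp: P_def)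
  have PV: "P \<subseteq> V" using Pb bad_V by blast
  have nvu: "\<not> adj v u" using no3[of v u x] u(1) xv sym by blast
  have nP: "x \<notin> P" "v \<notin> P" using Pb not_bad_deg[of x] not_bad_deg[of v] x4 v4 by auto
  have uP: "u \<notin> P"
  proof
    assume "u \<in> P"
    moreover have "u \<notin> B" using nvu by (auto simp: B_def Bx_def Bv_def)
    ultimately obtain b where b: "b \<in> B" "u = partner b" by (auto simp: P_def)
    then have bu: "adj b u" "adj (anchor b) b" "bad b" using bad_adj[of b] Bb by auto
    show False
    proof (cases "anchor b = x")
      case True
      then show False using no3[of x b u] bu u(1) sym by blast
    next
      case False
      then have "anchor b = v" using Bb b by blast
      moreover have "b \<noteq> x" using bu(3) not_bad_deg[of x] x4 by auto
      moreover have "v \<noteq> u" using u(2) v4 by auto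
      ultimately show False using no4[of v b u x] bu u(1) xv sym by blast
    qed
  qed
  have ux: "adj u x" using u sym by blast
  then obtain w where w: "nb u = {x, w}" "x \<noteq> w" using deg2_nb[OF u(2)] by blast
  have "w \<noteq> v" using w(1) in_nb[of w u] nvu sym by blast
  have ne: "v \<noteq> u" "v \<noteq> x" "u \<noteq> x" using v4 u x4 f(3) by auto
  define W where "W = V - ({x, v, u} \<union> P)"
  have S: "{x, v, u} \<union> P \<subseteq> V" using PV f(1,2) adjV[OF ux] by auto
  obtain c where c: "valid c W" using colouring_off[OF _ S] unfolding W_def by auto
  have nW: "x \<notin> W" "v \<notin> W" "u \<notin> W" by (auto simp: W_def)
  have ax: "adj x z \<Longrightarrow> z = v \<or> z = u \<or> z \<in> B" for z by (auto simp: B_def Bx_def)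
  have av: "adj v z \<Longrightarrow> z = x \<or> z \<in> B" for z by (auto simp: B_def Bv_def)
  have nx: "\<not> adj x z" if "z \<in> W" for z using that ax[of z] unfolding W_def P_def by blast
  have nv: "\<not> adj v z" if "z \<in> W" for z using that av[of z] unfolding W_def P_def by blast
  define k where "k = (if c w = Tw then On else Tw)"
  define j where "j = (if c w = Tw then Tw else On)"
  have "nb x \<inter> W = {}" using nx by auto
  then have 1: "valid (c(x := k)) (insert x W)" by (rule add_isolated[OF c f(2) nW(1)])
  have 2: "valid (c(x := k, v := j)) (insert v (insert x W))"
  proof (cases "c w = Tw")
    case True
    show ?thesis unfolding j_def using True
      apply simp
      by (rule addTw[OF 1 f(1)]) (use nW ne nv nx irr True in \<open>auto simp: k_def\<close>)
  next
    case False
    show ?thesis unfolding j_def using False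
      apply simp
      by (rule addOn[OF 1 f(1)]) (use nW ne nv nx irr False in \<open>auto simp: k_def\<close>)
  qed
  have 3: "valid (c(x := k, v := j, u := Fo)) (insert u (insert v (insert x W)))"
    by (rule add_deg2[OF 2 _ w(1)]) (use nW ne w(2) \<open>w \<noteq> v\<close> in \<open>auto simp: k_def split: if_splits\<close>)
  have eq: "insert u (insert v (insert x W)) = V - (B \<union> partner ` B)" using S nP uP by (auto simp: W_def P_def)
  have "(c(x := k, v := j, u := Fo)) x \<noteq> Fo" "(c(x := k, v := j, u := Fo)) v \<noteq> Fo" using ne by (auto simp: k_def j_def)
  then show False using no_bad_path_completion[OF 3[unfolded eq]] Bb by metis
qed

end

section \<open>Cycles of links\<close>

text \<open>A loopless multigraph is given by its darts, with reversal \<open>r\<close> and start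
  node \<open>tl\<close>; parallel edges are allowed, so a cycle may have length 2, and
  \<open>big\<close> says that there are more edges than nodes. A smallest node set spanning more
  edges than it has nodes has minimum degree 2 and a node of degree at least 3. A walk from that
  node that never turns back closes either at its start or at a node which it enters, leaves and
  enters again by another dart; in both cases three darts start there.\<close>

lemma dart_cycle:
  fixes D :: "'d set" and r :: "'d \<Rightarrow> 'd" and tl :: "'d \<Rightarrow> 'n"
  assumes fD: "finite D" and fN: "finite N"
    and D: "\<And>d. d \<in> D \<Longrightarrow> r d \<in> D" "\<And>d. d \<in> D \<Longrightarrow> r (r d) = d" "\<And>d. d \<in> D \<Longrightarrow> tl d \<in> N"
      "\<And>d. d \<in> D \<Longrightarrow> tl (r d) \<noteq> tl d"
    and big: "card D > 2 * card N"
  obtains m f where "2 \<le> (m::nat)" "\<And>k. k < m \<Longrightarrow> f k \<in> D" "inj_on (\<lambda>k. tl (f k)) {..<m}"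
    "\<And>k. k < m \<Longrightarrow> tl (r (f k)) = tl (f (Suc k mod m))" "\<And>k. k < m \<Longrightarrow> f (Suc k mod m) \<noteq> r (f k)"
    "3 \<le> card {d \<in> D. tl d = tl (f 0)}"
proof -
  define DD where "DD M = {d \<in> D. tl d \<in> M \<and> tl (r d) \<in> M}" for M
  define P where "P M \<longleftrightarrow> M \<subseteq> N \<and> card (DD M) > 2 * card M" for M
  have "DD N = D" using D by (auto simp: DD_def)
  then have "P N" using big by (auto simp: P_def)
  then obtain M where M: "P M" and min: "\<And>M'. P M' \<Longrightarrow> card M \<le> card M'"
    using ex_has_least_nat[of P N card] by blast
  have fM: "finite M" "M \<subseteq> N" using M fN finite_subset by (auto simp: P_def)
  have fDD: "finite (DD X)" for X using fD by (auto simp: DD_def)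
  have rDD: "r d \<in> DD M" if "d \<in> DD M" for d using that D by (auto simp: DD_def)
  define dg where "dg n = {d \<in> DD M. tl d = n}" for n
  have fdg: "finite (dg n)" for n using fDD[of M] by (auto simp: dg_def)
  \<comment> \<open>Deleting a node with at most one dart removes at most two darts, the dart and
    its reverse, so the surplus of edges would survive in a smaller set.\<close>
  have deg2: "2 \<le> card (dg n)" if n: "n \<in> M" for n
  proof (rule ccontr)
    assume "\<not> ?thesis"
    have "DD M \<subseteq> DD (M - {n}) \<union> (dg n \<union> r ` dg n)"
    proof
      fix d assume d: "d \<in> DD M"
      then have "r d \<in> DD M" "r (r d) = d" using rDD D by (auto simp: DD_def)
      note rd = this
      consider "tl d = n" | "tl (r d) = n" | "tl d \<noteq> n" "tl (r d) \<noteq> n" by blast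
      then show "d \<in> DD (M - {n}) \<union> (dg n \<union> r ` dg n)"
      proof cases
        case 2
        then have "r d \<in> dg n" using rd by (simp add: dg_def)
        then have "r (r d) \<in> r ` dg n" by blast
        then show ?thesis using rd by simp
      qed (use d in \<open>auto simp: dg_def DD_def\<close>)
    qed
    then have "card (DD M) \<le> card (DD (M - {n}) \<union> (dg n \<union> r ` dg n))"
      using fDD fdg by (intro card_mono) auto
    also have "\<dots> \<le> card (DD (M - {n})) + (card (dg n) + card (r ` dg n))"
      by (meson add_left_mono card_Un_le le_trans)
    also have "\<dots> \<le> card (DD (M - {n})) + 2"
      using card_image_le[OF fdg, of r n] \<open>\<not> _\<close> by linarith
    finally have 1: "card (DD M) \<le> card (DD (M - {n})) + 2" .
    have "card (M - {n}) = card M - 1" "0 < card M" using n fM by (auto simp: card_gt_0_iff)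
    moreover have "2 * card M < card (DD M)" using M by (simp add: P_def)
    ultimately have "card (DD (M - {n})) > 2 * card (M - {n})" using 1 by linarith
    then have "P (M - {n})" using fM by (auto simp: P_def)
    then show False using min[of "M - {n}"] card_Diff1_less[OF fM(1) n] by linarith
  qed
  have "\<exists>n\<in>M. 3 \<le> card (dg n)"
  proof (rule ccontr)
    assume "\<not> ?thesis"
    then have le: "card (dg n) \<le> 2" if "n \<in> M" for n using that by fastforce
    have "DD M \<subseteq> (\<Union>n\<in>M. dg n)" by (auto simp: DD_def dg_def)
    then have "card (DD M) \<le> card (\<Union>n\<in>M. dg n)" using fM fdg by (intro card_mono) auto
    also have "\<dots> \<le> (\<Sum>n\<in>M. card (dg n))" by (rule card_UN_le[OF fM(1)])
    also have "\<dots> \<le> (\<Sum>n\<in>M. 2)" by (intro sum_mono le)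
    finally show False using M by (simp add: P_def)
  qed
  then obtain n0 where n0: "n0 \<in> M" "3 \<le> card (dg n0)" by blast
  then obtain d0 where d0: "d0 \<in> dg n0" by (metis card.empty ex_in_conv not_numeral_le_zero)
  have "\<exists>e. e \<in> DD M \<and> tl e = tl (r d) \<and> e \<noteq> r d" if d: "d \<in> DD M" for d
  proof (rule ccontr)
    assume "\<not> ?thesis"
    then have "dg (tl (r d)) \<subseteq> {r d}" by (auto simp: dg_def)
    from card_mono[OF _ this] have "card (dg (tl (r d))) \<le> 1" by simp
    moreover have "2 \<le> card (dg (tl (r d)))" using d by (intro deg2) (simp add: DD_def)
    ultimately show False by linarith
  qed
  then obtain nx where nx: "\<And>d. d \<in> DD M \<Longrightarrow> nx d \<in> DD M \<and> tl (nx d) = tl (r d) \<and> nx d \<noteq> r d" by metis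
  define f where "f k = (nx ^^ k) d0" for k
  have fDDM: "f k \<in> DD M" for k
    by (induction k) (use d0 nx in \<open>auto simp: f_def dg_def\<close>)
  have fS: "tl (f (Suc k)) = tl (r (f k))" "f (Suc k) \<noteq> r (f k)" for k
    using nx[OF fDDM[of k]] by (auto simp: f_def)
  have fD': "f k \<in> D" for k using fDDM[of k] by (auto simp: DD_def)
  define Q where "Q j \<longleftrightarrow> (\<exists>i<j. tl (f i) = tl (f j))" for j
  have "\<exists>j. Q j"
  proof (rule ccontr)
    assume no: "\<nexists>j. Q j"
    have "inj (\<lambda>k. tl (f k))"
    proof (rule injI)
      fix a b assume "tl (f a) = tl (f b)"
      then show "a = b" using no by (metis Q_def linorder_neqE_nat)
    qed
    moreover have "range (\<lambda>k. tl (f k)) \<subseteq> N" using fD' D by auto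
    ultimately show False using fN finite_subset infinite_UNIV_nat finite_imageD by metis
  qed
  define j where "j = (LEAST j. Q j)"
  have "Q j" using \<open>\<exists>j. Q j\<close> unfolding j_def by (metis LeastI_ex)
  then obtain i where i: "i < j" "tl (f i) = tl (f j)" by (auto simp: Q_def)
  have inj: "a = b" if "a < j" "b < j" "tl (f a) = tl (f b)" for a b
  proof (rule ccontr)
    assume "a \<noteq> b"
    then have "Q (max a b)" using that by (auto simp: Q_def max_def intro: exI[of _ a] exI[of _ b])
    moreover have "max a b < j" using that by simp
    ultimately show False unfolding j_def by (metis not_less_Least)
  qed
  have ij: "j \<noteq> Suc i" using fS(1)[of i] i D(4)[OF fD'[of i]] by auto
  define m where "m = j - i"
  have m: "2 \<le> m" "i + m = j" using i ij by (auto simp: m_def)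
  define g where "g k = f (i + k)" for k
  \<comment> \<open>If the closing dart were the reverse of the first one, distinctness of the nodes
    would force length 2, and the walk would have turned back at once.\<close>
  have wrap: "f i \<noteq> r (f (j - 1))"
  proof
    assume a: "f i = r (f (j - 1))"
    then have rf: "r (f i) = f (j - 1)" using D(2)[OF fD'[of "j - 1"]] by simp
    then have "tl (f (Suc i)) = tl (f (j - 1))" using fS(1)[of i] by simp
    then have "Suc i = j - 1" using inj[of "Suc i" "j - 1"] i ij by auto
    then show False using fS(2)[of i] rf by simp
  qed
  have last: "tl (r (f (j - 1))) = tl (f i)" using fS(1)[of "j - 1"] i by simp
  show ?thesis
  proof (rule that[of m g])
    show "2 \<le> m" by (rule m)
    show "g k \<in> D" if "k < m" for k using fD' by (simp add: g_def)
    show "inj_on (\<lambda>k. tl (g k)) {..<m}"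
    proof (rule inj_onI)
      fix a b assume "a \<in> {..<m}" "b \<in> {..<m}" "tl (g a) = tl (g b)"
      then show "a = b" using inj[of "i + a" "i + b"] m by (auto simp: g_def)
    qed
    show "tl (r (g k)) = tl (g (Suc k mod m))" if "k < m" for k
    proof (cases "Suc k = m")
      case True
      then have "i + k = j - 1" using m by auto
      then show ?thesis using True last by (simp add: g_def)
    next
      case False
      then show ?thesis using that fS(1)[of "i + k"] by (simp add: g_def)
    qed
    show "g (Suc k mod m) \<noteq> r (g k)" if "k < m" for k
    proof (cases "Suc k = m")
      case True
      then have "i + k = j - 1" using m by auto
      then show ?thesis using True wrap by (simp add: g_def)
    next
      case False
      then show ?thesis using that fS(2)[of "i + k"] by (simp add: g_def)
    qed
    have fin: "finite {d \<in> D. tl d = tl (g 0)}" using fD by auto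
    show "3 \<le> card {d \<in> D. tl d = tl (g 0)}"
    proof (cases i)
      case 0
      then have "tl (g 0) = n0" using d0 by (simp add: g_def f_def dg_def)
      then have "dg n0 \<subseteq> {d \<in> D. tl d = tl (g 0)}" by (auto simp: dg_def DD_def)
      from card_mono[OF fin this] show ?thesis using n0(2) by linarith
    next
      case (Suc i')
      \<comment> \<open>The dart leaving the closing node, and the reverses of the two darts by
        which the walk enters it.\<close>
      let ?S = "{f i, r (f i'), r (f (j - 1))}"
      have "f i \<noteq> r (f i')" using fS(2)[of i'] Suc by simp
      moreover have "r (f i') \<noteq> r (f (j - 1))"
      proof
        assume "r (f i') = r (f (j - 1))"
        then have "f i' = f (j - 1)" using D(2) fD' by metis
        then show False using inj[of i' "j - 1"] i Suc by auto
      qed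
      ultimately have "card ?S = 3" using wrap by auto
      moreover have "?S \<subseteq> {d \<in> D. tl d = tl (g 0)}"
        using fD' D(1) last fS(1)[of i'] Suc by (auto simp: g_def)
      moreover note card_mono[OF fin this]
      ultimately show ?thesis by linarith
    qed
  qed
qed

section \<open>Clusters and their recolouring\<close>

context critical_graph
begin

text \<open>Its charge is 84 - 54 - 36 = -6 after serving three links, and the gain of 5 raises it
  only to -1.\<close>

definition poor4 :: "'a \<Rightarrow> bool" where
  "poor4 v \<longleftrightarrow> card (nb v) = 4 \<and> card (bad_nb v) = 3"

text \<open>It pays 12 to each bad neighbour and 5 to each of the others, and 84 - 54 - 24 - 10 =
  -4. The remaining vertices of degree 4 with two bad neighbours end without deficit, see
  \<open>final_two_bad\<close>.\<close>

definition center :: "'a \<Rightarrow> bool" where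
  "center x \<longleftrightarrow> card (nb x) = 4 \<and> card (bad_nb x) = 2 \<and> (\<forall>y. adj x y \<and> \<not> bad y \<longrightarrow> poor4 y)"

definition cluster :: "'a \<Rightarrow> 'a set" where
  "cluster x = insert x {y. adj x y \<and> \<not> bad y}"

text \<open>A cluster is a connected piece of three vertices, all of whose other neighbours lie on links. It has to
  be recoloured as a whole, so that it counts as one vertex, its center, in the graph of links.\<close>

definition rep :: "'a \<Rightarrow> 'a" where
  "rep v = (if poor4 v \<and> (\<exists>x. adj v x \<and> center x) then (THE x. adj v x \<and> center x) else v)"

lemma in_bad_nb [simp]: "u \<in> bad_nb v \<longleftrightarrow> adj v u \<and> bad u"
  by (simp add: bad_nb_def)

lemma bad_nb_sub: "bad_nb v \<subseteq> nb v"
  by auto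

lemma fin_bad_nb [simp]: "finite (bad_nb v)"
  using finite_subset[OF bad_nb_sub fin_nb] .

lemma card_nonbad: "card {y. adj v y \<and> \<not> bad y} = card (nb v) - card (bad_nb v)"
proof -
  have "{y. adj v y \<and> \<not> bad y} = nb v - bad_nb v" by auto
  then show ?thesis by (simp add: card_Diff_subset bad_nb_sub)
qed

lemma poor4_nb:
  assumes "poor4 v" "adj v x" "\<not> bad x" "adj v y" "\<not> bad y" shows "x = y"
proof -
  have "card {y. adj v y \<and> \<not> bad y} = 1" using assms(1) by (simp add: card_nonbad poor4_def)
  then obtain q where "{y. adj v y \<and> \<not> bad y} = {q}" by (rule card_1_singletonE)
  then have "{x, y} \<subseteq> {q}" using assms by blast
  then show ?thesis by blast
qed

lemma deg4_not_bad: "poor4 v \<Longrightarrow> \<not> bad v" "center v \<Longrightarrow> \<not> bad v"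
  using not_bad_deg[of v] by (auto simp: poor4_def center_def)

lemma center_not_poor4: "center x \<Longrightarrow> \<not> poor4 x"
  by (simp add: center_def poor4_def)

lemma centerE:
  assumes x: "center x"
  obtains v y where "v \<noteq> y" "x \<noteq> v" "x \<noteq> y" "cluster x = {x, v, y}" "poor4 v" "poor4 y" "adj x v" "adj x y" "\<not> adj v y"
proof -
  have "card {y. adj x y \<and> \<not> bad y} = 2" using x by (simp add: card_nonbad center_def)
  then obtain v y where vy: "{y. adj x y \<and> \<not> bad y} = {v, y}" "v \<noteq> y" unfolding card_2_iff by blast
  have a: "adj x v \<and> \<not> bad v" "adj x y \<and> \<not> bad y" using vy by blast+
  show ?thesis
  proof (rule that[of v y])
    show "cluster x = {x, v, y}" unfolding cluster_def vy by simp
    show "poor4 v" "poor4 y" using a x by (auto simp: center_def)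
    show "\<not> adj v y" using no3[of x v y] a sym by blast
    show "x \<noteq> v" "x \<noteq> y" using a irr by auto
  qed (use vy a in auto)
qed

text \<open>A \<open>poor4\<close> vertex has a single neighbour that is not bad, so its center is
  unique. Hence clusters are disjoint, and only edges to links leave them.\<close>

lemma cluster_facts:
  assumes x: "center x" and a: "a \<in> cluster x"
  shows "card (nb a) = 4" "\<not> bad a" "rep a = x" "\<And>w. adj a w \<Longrightarrow> \<not> bad w \<Longrightarrow> w \<in> cluster x" "a \<in> V"
    "\<And>d. bad d \<Longrightarrow> adj a d \<Longrightarrow> anchor d = a"
proof -
  have c: "a = x \<or> adj x a \<and> poor4 a" using x a by (auto simp: cluster_def center_def)
  show c4: "card (nb a) = 4" using c x by (auto simp: center_def poor4_def)
  then show "\<not> bad a" using not_bad_deg by simp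
  show "rep a = x"
  proof (cases "a = x")
    case True
    then show ?thesis using center_not_poor4[OF x] by (simp add: rep_def)
  next
    case False
    then have p: "adj a x" "poor4 a" using c sym by auto
    have "(THE x. adj a x \<and> center x) = x"
      by (rule the_equality) (use p x poor4_nb[OF p(2)] deg4_not_bad(2) in blast)+
    then show ?thesis using p x by (auto simp: rep_def)
  qed
  show "w \<in> cluster x" if "adj a w" "\<not> bad w" for w
  proof (cases "a = x")
    case False
    then have p: "adj a x" "poor4 a" using c sym by auto
    then show ?thesis using poor4_nb[OF p(2,1) deg4_not_bad(2)[OF x] that] by (simp add: cluster_def)
  qed (use that in \<open>simp add: cluster_def\<close>)
  have "nb a \<noteq> {}" using c4 by auto
  then show "a \<in> V" using adjV by auto
  show "anchor d = a" if "bad d" "adj a d" for d using anchor_eq[OF that] c4 by simp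
qed

lemma rep_cases: "rep a = a \<or> (center (rep a) \<and> a \<in> cluster (rep a))"
proof (cases "poor4 a \<and> (\<exists>x. adj a x \<and> center x)")
  case True
  then obtain x where x: "adj a x" "center x" by blast
  have "a \<in> cluster x" using x True sym deg4_not_bad(1) by (auto simp: cluster_def)
  then show ?thesis using cluster_facts(3)[OF x(2)] x by auto
qed (auto simp: rep_def)

lemma rep_eq:
  assumes "rep a = rep b" "a \<noteq> b" shows "center (rep a)" "a \<in> cluster (rep a)" "b \<in> cluster (rep a)"
proof -
  have s: "x \<in> cluster x" for x by (simp add: cluster_def)
  show "center (rep a)" "a \<in> cluster (rep a)" "b \<in> cluster (rep a)"
    using rep_cases[of a] rep_cases[of b] assms s by metis+
qed

text \<open>The cluster is a path with \<open>x\<close> in the middle, and \<open>W\<close> does not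
  touch it, so only conflicts inside it matter. \<open>z\<close> becomes \<open>Fo\<close>, and the
  two other members take \<open>On\<close> and \<open>Tw\<close>; the ends of the path are
  interchangeable.\<close>

lemma colour_cluster:
  assumes x: "center x" and z: "z \<in> cluster x" and c: "valid c W" and dis: "W \<inter> cluster x = {}"
    and na: "\<And>a w. a \<in> cluster x \<Longrightarrow> w \<in> W \<Longrightarrow> \<not> adj a w"
  obtains c' where "valid c' (W \<union> cluster x)" "\<And>w. w \<in> W \<Longrightarrow> c' w = c w" "\<And>a. a \<in> cluster x \<Longrightarrow> a \<noteq> z \<Longrightarrow> c' a \<noteq> Fo"
proof -
  have "\<exists>v y. v \<noteq> y \<and> x \<noteq> v \<and> x \<noteq> y \<and> cluster x = {x, v, y} \<and> adj x v \<and> adj x y \<and> \<not> adj v y \<and> (z = x \<or> z = v)"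
  proof -
    obtain v y where 1: "v \<noteq> y" "x \<noteq> v" "x \<noteq> y" "cluster x = {x, v, y}" "adj x v" "adj x y" "\<not> adj v y" using centerE[OF x] .
    have 2: "\<not> adj y v" using 1 sym by blast
    have 3: "cluster x = {x, y, v}" using 1(4) by auto
    have "z = x \<or> z = v \<or> z = y" using z 1(4) by auto
    then show ?thesis using 1 2 3 by (metis (no_types))
  qed
  then obtain v y where vy: "v \<noteq> y" "x \<noteq> v" "x \<noteq> y" "cluster x = {x, v, y}" "adj x v" "adj x y" "\<not> adj v y" "z = x \<or> z = v" by blast
  have n2: "\<not> adj y v" "adj v x" "adj y x" using vy sym by blast+
  have W: "x \<notin> W" "v \<notin> W" "y \<notin> W" using dis vy(4) by auto
  have V: "x \<in> V" "v \<in> V" "y \<in> V" using cluster_facts(5)[OF x] vy(4) by auto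
  have na': "\<And>w. w \<in> W \<Longrightarrow> \<not> adj x w" "\<And>w. w \<in> W \<Longrightarrow> \<not> adj v w" "\<And>w. w \<in> W \<Longrightarrow> \<not> adj y w" using na vy(4) by auto
  have nv: "nb v \<inter> W = {}" using na'(2) by auto
  have eq: "insert y (insert x (insert v W)) = W \<union> cluster x" using vy(4) by auto
  show ?thesis
  proof (cases "z = x")
    case True
    have 1: "valid (c(v := On)) (insert v W)" by (rule add_isolated[OF c V(2) W(2) nv])
    have 2: "valid (c(v := On, x := Fo)) (insert x (insert v W))"
      by (rule leafFo[OF 1 V(1)]) (use W vy na' in auto)
    have 3: "valid (c(v := On, x := Fo, y := Tw)) (insert y (insert x (insert v W)))"
      by (rule addTw[OF 2 V(3)]) (use W vy na' n2 irr in auto)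
    show ?thesis by (rule that[OF 3[unfolded eq]]) (use W vy(1-4) True in auto)
  next
    case False
    have 1: "valid (c(v := Fo)) (insert v W)" by (rule add_isolated[OF c V(2) W(2) nv])
    have 2: "valid (c(v := Fo, x := On)) (insert x (insert v W))"
      by (rule addOn[OF 1 V(1)]) (use W vy na' irr in auto)
    have 3: "valid (c(v := Fo, x := On, y := Tw)) (insert y (insert x (insert v W)))"
      by (rule addTw[OF 2 V(3)]) (use W vy na' n2 irr in auto)
    show ?thesis by (rule that[OF 3[unfolded eq]]) (use W vy(1-4,8) False in auto)
  qed
qed

text \<open>All links at the cluster are removed and put back around a new colouring. The missing
  link \<open>e\<close> leaves \<open>z\<close> at most three neighbours, so \<open>z\<close> can be
  the one member in the forest; the others become flexible for good. The last conclusion confines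
  the change to the cluster and its links.\<close>

lemma recolour_cluster:
  assumes x: "center x" and z: "z \<in> cluster x" and e: "bad e" "anchor e = z" "e \<notin> W" and c: "valid c W"
    and NB: "\<And>u. u \<in> V \<Longrightarrow> \<not> bad u \<Longrightarrow> u \<in> W"
    and pr: "\<And>d. bad d \<Longrightarrow> anchor d \<in> cluster x \<Longrightarrow> d \<in> W \<Longrightarrow> partner d \<in> W"
  obtains c' where "valid c' W" "\<And>a. a \<in> cluster x \<Longrightarrow> a \<noteq> z \<Longrightarrow> c' a \<noteq> Fo"
    "\<And>u. u \<in> W \<Longrightarrow> u \<notin> cluster x \<Longrightarrow> (\<And>d. bad d \<Longrightarrow> anchor d \<in> cluster x \<Longrightarrow> d \<in> W \<Longrightarrow> u \<noteq> d \<and> u \<noteq> partner d) \<Longrightarrow> c' u = c u"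
proof -
  define E where "E = {d \<in> W. bad d \<and> anchor d \<in> cluster x}"
  have EB: "bad d" if "d \<in> E \<union> partner ` E" for d using that bad_facts(5) by (auto simp: E_def)
  have EW: "E \<union> partner ` E \<subseteq> W" using pr by (auto simp: E_def)
  have clW: "cluster x \<subseteq> W" using NB cluster_facts(2,5)[OF x] by auto
  define W0 where "W0 = W - cluster x - (E \<union> partner ` E)"
  have c0: "valid c W0" unfolding W0_def by (rule valid_mono[OF c]) blast
  have na: "\<not> adj a w" if a: "a \<in> cluster x" "w \<in> W0" for a w
  proof
    assume aw: "adj a w"
    show False
    proof (cases "bad w")
      case True
      then have "w \<in> E" using cluster_facts(6)[OF x a(1) True aw] a by (auto simp: E_def W0_def)
      then show False using a by (auto simp: W0_def)
    next
      case False
      then show False using cluster_facts(4)[OF x a(1) aw] a by (auto simp: W0_def)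
    qed
  qed
  have dis: "W0 \<inter> cluster x = {}" by (auto simp: W0_def)
  obtain c1 where c1: "valid c1 (W0 \<union> cluster x)" "\<And>w. w \<in> W0 \<Longrightarrow> c1 w = c w" "\<And>a. a \<in> cluster x \<Longrightarrow> a \<noteq> z \<Longrightarrow> c1 a \<noteq> Fo"
    using colour_cluster[OF x z c0 dis na] by blast
  have full: "W0 \<union> cluster x \<union> E \<union> partner ` E = W" using EW clW by (auto simp: W0_def)
  have fE: "finite E" using finite_subset[OF valid_sub[OF c] finV] by (auto simp: E_def)
  have z3: "card (nb z \<inter> W) \<le> 3"
  proof -
    have "adj z e" using bad_adj[OF e(1)] e(2) by auto
    then have "card (nb z - {e}) = 3" using cluster_facts(1)[OF x z] by simp
    moreover have "nb z \<inter> W \<subseteq> nb z - {e}" using e(3) by auto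
    ultimately show ?thesis using card_mono[of "nb z - {e}" "nb z \<inter> W"] by simp
  qed
  obtain c2 where c2: "valid c2 (W0 \<union> cluster x \<union> E \<union> partner ` E)" "\<And>w. w \<in> W0 \<union> cluster x \<Longrightarrow> c2 w = c1 w"
  proof (rule add_bad_paths[OF c1(1) fE])
    fix d assume d: "d \<in> E"
    have b: "bad d" "anchor d \<in> cluster x" using d unfolding E_def by blast+
    note b = b(1) bad_facts(5)[OF b(1)] b(2)
    have "d \<notin> cluster x" "partner d \<notin> cluster x" using b cluster_facts(2)[OF x] by blast+
    moreover have "d \<notin> W0" "partner d \<notin> W0" using d unfolding W0_def by blast+
    ultimately have nE: "d \<notin> W0 \<union> cluster x" "partner d \<notin> W0 \<union> cluster x" by blast+
    have "anchor (partner d) \<in> W" "anchor (partner d) \<notin> E \<union> partner ` E" using NB anchor_V anchor_not_bad b EB by blast+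
    then have "anchor (partner d) \<in> W0 \<union> cluster x" unfolding W0_def by blast
    then show "bad d \<and> d \<notin> W0 \<union> cluster x \<and> partner d \<notin> W0 \<union> cluster x \<and> anchor d \<in> W0 \<union> cluster x \<and> anchor (partner d) \<in> W0 \<union> cluster x"
      using b nE by blast
    show "c1 (anchor d) \<noteq> Fo \<or> card (nb (anchor d) \<inter> (W0 \<union> cluster x \<union> E \<union> partner ` E)) \<le> 3"
      unfolding full using c1(3)[OF b(3)] z3 by blast
  qed blast
  show ?thesis
  proof (rule that[of c2])
    show "valid c2 W" using c2(1) full by simp
    show "c2 a \<noteq> Fo" if "a \<in> cluster x" "a \<noteq> z" for a using c1(3)[OF that] c2(2)[of a] that by simp
    show "c2 u = c u" if u: "u \<in> W" "u \<notin> cluster x" and h: "\<And>d. bad d \<Longrightarrow> anchor d \<in> cluster x \<Longrightarrow> d \<in> W \<Longrightarrow> u \<noteq> d \<and> u \<noteq> partner d" for u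
    proof -
      have "u \<notin> E \<union> partner ` E" using h by (auto simp: E_def)
      then have "u \<in> W0" using u by (auto simp: W0_def)
      then show ?thesis using c1(2) c2(2) by simp
    qed
  qed
qed

text \<open>The inner vertex \<open>f\<close> of a missing link gets its colour in advance. The
  center stays uncoloured while the other links of the cluster return, so that \<open>y\<close>,
  coloured \<open>Fo\<close>, has only three neighbours. The center then joins the forest between
  \<open>On\<close> and \<open>Fo\<close>, and no \<open>Tw\<close> is near
  \<open>f\<close>.\<close>

lemma recolour_center:
  assumes x: "center x" and ef: "bad_nb x = {e, f}" "e \<noteq> f" "e \<notin> W" "f \<notin> W" "partner f \<notin> W" and c: "valid c W"
    and NB: "\<And>u. u \<in> V \<Longrightarrow> \<not> bad u \<Longrightarrow> u \<in> W"
    and pr: "\<And>d. bad d \<Longrightarrow> anchor d \<in> cluster x \<Longrightarrow> d \<in> W \<Longrightarrow> partner d \<in> W"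
  obtains c' where "valid c' (insert f W)" "c' f \<noteq> Fo"
proof -
  obtain v y where vy: "v \<noteq> y" "x \<noteq> v" "x \<noteq> y" "cluster x = {x, v, y}" "poor4 v" "poor4 y" "adj x v" "adj x y" "\<not> adj v y" using centerE[OF x] .
  have xc: "x \<in> cluster x" "v \<in> cluster x" "y \<in> cluster x" using vy by auto
  define E where "E = {d \<in> W. bad d \<and> anchor d \<in> cluster x}"
  have EB: "bad d" if "d \<in> E \<union> partner ` E" for d using that bad_facts(5) by (auto simp: E_def)
  have EW: "E \<union> partner ` E \<subseteq> W" using pr by (auto simp: E_def)
  have clW: "cluster x \<subseteq> W" using NB cluster_facts(2,5)[OF x] by auto
  have bf: "bad e" "bad f" "adj x e" "adj x f" using ef(1) in_bad_nb by blast+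
  have Ex: "anchor d \<noteq> x" if "d \<in> E" for d
  proof
    assume "anchor d = x"
    then have "d \<in> bad_nb x" using that bad_adj[of d] by (auto simp: E_def)
    then show False using that ef by (auto simp: E_def)
  qed
  define W0 where "W0 = W - cluster x - (E \<union> partner ` E)"
  have c0: "valid c W0" unfolding W0_def by (rule valid_mono[OF c]) blast
  have na: "\<not> adj a w" if a: "a \<in> cluster x" "w \<in> W0" for a w
  proof
    assume aw: "adj a w"
    show False
    proof (cases "bad w")
      case True
      then have "w \<in> E" using cluster_facts(6)[OF x a(1) True aw] a by (auto simp: E_def W0_def)
      then show False using a by (auto simp: W0_def)
    next
      case False
      then show False using cluster_facts(4)[OF x a(1) aw] a by (auto simp: W0_def)
    qed
  qed
  have W: "x \<notin> W0" "v \<notin> W0" "y \<notin> W0" using xc by (auto simp: W0_def)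
  have V: "x \<in> V" "v \<in> V" "y \<in> V" using cluster_facts(5)[OF x] xc by auto
  have nv: "nb v \<inter> W0 = {}" using na xc by auto
  have ny: "nb y \<inter> insert v W0 = {}" using na xc vy(9) sym by auto
  have 1: "valid (c(v := On)) (insert v W0)" by (rule add_isolated[OF c0 V(2) W(2) nv])
  have 2: "valid (c(v := On, y := Fo)) (insert y (insert v W0))"
    by (rule add_isolated[OF 1 V(3) _ ny]) (use W vy in auto)
  let ?c = "c(v := On, y := Fo)" and ?W = "insert y (insert v W0)"
  have xE: "x \<notin> E \<union> partner ` E" using EB cluster_facts(2)[OF x xc(1)] by blast
  have full: "?W \<union> E \<union> partner ` E = W - {x}"
    using EW clW vy(1-4) xE EB cluster_facts(2)[OF x] by (auto simp: W0_def)
  have fE: "finite E" using finite_subset[OF valid_sub[OF c] finV] by (auto simp: E_def)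
  have y3: "card (nb y \<inter> (W - {x})) \<le> 3"
  proof -
    have "adj y x" using vy(8) sym by blast
    then have "card (nb y - {x}) = 3" using cluster_facts(1)[OF x xc(3)] by simp
    moreover have "nb y \<inter> (W - {x}) \<subseteq> nb y - {x}" by auto
    ultimately show ?thesis using card_mono[of "nb y - {x}" "nb y \<inter> (W - {x})"] by simp
  qed
  obtain c2 where c2: "valid c2 (?W \<union> E \<union> partner ` E)" "\<And>w. w \<in> ?W \<Longrightarrow> c2 w = ?c w"
  proof (rule add_bad_paths[OF 2 fE])
    fix d assume d: "d \<in> E"
    have b: "bad d" "anchor d \<in> cluster x" using d unfolding E_def by blast+
    note b = b(1) bad_facts(5)[OF b(1)] b(2)
    have "d \<notin> cluster x" "partner d \<notin> cluster x" using b cluster_facts(2)[OF x] by blast+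
    moreover have "d \<notin> W0" "partner d \<notin> W0" using d unfolding W0_def by blast+
    ultimately have nE: "d \<notin> ?W" "partner d \<notin> ?W" using xc by blast+
    have "anchor (partner d) \<noteq> x"
    proof
      assume "anchor (partner d) = x"
      then have "partner d \<in> bad_nb x" using b bad_adj[of "partner d"] by auto
      then show False using d EW ef by auto
    qed
    moreover have "anchor (partner d) \<in> W" "anchor (partner d) \<notin> E \<union> partner ` E" using NB anchor_V anchor_not_bad b EB by blast+
    ultimately have "anchor (partner d) \<in> ?W" unfolding W0_def vy(4) by blast
    moreover have "anchor d \<in> ?W" using b(3) Ex[OF d] vy(4) by auto
    ultimately show "bad d \<and> d \<notin> ?W \<and> partner d \<notin> ?W \<and> anchor d \<in> ?W \<and> anchor (partner d) \<in> ?W"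
      using b nE by blast
    show "?c (anchor d) \<noteq> Fo \<or> card (nb (anchor d) \<inter> (?W \<union> E \<union> partner ` E)) \<le> 3"
      unfolding full using b(3) Ex[OF d] vy(1,4) y3 by auto
  qed blast
  have cv: "c2 v = On" "c2 y = Fo" using c2(2) vy(1) by auto
  have c2': "valid c2 (W - {x})" using c2(1) full by simp
  have nx: "w = v \<or> w = y" if "w \<in> W" "adj x w" for w
  proof -
    have "\<not> bad w" using that ef in_bad_nb[of w x] by auto
    then have "w \<in> cluster x" using cluster_facts(4)[OF x xc(1) that(2)] by blast
    then show ?thesis using vy(4) that(2) irr by auto
  qed
  have 3: "valid (c2(x := Fo)) (insert x (W - {x}))"
  proof (rule leafFo[OF c2' V(1)])
    fix a b assume "a \<in> W - {x}" "b \<in> W - {x}" "adj x a" "adj x b" "c2 a = c2 b"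
    then show "a = b" using nx[of a] nx[of b] cv by auto
  qed simp
  have "insert x (W - {x}) = W" using clW xc by auto
  with 3 have 3: "valid (c2(x := Fo)) W" by simp
  have nf: "w = x" if "w \<in> W" "adj f w" for w
    using that bad_adj[OF bf(2)] cluster_facts(6)[OF x xc(1) bf(2,4)] ef(5) by auto
  have "valid (c2(x := Fo, f := Tw)) (insert f W)"
  proof (rule addTw[OF 3 bad_V[OF bf(2)] ef(4)])
    show "(c2(x := Fo)) a \<noteq> Tw" if "a \<in> W" "adj f a" for a using nf[OF that] by simp
    show "(c2(x := Fo)) b \<noteq> Tw" if "a \<in> W" "adj f a" "b \<in> W" "adj a b" for a b
    proof -
      have "a = x" using nf that by blast
      then have "b = v \<or> b = y" using nx that by blast
      then show ?thesis using cv vy(2,3) by auto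
    qed
  qed
  then show ?thesis using that by fastforce
qed

text \<open>If \<open>z\<close> is \<open>Fo\<close>, the third link at \<open>z\<close> is taken
  out, so that \<open>q\<close> is the only neighbour of \<open>z\<close> restricting
  \<open>f\<close>. After colouring \<open>f\<close> unlike \<open>q\<close>, the vertex
  \<open>z\<close> has at most two coloured neighbours and takes the third link back.\<close>

lemma recolour_poor4:
  assumes z: "poor4 z" and ef: "e \<in> bad_nb z" "f \<in> bad_nb z" "e \<noteq> f" "e \<notin> W" "f \<notin> W" "partner f \<notin> W" and c: "valid c W"
    and NB: "\<And>u. u \<in> V \<Longrightarrow> \<not> bad u \<Longrightarrow> u \<in> W"
    and pr: "\<And>d. bad d \<Longrightarrow> anchor d = z \<Longrightarrow> d \<noteq> e \<Longrightarrow> d \<noteq> f \<Longrightarrow> d \<in> W \<and> partner d \<in> W"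
  obtains c' where "valid c' W" "c' z \<noteq> Fo" | c' where "valid c' (insert f W)" "c' f \<noteq> Fo"
proof (cases "c z = Fo")
  case False
  then show ?thesis using that(1) c by blast
next
  case zF: True
  have z4: "card (nb z) = 4" "card (bad_nb z) = 3" using z by (auto simp: poor4_def)
  have "card (bad_nb z - {e, f}) = 1" using ef z4 by (simp add: card_Diff_subset)
  then obtain g where g: "bad_nb z - {e, f} = {g}" by (rule card_1_singletonE)
  have gb: "bad g" "adj z g" "g \<noteq> e" "g \<noteq> f" using g in_bad_nb by blast+
  have "card {y. adj z y \<and> \<not> bad y} = 1" using z4 by (simp add: card_nonbad)
  then obtain q where q: "{y. adj z y \<and> \<not> bad y} = {q}" by (rule card_1_singletonE)
  have q': "adj z q" "\<not> bad q" using q by blast+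
  have az: "w = q \<or> w = e \<or> w = f \<or> w = g" if "adj z w" for w
  proof (cases "bad w")
    case True
    then have "w \<in> bad_nb z" using that by simp
    then show ?thesis using g by blast
  qed (use that q in blast)
  have bf: "bad f" "adj z f" "bad e" using ef by auto
  have enz: "anchor g = z" "anchor f = z" using anchor_eq gb bf z4 by auto
  have gW: "g \<in> W" "partner g \<in> W" using pr[OF gb(1) enz(1) gb(3,4)] by auto
  define W0 where "W0 = W - {g, partner g}"
  have c0: "valid c W0" unfolding W0_def by (rule valid_mono[OF c]) blast
  define k where "k = (if c q = On then Tw else On)"
  have nz: "w = q" if "w \<in> W0" "adj z w" for w using az[OF that(2)] that(1) ef by (auto simp: W0_def)
  have nf: "w = z" if "w \<in> W0" "adj f w" for w
    using that bad_adj[OF bf(1)] enz ef(6) by (auto simp: W0_def)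
  have fW0: "f \<notin> W0" "f \<in> V" using ef bad_V bf by (auto simp: W0_def)
  have 1: "valid (c(f := k)) (insert f W0)"
  proof (cases "c q = On")
    case True
    then have k: "k = Tw" by (simp add: k_def)
    show ?thesis unfolding k
      by (rule addTw[OF c0 fW0(2,1)]) (use nf nz zF True in auto)
  next
    case False
    then have k: "k = On" by (simp add: k_def)
    show ?thesis unfolding k
      by (rule addOn[OF c0 fW0(2,1)]) (use nf nz zF False in auto)
  qed
  have "nb z \<inter> insert f W0 \<subseteq> {q, f}" using nz by auto
  then have "card (nb z \<inter> insert f W0) \<le> card {q, f}" by (intro card_mono) auto
  also have "\<dots> \<le> 2" by (simp add: card_insert_if)
  finally have fl: "flex (c(f := k)) (insert f W0) (anchor g)" unfolding enz by (rule flex_card)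
  have pgf: "partner g \<noteq> f" using gW ef by auto
  have bpg: "bad (partner g)" using bad_facts(5) gb by blast
  have zV: "z \<in> V" using gb adjV by blast
  have zW: "z \<in> W0" using NB[OF zV] deg4_not_bad(1)[OF z] gb(1) bpg by (auto simp: W0_def)
  have ept: "anchor (partner g) \<in> W" "\<not> bad (anchor (partner g))" using NB anchor_V anchor_not_bad bpg by blast+
  then have ewW: "anchor (partner g) \<in> W0" using gb(1) bpg by (auto simp: W0_def)
  obtain c' where c': "valid c' (insert g (insert (partner g) (insert f W0)))" "\<And>w. w \<in> insert f W0 \<Longrightarrow> c' w = (c(f := k)) w"
    by (rule add_bad_path[OF 1 _ _ bad_facts(1,2)[OF gb(1)] _ _ fl]) (use gb pgf zW ewW enz in \<open>auto simp: W0_def\<close>)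
  have "insert g (insert (partner g) (insert f W0)) = insert f W" using gW by (auto simp: W0_def)
  moreover have "c' f \<noteq> Fo" using c'(2)[of f] by (simp add: k_def)
  ultimately show ?thesis using that(2) c'(1) by simp
qed

section \<open>The graph of links between vertices of degree 4\<close>

definition T4 :: "'a set" where
  "T4 = {v. card (nb v) = 4 \<and> 2 \<le> card (bad_nb v)}"

text \<open>Every link with both ends in \<open>T4\<close> occurs twice, once for each
  direction.\<close>

definition links :: "'a set" where
  "links = {d. bad d \<and> anchor d \<in> T4 \<and> anchor (partner d) \<in> T4}"

text \<open>Members of one cluster are at distance at most 2, and a link joins its ends by three
  edges. A link within one class would close a cycle of length at most 5.\<close>

lemma rep_ends_ne:
  assumes d: "bad d" shows "rep (anchor d) \<noteq> rep (anchor (partner d))"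
proof
  assume eq: "rep (anchor d) = rep (anchor (partner d))"
  define a where "a = anchor d"
  define b where "b = anchor (partner d)"
  have bp: "bad (partner d)" using bad_facts(5)[OF d] .
  have ad: "adj a d" "adj d (partner d)" "adj (partner d) b"
    using bad_adj[OF d] bad_adj[OF bp] by (auto simp: a_def b_def)
  have nb: "\<not> bad a" "\<not> bad b" using anchor_not_bad d bp by (auto simp: a_def b_def)
  then have ne: "a \<noteq> partner d" "d \<noteq> b" using d bp by auto
  show False
  proof (cases "a = b")
    case True
    then show False using no3[OF ad(1,2)] ad(3) by blast
  next
    case False
    define x where "x = rep a"
    have x: "center x" "a \<in> cluster x" "b \<in> cluster x"
      using rep_eq[of a b] False eq unfolding a_def b_def x_def by auto
    have "a = x \<or> adj x a" "b = x \<or> adj x b" using x by (auto simp: cluster_def)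
    then consider "adj a b" | "adj x a" "adj x b" using False sym by blast
    then show False
    proof cases
      case 1
      then show False using no4[OF ad _ ne] sym by blast
    next
      case 2
      then show False using no5[OF 2(1) ad] sym by blast
    qed
  qed
qed

text \<open>The vertex \<open>d 0\<close> is the first one on the link from position 0 to position 1 of the cycle. Either its
  anchor gets a colour other than \<open>Fo\<close>, or \<open>d 0\<close> itself is coloured \<open>On\<close> or \<open>Tw\<close> (case \<open>h\<close> below): this link
  can then be closed last. The others are put back from position \<open>m - 1\<close> down to 1.\<close>

lemma no_link_cycle:
  assumes m: "2 \<le> m" and dl: "\<And>k. k < m \<Longrightarrow> d k \<in> links" and inj: "inj_on (\<lambda>k. rep (anchor (d k))) {..<m}"
    and nxt: "\<And>k. k < m \<Longrightarrow> rep (anchor (partner (d k))) = rep (anchor (d (Suc k mod m)))"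
    and nrev: "\<And>k. k < m \<Longrightarrow> d (Suc k mod m) \<noteq> partner (d k)"
    and deg3: "3 \<le> card {u \<in> links. rep (anchor u) = rep (anchor (d 0))}"
  shows False
proof -
  \<comment> \<open>\<open>L k\<close> consists of the inner vertices of the first \<open>k\<close>
    links. \<open>W h k\<close> is the rest, together with \<open>d 0\<close> if this vertex was
    coloured in advance, and \<open>G\<close> is what must survive until the last link.\<close>
  define L where "L k = (\<Union>i<k. {d i, partner (d i)})" for k
  define W where "W h k = (V - L k) \<union> (if h then {d 0} else {})" for h k
  define G where "G h c \<longleftrightarrow> (if h then c (d 0) \<noteq> Fo else c (anchor (d 0)) \<noteq> Fo)" for h and c :: "'a \<Rightarrow> hue"
  \<comment> \<open>\<open>e i\<close> is the inner vertex by which the preceding link of the cycle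
    arrives at position \<open>i\<close>; indices are cyclic.\<close>
  define pv where "pv i = (if i = 0 then m - 1 else i - 1)" for i
  define e where "e i = partner (d (pv i))" for i
  have pv: "pv i < m" "Suc (pv i) mod m = i" if "i < m" for i
    using that m by (auto simp: pv_def)
  have bd: "bad (d k)" "bad (partner (d k))" "partner (partner (d k)) = d k" if "k < m" for k
    using dl[OF that] bad_facts(5,6) by (auto simp: links_def)
  have e: "bad (e i)" "rep (anchor (e i)) = rep (anchor (d i))" "e i \<noteq> d i" "e i \<in> L m" if "i < m" for i
  proof -
    show "bad (e i)" using bd(2)[OF pv(1)[OF that]] by (simp add: e_def)
    show "rep (anchor (e i)) = rep (anchor (d i))" using nxt[OF pv(1)[OF that]] pv(2)[OF that] by (simp add: e_def)
    show "e i \<noteq> d i" using nrev[OF pv(1)[OF that]] pv(2)[OF that] by (metis e_def)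
    show "e i \<in> L m" using pv(1)[OF that] by (auto simp: e_def L_def)
  qed
  have Lb: "bad u" "partner u \<in> L k" if "u \<in> L k" "k \<le> m" for u k
    using that bd by (auto simp: L_def)
  have Lpt: "partner u \<in> L k \<longleftrightarrow> u \<in> L k" if "bad u" "k \<le> m" for u k
    using Lb(2)[of "partner u" k] Lb(2)[of u k] bad_facts(6)[OF that(1)] that by auto
  have Lmono: "L k \<subseteq> L m" if "k \<le> m" for k using that by (force simp: L_def)
  \<comment> \<open>The cycle visits each class once, so at position \<open>i\<close> it has only
    these two link ends.\<close>
  have at: "u = d i \<or> u = e i" if u: "u \<in> L m" "i < m" "rep (anchor u) = rep (anchor (d i))" for u i
  proof -
    obtain j where j: "j < m" "u = d j \<or> u = partner (d j)" using u(1) by (auto simp: L_def)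
    show ?thesis
    proof (cases "u = d j")
      case True
      then have "j = i" using inj_onD[OF inj, of j i] u j by auto
      then show ?thesis using True by simp
    next
      case False
      then have uj: "u = partner (d j)" using j by blast
      have "Suc j mod m = i"
        using inj_onD[OF inj, of "Suc j mod m" i] nxt[OF j(1)] u uj j by auto
      then have "pv i = j" using j(1) by (cases "Suc j = m") (auto simp: pv_def)
      then show ?thesis using uj by (simp add: e_def)
    qed
  qed
  have NB: "u \<in> W h k" if "u \<in> V" "\<not> bad u" "k \<le> m" for u h k
    using that Lb(1) by (auto simp: W_def)
  have d0V: "d 0 \<in> V" using bd(1)[of 0] m bad_V by auto
  have init: "\<exists>h c. valid c (W h m) \<and> G h c"
  proof -
    have "L m \<subseteq> V" using Lb(1)[of _ m] bad_V by blast
    moreover have "L m \<noteq> {}" using e(4)[of 0] m by auto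
    ultimately obtain c where c: "valid c (V - L m)" using colouring_off by blast
    have WF: "W False m = V - L m" and WT: "W True m = insert (d 0) (V - L m)" by (auto simp: W_def)
    have m0: "0 < m" using m by simp
    note e0 = e[OF m0]
    have eW: "e 0 \<notin> V - L m" using e0(4) by blast
    have dL: "d 0 \<in> L m" using m by (auto simp: L_def)
    have dW: "d 0 \<notin> V - L m" "partner (d 0) \<notin> V - L m" using dL Lb(2)[OF dL] by auto
    have NB': "u \<in> V - L m" if "u \<in> V" "\<not> bad u" for u using NB[OF that, of m False] WF by simp
    have pr: "partner u \<in> V - L m" if "bad u" "u \<in> V - L m" for u
      using that Lpt[OF that(1), of m] bad_V[OF bad_facts(5)[OF that(1)]] by auto
    define z where "z = anchor (d 0)"
    show ?thesis
    proof (cases "anchor (e 0) = z")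
      case False
      \<comment> \<open>The cycle enters and leaves a cluster at different members. With the missing
        link \<open>e 0\<close> its anchor may stay in the forest, and the anchor of
        \<open>d 0\<close> leaves it.\<close>
      define x where "x = rep z"
      have x: "center x" "z \<in> cluster x" "anchor (e 0) \<in> cluster x"
        using rep_eq[of z "anchor (e 0)"] False e0(2) unfolding z_def x_def by auto
      obtain c' where c': "valid c' (V - L m)" "\<And>a. a \<in> cluster x \<Longrightarrow> a \<noteq> anchor (e 0) \<Longrightarrow> c' a \<noteq> Fo"
        by (rule recolour_cluster[OF x(1,3) e0(1) refl eW c]) (use NB' pr in blast)+
      have "G False c'" using c'(2)[OF x(2)] False by (simp add: G_def z_def)
      then show ?thesis using c'(1) WF by metis
    next
      case True
      have bz: "e 0 \<in> bad_nb z" "d 0 \<in> bad_nb z"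
        using bad_adj[OF e0(1)] bad_adj[OF bd(1)[OF m0]] e0(1) bd(1)[OF m0] True by (auto simp: z_def)
      have zT: "z \<in> T4" using dl[OF m0] by (simp add: links_def z_def)
      then have z4: "card (nb z) = 4" "2 \<le> card (bad_nb z)" by (auto simp: T4_def)
      have "card (bad_nb z) \<noteq> 4"
      proof
        assume "card (bad_nb z) = 4"
        then have "bad_nb z = nb z" using card_subset_eq[OF fin_nb bad_nb_sub] z4 by simp
        then have "almost_bad z (e 0)" unfolding almost_bad_def using bz z4 in_bad_nb by (metis in_bad_nb order_refl)
        then show False using almost_bad_not_deg2 bad_facts(3)[OF e0(1)] by blast
      qed
      moreover have "card (bad_nb z) \<le> 4" using card_mono[OF fin_nb bad_nb_sub] z4 by metis
      ultimately consider "card (bad_nb z) = 3" | "card (bad_nb z) = 2" using z4 by linarith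
      then show ?thesis
      proof cases
        case 1
        then have P: "poor4 z" using z4 by (simp add: poor4_def)
        have pr': "u \<in> V - L m \<and> partner u \<in> V - L m" if "bad u" "anchor u = z" "u \<noteq> e 0" "u \<noteq> d 0" for u
        proof -
          have "u \<notin> L m" using at[of u 0] that m0 by (auto simp: z_def)
          then show ?thesis using pr that bad_V by blast
        qed
        show ?thesis
        proof (rule recolour_poor4[OF P bz e0(3) eW dW c NB' pr'])
          fix c' assume "valid c' (V - L m)" "c' z \<noteq> Fo"
          then have "valid c' (W False m) \<and> G False c'" using WF by (simp add: G_def z_def)
          then show ?thesis by blast
        next
          fix c' assume "valid c' (insert (d 0) (V - L m))" "c' (d 0) \<noteq> Fo"
          then have "valid c' (W True m) \<and> G True c'" using WT by (simp add: G_def)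
          then show ?thesis by blast
        qed
      next
        case 2
        have bnz: "bad_nb z = {e 0, d 0}"
          by (rule card_seteq[symmetric]) (use bz 2 e0(3) in auto)
        \<comment> \<open>This is where the third dart at the opening node is used: a vertex with
          only two links that is no center would be a class of its own with no dart besides
          \<open>d 0\<close> and \<open>e 0\<close>.\<close>
        have cz: "center z"
        proof (rule ccontr)
          assume nc: "\<not> center z"
          have rz: "rep z = z"
            using rep_cases[of z] 2 by (auto simp: rep_def poor4_def)
          have "{u \<in> links. rep (anchor u) = rep (anchor (d 0))} \<subseteq> {e 0, d 0}"
          proof
            fix u assume "u \<in> {u \<in> links. rep (anchor u) = rep (anchor (d 0))}"
            then have u: "bad u" "rep (anchor u) = z" using rz by (auto simp: links_def z_def)
            then have "anchor u = z" using rep_cases[of "anchor u"] nc by auto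
            then have "u \<in> bad_nb z" using bad_adj[OF u(1)] u(1) by auto
            then show "u \<in> {e 0, d 0}" using bnz by simp
          qed
          then have "card {u \<in> links. rep (anchor u) = rep (anchor (d 0))} \<le> card {e 0, d 0}" by (intro card_mono) auto
          also have "\<dots> \<le> 2" by (simp add: card_insert_if)
          finally show False using deg3 by simp
        qed
        obtain c' where "valid c' (insert (d 0) (V - L m))" "c' (d 0) \<noteq> Fo"
          by (rule recolour_center[OF cz bnz e0(3) eW dW c]) (use NB' pr in blast)+
        then have "valid c' (W True m) \<and> G True c'" using WT by (simp add: G_def)
        then show ?thesis by blast
      qed
    qed
  qed
  \<comment> \<open>As links return in decreasing order, \<open>e i\<close> is still missing when
    link \<open>i\<close> is inserted. If both meet the same vertex, two of its four neighbours are
    uncoloured and it is flexible. If they meet a cluster at different members, recolouring it moves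
    the anchor of \<open>d i\<close> out of the forest.\<close>
  have step: "\<exists>c'. valid c' (W h (k - 1)) \<and> G h c'"
    if k: "2 \<le> k" "k \<le> m" and c: "valid c (W h k)" and g: "G h c" for h c k
  proof -
    define i where "i = k - 1"
    have i: "1 \<le> i" "i < m" "k = Suc i" using k by (auto simp: i_def)
    have m0: "0 < m" using m by simp
    have Ni: "rep (anchor (d 0)) \<noteq> rep (anchor (d i))" using inj_onD[OF inj, of 0 i] i m by auto
    note ei = e[OF i(2)] and di = bd[OF i(2)]
    have eq: "e i = partner (d (i - 1))" using i by (simp add: e_def pv_def)
    have eL: "e i \<in> L k" using i by (auto simp: eq L_def)
    have fL: "d i \<in> L k" using i by (auto simp: L_def)
    have pL: "partner (d i) \<in> L k" using Lb(2)[OF fL k(2)] .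
    have e0: "e i \<noteq> d 0" using ei(2) Ni by metis
    have f0: "d i \<noteq> d 0" using Ni by metis
    have p0: "partner (d i) \<noteq> d 0"
    proof
      assume a: "partner (d i) = d 0"
      then have "rep (anchor (d (Suc i mod m))) = rep (anchor (d 0))" using nxt[OF i(2)] by simp
      then have "Suc i mod m = 0" using inj_onD[OF inj, of "Suc i mod m" 0] m by auto
      then show False using nrev[OF i(2)] a by simp
    qed
    have out: "e i \<notin> W h k" "d i \<notin> W h k" "partner (d i) \<notin> W h k"
      using eL fL pL e0 f0 p0 by (auto simp: W_def)
    have pd0: "partner (d 0) \<notin> W h k"
      using bd(1)[OF m0] k partner_ne(1) by (auto simp: W_def L_def)
    have ends: "anchor (d i) \<in> W h k" "anchor (partner (d i)) \<in> W h k" using NB anchor_V anchor_not_bad di k by auto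
    have "\<exists>c1. valid c1 (W h k) \<and> G h c1 \<and> flex c1 (W h k) (anchor (d i))"
    proof (cases "anchor (e i) = anchor (d i)")
      case True
      let ?z = "anchor (d i)"
      have b: "adj ?z (e i)" "adj ?z (d i)" using bad_adj[OF ei(1)] bad_adj[OF di(1)] True by auto
      have "card (nb ?z) = 4" using dl[OF i(2)] by (simp add: links_def T4_def)
      then have "card (nb ?z - {e i, d i}) = 2" using b ei(3) by (simp add: card_Diff_subset)
      moreover have "nb ?z \<inter> W h k \<subseteq> nb ?z - {e i, d i}" using out by auto
      ultimately have "card (nb ?z \<inter> W h k) \<le> 2"
        using card_mono[of "nb ?z - {e i, d i}" "nb ?z \<inter> W h k"] by simp
      then show ?thesis using flex_card c g by blast
    next
      case False
      define x where "x = rep (anchor (d i))"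
      have x: "center x" "anchor (d i) \<in> cluster x" "anchor (e i) \<in> cluster x"
        using rep_eq[of "anchor (d i)" "anchor (e i)"] False ei(2) unfolding x_def by auto
      \<comment> \<open>The recoloured cluster is not the class at position 0, which is why
        \<open>G\<close> is preserved.\<close>
      have nd0: "anchor (d 0) \<notin> cluster x" using cluster_facts(3)[OF x(1)] Ni unfolding x_def by metis
      have pr: "partner u \<in> W h k" if u: "bad u" "anchor u \<in> cluster x" "u \<in> W h k" for u
      proof -
        have "u \<noteq> d 0" using nd0 u by metis
        then have "u \<notin> L k" using u by (auto simp: W_def split: if_splits)
        then show ?thesis using Lpt[OF u(1) k(2)] bad_V[OF bad_facts(5)[OF u(1)]] by (auto simp: W_def)
      qed
      obtain c' where c': "valid c' (W h k)" "\<And>a. a \<in> cluster x \<Longrightarrow> a \<noteq> anchor (e i) \<Longrightarrow> c' a \<noteq> Fo"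
        "\<And>u. u \<in> W h k \<Longrightarrow> u \<notin> cluster x \<Longrightarrow> (\<And>d. bad d \<Longrightarrow> anchor d \<in> cluster x \<Longrightarrow> d \<in> W h k \<Longrightarrow> u \<noteq> d \<and> u \<noteq> partner d) \<Longrightarrow> c' u = c u"
        by (rule recolour_cluster[OF x(1,3) ei(1) refl out(1) c]) (use NB[OF _ _ k(2)] pr in blast)+
      have d0b: "bad (d 0)" "bad (partner (d 0))" "partner (partner (d 0)) = d 0" using bd[OF m0] by auto
      have "c' (d 0) = c (d 0)" if h
      proof (rule c'(3))
        show "d 0 \<in> W h k" using that by (simp add: W_def)
        show "d 0 \<notin> cluster x" using cluster_facts(2)[OF x(1)] d0b by blast
        fix u assume u: "bad u" "anchor u \<in> cluster x" "u \<in> W h k"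
        have "u \<noteq> partner (d 0)" using u pd0 by blast
        then show "d 0 \<noteq> u \<and> d 0 \<noteq> partner u" using u nd0 bad_facts(6)[OF u(1)] by metis
      qed
      moreover have "c' (anchor (d 0)) = c (anchor (d 0))"
      proof (rule c'(3))
        show "anchor (d 0) \<in> W h k" using NB anchor_V anchor_not_bad d0b k by auto
        show "anchor (d 0) \<notin> cluster x" by (rule nd0)
        fix u assume u: "bad u" "anchor u \<in> cluster x" "u \<in> W h k"
        then show "anchor (d 0) \<noteq> u \<and> anchor (d 0) \<noteq> partner u" using anchor_not_bad[OF d0b(1)] bad_facts(5)[OF u(1)] by metis
      qed
      ultimately have "G h c'" using g by (auto simp: G_def split: if_splits)
      moreover have "c' (anchor (d i)) \<noteq> Fo" using c'(2)[OF x(2)] False by metis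
      ultimately show ?thesis using c'(1) unfolding flex_def by blast
    qed
    then obtain c1 where c1: "valid c1 (W h k)" "G h c1" "flex c1 (W h k) (anchor (d i))" by blast
    obtain c2 where c2: "valid c2 (insert (d i) (insert (partner (d i)) (W h k)))" "\<And>u. u \<in> W h k \<Longrightarrow> c2 u = c1 u"
      by (rule add_bad_path[OF c1(1) out(2,3) bad_facts(1,2)[OF di(1)] ends c1(3)]) blast
    have nl: "d i \<notin> L i"
    proof
      assume "d i \<in> L i"
      then obtain j where j: "j < i" "d i = d j \<or> d i = partner (d j)" by (auto simp: L_def)
      have "d i \<noteq> d j" using inj_onD[OF inj, of i j] j i by auto
      then have a: "d i = partner (d j)" using j by blast
      then have "Suc j mod m = i" using nxt[of j] inj_onD[OF inj, of "Suc j mod m" i] j i by auto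
      then show False using nrev[of j] a j i by auto
    qed
    then have nl2: "partner (d i) \<notin> L i" using Lpt[OF di(1), of i] i by auto
    have "L k = insert (d i) (insert (partner (d i)) (L i))" unfolding L_def i(3) lessThan_Suc by auto
    then have "insert (d i) (insert (partner (d i)) (W h k)) = W h i"
      using nl nl2 bad_V di by (auto simp: W_def)
    moreover have "G h c2"
    proof -
      have "anchor (d 0) \<in> W h k" using NB anchor_V anchor_not_bad bd(1)[OF m0] k by auto
      then show ?thesis using c1(2) c2(2) by (auto simp: G_def W_def split: if_splits)
    qed
    ultimately show ?thesis using c2(1) unfolding i_def by metis
  qed
  obtain h c0 where c0: "valid c0 (W h m)" "G h c0" using init by blast
  have "\<exists>c. valid c (W h (m - j)) \<and> G h c" if "j \<le> m - 1" for j
    using that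
  proof (induction j)
    case 0
    then show ?case using c0 by auto
  next
    case (Suc j)
    then obtain c where "valid c (W h (m - j))" "G h c" by auto
    then have "\<exists>c. valid c (W h (m - j - 1)) \<and> G h c" using step[of "m - j" c h] Suc.prems by auto
    then show ?case by simp
  qed
  from this[of "m - 1"] obtain c where c: "valid c (W h 1)" "G h c" using m by auto
  have m0: "0 < m" using m by simp
  note b0 = bd[OF m0]
  have L1: "L 1 = {d 0, partner (d 0)}" by (auto simp: L_def)
  have ends: "anchor (d 0) \<in> V - L 1" "anchor (partner (d 0)) \<in> V - L 1"
    using anchor_V[OF b0(1)] anchor_V[OF b0(2)] anchor_not_bad[OF b0(1)] anchor_not_bad[OF b0(2)] b0(1,2) unfolding L1 by auto
  have close: False if cc: "valid c' (V - L 1)" "c' (anchor (d 0)) \<noteq> Fo" for c'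
  proof -
    have "flex c' (V - L 1) (anchor (d 0))" using cc by (simp add: flex_def)
    then obtain c2 where "valid c2 (insert (d 0) (insert (partner (d 0)) (V - L 1)))"
      by (rule add_bad_path[OF cc(1) _ _ bad_facts(1,2)[OF b0(1)] ends, rotated 2]) (use L1 in auto)
    moreover have "insert (d 0) (insert (partner (d 0)) (V - L 1)) = V" using L1 bad_V b0 by auto
    ultimately show False using uncol by simp
  qed
  show False
  proof (cases h)
    case False
    then show False using close c by (simp add: W_def G_def)
  next
    case True
    have ne: "partner (d 0) \<noteq> d 0" using partner_ne(1)[OF b0(1)] .
    have Weq: "W h 1 = V - {partner (d 0)}" using True L1 d0V ne by (auto simp: W_def)
    have cd: "c (d 0) \<noteq> Fo" using c(2) True by (simp add: G_def)
    have cw: "valid c (V - {partner (d 0)})" using c(1) Weq by simp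
    show False
    proof (cases "c (anchor (partner (d 0))) = c (d 0)")
      case False
      have "valid (c(partner (d 0) := Fo)) (insert (partner (d 0)) (V - {partner (d 0)}))"
        by (rule add_deg2[OF cw _ bad_facts(2)[OF b0(1)]]) (use False in auto)
      moreover have "insert (partner (d 0)) (V - {partner (d 0)}) = V" using bad_V b0 by auto
      ultimately show False using uncol by simp
    next
      \<comment> \<open>The common colour is not \<open>Fo\<close>, so the far end of the link is
        flexible: \<open>d 0\<close> is uncoloured again and the whole link is put back from that
        end.\<close>
      case same: True
      have c': "valid c (V - L 1)" by (rule valid_mono[OF cw]) (use L1 in auto)
      have fl: "flex c (V - L 1) (anchor (partner (d 0)))" using same cd by (simp add: flex_def)
      have p: "nb (partner (d 0)) = {anchor (partner (d 0)), d 0}" "nb (d 0) = {partner (d 0), anchor (d 0)}"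
        using bad_facts(1,2)[OF b0(1)] by auto
      obtain c2 where "valid c2 (insert (partner (d 0)) (insert (d 0) (V - L 1)))"
        by (rule add_bad_path[OF c' _ _ p ends(2,1) fl]) (use L1 in auto)
      moreover have "insert (partner (d 0)) (insert (d 0) (V - L 1)) = V" using L1 bad_V b0 by auto
      ultimately show False using uncol by simp
    qed
  qed
qed

lemma fin_T4: "finite T4" and fin_links: "finite links"
proof -
  have "T4 \<subseteq> V"
  proof
    fix v assume "v \<in> T4"
    then have "nb v \<noteq> {}" by (auto simp: T4_def)
    then show "v \<in> V" using adjV by auto
  qed
  then show "finite T4" using finV finite_subset by blast
  have "links \<subseteq> V" using bad_V by (auto simp: links_def)
  then show "finite links" using finV finite_subset by blast
qed

text \<open>Since \<open>links\<close> holds both directions of each link, this bounds the number of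
  links by the number of classes.\<close>

lemma links_le: "card links \<le> 2 * card (rep ` T4)"
proof (rule ccontr)
  assume big: "\<not> ?thesis"
  show False
  proof (rule dart_cycle[OF fin_links, of "rep ` T4" partner "\<lambda>d. rep (anchor d)"])
    show "finite (rep ` T4)" using fin_T4 by simp
    show "partner d \<in> links" "partner (partner d) = d" "rep (anchor d) \<in> rep ` T4" if "d \<in> links" for d
      using that bad_facts(5,6) by (auto simp: links_def)
    show "rep (anchor (partner d)) \<noteq> rep (anchor d)" if "d \<in> links" for d
      using that rep_ends_ne[of d] by (auto simp: links_def)
    show "2 * card (rep ` T4) < card links" using big by simp
  qed (rule no_link_cycle)
qed

section \<open>Discharging\<close>

text \<open>Its charge is 105 - 54 - 48 = 3 after serving four links; the gain of 1 provides the one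
  unit per link demanded in \<open>final_rest\<close>.\<close>

definition poor5 :: "'a \<Rightarrow> bool" where
  "poor5 v \<longleftrightarrow> card (nb v) = 5 \<and> card (bad_nb v) = 4"

text \<open>The vertex \<open>y\<close> of a \<open>twig\<close>. Its charge is 63 - 54 - 12 = -3
  after paying the two neighbours of degree 2, which explains the gain of 3.\<close>

definition twig_root :: "'a \<Rightarrow> bool" where
  "twig_root y \<longleftrightarrow> card (nb y) = 3 \<and> card {u. adj y u \<and> card (nb u) = 2} = 2"

text \<open>Charges are multiplied by 21, so that the bound 18/7 on the average degree becomes 54. Every vertex of
  degree at least 3 gives \<open>gain w\<close> to each neighbour \<open>w\<close>.\<close>

definition gain :: "'a \<Rightarrow> int" where
  "gain w = (if bad w then 12 else if card (nb w) = 2 then 6 else if poor4 w then 5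
     else if twig_root w then 3 else if poor5 w then 1 else 0)"

definition final :: "'a \<Rightarrow> int" where
  "final v = 21 * int (card (nb v)) - 54 - (if 3 \<le> card (nb v) then \<Sum>w\<in>nb v. gain w else 0)
     + gain v * int (card {w. adj v w \<and> 3 \<le> card (nb w)})"

section \<open>Final charges of single vertices\<close>

lemma gain_bounds: "0 \<le> gain w" "\<not> bad w \<Longrightarrow> gain w \<le> 6"
  by (auto simp: gain_def)

lemma in_nonneg: "0 \<le> gain v * int (card {w. adj v w \<and> 3 \<le> card (nb w)})"
  using gain_bounds by simp

lemma sum_final: "(\<Sum>v\<in>V. final v) = (\<Sum>v\<in>V. 21 * int (card (nb v)) - 54)"
proof -
  define t where "t v w = (if adj v w \<and> 3 \<le> card (nb v) then gain w else 0)" for v w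
  have nbV: "nb v = {w \<in> V. adj v w}" for v using adjV2 by auto
  have out: "(if 3 \<le> card (nb v) then \<Sum>w\<in>nb v. gain w else 0) = (\<Sum>w\<in>V. t v w)" for v
  proof (cases "3 \<le> card (nb v)")
    case True
    then have "(\<Sum>w\<in>V. t v w) = (\<Sum>w\<in>V. if adj v w then gain w else 0)"
      by (auto simp: t_def)
    also have "\<dots> = (\<Sum>w\<in>{w \<in> V. adj v w}. gain w)"
      by (rule sum.inter_filter[OF finV, symmetric])
    finally show ?thesis using True nbV by simp
  qed (simp add: t_def)
  have inn: "gain v * int (card {w. adj v w \<and> 3 \<le> card (nb w)}) = (\<Sum>w\<in>V. t w v)" for v
  proof -
    have "(\<Sum>w\<in>V. t w v) = (\<Sum>w\<in>V. if adj v w \<and> 3 \<le> card (nb w) then gain v else 0)"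
      unfolding t_def using sym by (intro sum.cong) auto
    also have "\<dots> = (\<Sum>w\<in>{w \<in> V. adj v w \<and> 3 \<le> card (nb w)}. gain v)"
      by (rule sum.inter_filter[OF finV, symmetric])
    also have "{w \<in> V. adj v w \<and> 3 \<le> card (nb w)} = {w. adj v w \<and> 3 \<le> card (nb w)}" using adjV2 by auto
    finally show ?thesis by simp
  qed
  have "(\<Sum>v\<in>V. final v) = (\<Sum>v\<in>V. 21 * int (card (nb v)) - 54) - (\<Sum>v\<in>V. \<Sum>w\<in>V. t v w) + (\<Sum>v\<in>V. \<Sum>w\<in>V. t w v)"
    unfolding final_def out inn by (simp add: sum.distrib sum_subtractf)
  also have "(\<Sum>v\<in>V. \<Sum>w\<in>V. t w v) = (\<Sum>v\<in>V. \<Sum>w\<in>V. t v w)" by (rule sum.swap)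
  finally show ?thesis by simp
qed

text \<open>If all neighbours were bad, \<open>v\<close> would be almost bad with respect to one of
  them, which has degree 2.\<close>

lemma bad_lt:
  assumes "4 \<le> card (nb v)" shows "card (bad_nb v) < card (nb v)"
proof (rule ccontr)
  assume "\<not> ?thesis"
  then have eq: "bad_nb v = nb v" using card_seteq[OF fin_nb bad_nb_sub] by simp
  have "nb v \<noteq> {}" using assms by auto
  then obtain q where q: "q \<in> nb v" by blast
  have qb: "bad q" using q eq in_bad_nb by blast
  have "\<forall>u\<in>nb v. bad u" using eq in_bad_nb by blast
  then have "almost_bad v q" using q assms unfolding almost_bad_def by simp
  then show False using almost_bad_not_deg2 bad_facts(3)[OF qb] by blast
qed

lemma almost_badI:
  assumes "4 \<le> card (nb v)" "card (nb v) = Suc (card (bad_nb v))" "adj v q" "\<not> bad q" shows "almost_bad v q"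
proof -
  have "card {y. adj v y \<and> \<not> bad y} = 1" using assms by (simp add: card_nonbad)
  then obtain q' where "{y. adj v y \<and> \<not> bad y} = {q'}" by (rule card_1_singletonE)
  then have q': "w = q'" if "adj v w" "\<not> bad w" for w using that by blast
  have "bad u" if "adj v u" "u \<noteq> q" for u using q'[of u] q'[OF assms(3,4)] that by auto
  then have "\<forall>u\<in>nb v. u \<noteq> q \<longrightarrow> bad u" by simp
  then show ?thesis using assms(1,3) unfolding almost_bad_def by blast
qed

lemma poor4_almost_bad: "poor4 v \<Longrightarrow> adj v q \<Longrightarrow> \<not> bad q \<Longrightarrow> almost_bad v q"
  by (rule almost_badI) (auto simp: poor4_def)

lemma poor5_almost_bad: "poor5 v \<Longrightarrow> adj v q \<Longrightarrow> \<not> bad q \<Longrightarrow> almost_bad v q"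
  by (rule almost_badI) (auto simp: poor5_def)

lemma poor5_not_bad: "poor5 v \<Longrightarrow> \<not> bad v"
  using not_bad_deg[of v] by (auto simp: poor5_def)

lemma twig_root_deg2:
  assumes "twig_root y" "adj y x" "card (nb x) \<noteq> 2" "adj y z" "z \<noteq> x" shows "card (nb z) = 2"
proof (rule ccontr)
  assume z: "card (nb z) \<noteq> 2"
  let ?S = "{u. adj y u \<and> card (nb u) = 2}"
  have "?S \<subseteq> nb y - {x, z}" using assms z by auto
  then have "card ?S \<le> card (nb y - {x, z})" by (intro card_mono) auto
  also have "\<dots> = 1" using assms by (simp add: card_Diff_subset twig_root_def)
  finally show False using assms(1) by (simp add: twig_root_def)
qed

lemma twig_root_twig:
  assumes "twig_root y" "adj x y" "card (nb x) \<noteq> 2"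
  obtains t1 t2 s1 s2 where "twig x y t1 t2 s1 s2"
proof -
  have a: "adj y x" using assms(2) sym by blast
  show ?thesis
    using twigI[of y x] assms a twig_root_deg2[OF assms(1) a assms(3)] that unfolding twig_root_def by metis
qed

text \<open>Each kind of vertex with positive gain has been excluded in the place of
  \<open>q\<close>. So poor vertices pay for their links and nothing else.\<close>

lemma almost_bad_gain:
  assumes A: "almost_bad v q" and q: "\<not> bad q" shows "gain q = 0"
proof -
  have v4: "4 \<le> card (nb v)" and vq: "adj v q" "adj q v" using A sym by (auto simp: almost_bad_def)
  have vb: "\<not> bad v" using v4 not_bad_deg[of v] by auto
  have 2: "card (nb q) \<noteq> 2" using almost_bad_not_deg2[OF A] .
  have "\<not> poor4 q" "\<not> poor5 q" using poor4_almost_bad[OF _ vq(2) vb] poor5_almost_bad[OF _ vq(2) vb] almost_bad_asym[OF A] by blast+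
  moreover have "\<not> twig_root q"
  proof
    assume t: "twig_root q"
    then have "card {u. adj q u \<and> card (nb u) = 2} \<noteq> 0" by (simp add: twig_root_def)
    then have "{u. adj q u \<and> card (nb u) = 2} \<noteq> {}" by (metis card.empty)
    then obtain a where "adj q a" "card (nb a) = 2" by blast
    then show False using almost_bad_deg3(2)[OF A] t by (simp add: twig_root_def)
  qed
  ultimately show ?thesis using q 2 by (simp add: gain_def)
qed

lemma sum_gain: "(\<Sum>w\<in>nb v. gain w) = 12 * int (card (bad_nb v)) + (\<Sum>w\<in>{y. adj v y \<and> \<not> bad y}. gain w)"
proof -
  have e: "nb v = bad_nb v \<union> {y. adj v y \<and> \<not> bad y}" by auto
  have f: "finite {y. adj v y \<and> \<not> bad y}" by (rule finite_subset[OF _ fin_nb[of v]]) auto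
  have "(\<Sum>w\<in>nb v. gain w) = (\<Sum>w\<in>bad_nb v. gain w) + (\<Sum>w\<in>{y. adj v y \<and> \<not> bad y}. gain w)"
    by (subst e, rule sum.union_disjoint) (use f in auto)
  moreover have "(\<Sum>w\<in>bad_nb v. gain w) = (\<Sum>w\<in>bad_nb v. 12)" by (intro sum.cong) (auto simp: gain_def)
  ultimately show ?thesis by simp
qed

lemma sum_gain_le: "(\<Sum>w\<in>{y. adj v y \<and> \<not> bad y}. gain w) \<le> 6 * int (card (nb v) - card (bad_nb v))"
proof -
  have "(\<Sum>w\<in>{y. adj v y \<and> \<not> bad y}. gain w) \<le> (\<Sum>w\<in>{y. adj v y \<and> \<not> bad y}. 6)"
    by (rule sum_mono) (use gain_bounds in auto)
  then show ?thesis using card_nonbad[of v] by simp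
qed

text \<open>The neighbour \<open>q\<close> has degree at least 3 and is the only such neighbour:
  \<open>v\<close> receives its gain exactly once and gives \<open>q\<close> nothing.\<close>

lemma final_almost_bad:
  assumes v4: "4 \<le> card (nb v)" "card (nb v) = Suc (card (bad_nb v))"
  shows "final v = 21 * int (card (nb v)) - 54 - 12 * int (card (bad_nb v)) + gain v"
proof -
  have "card {y. adj v y \<and> \<not> bad y} = 1" using assms by (simp add: card_nonbad)
  then obtain q where q: "{y. adj v y \<and> \<not> bad y} = {q}" by (rule card_1_singletonE)
  then have vq: "adj v q" "\<not> bad q" by blast+
  have A: "almost_bad v q" using almost_badI[OF v4 vq] .
  have q2: "card (nb q) \<noteq> 2" using almost_bad_not_deg2[OF A] .
  have "2 \<le> card (nb q)" using deg_ge2 adjV2 vq by blast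
  then have q3: "3 \<le> card (nb q)" using q2 by linarith
  have "{w. adj v w \<and> 3 \<le> card (nb w)} = {q}"
  proof
    show "{w. adj v w \<and> 3 \<le> card (nb w)} \<subseteq> {q}"
    proof
      fix w assume w: "w \<in> {w. adj v w \<and> 3 \<le> card (nb w)}"
      then have "\<not> bad w" using bad_facts(3)[of w] by auto
      then show "w \<in> {q}" using w q by blast
    qed
  qed (use vq q3 in auto)
  then have "gain v * int (card {w. adj v w \<and> 3 \<le> card (nb w)}) = gain v" by simp
  moreover have "(\<Sum>w\<in>nb v. gain w) = 12 * int (card (bad_nb v))"
    using sum_gain[of v] almost_bad_gain[OF A vq(2)] unfolding q by simp
  ultimately show ?thesis using v4 by (simp add: final_def)
qed

text \<open>The missing 54 - 42 = 12 come from the anchor alone for a bad vertex, and in halves from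
  both neighbours otherwise.\<close>

lemma final_deg2:
  assumes "card (nb u) = 2" shows "final u = 0"
proof (cases "bad u")
  case True
  have e3: "3 \<le> card (nb (anchor u))" "card (nb (partner u)) = 2" using bad_facts(4,7)[OF True] by auto
  have "{w. adj u w \<and> 3 \<le> card (nb w)} = {anchor u}"
    using bad_adj(1)[OF True] e3 by auto
  then show ?thesis using True assms by (simp add: final_def gain_def)
next
  case False
  have "3 \<le> card (nb w)" if "adj u w" for w
  proof -
    have "card (nb w) \<noteq> 2" using False assms that by (auto simp: bad_def)
    moreover have "2 \<le> card (nb w)" using deg_ge2 adjV2[OF that] by blast
    ultimately show ?thesis by linarith
  qed
  then have "{w. adj u w \<and> 3 \<le> card (nb w)} = nb u" by auto
  then show ?thesis using False assms by (simp add: final_def gain_def)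
qed

text \<open>\<open>almost_bad_deg3\<close> forbids \<open>poor4\<close> beside a vertex of degree 3,
  and also \<open>poor5\<close> if that vertex has a neighbour of degree 2.\<close>

lemma gain_nbr_deg3:
  assumes v3: "card (nb v) = 3" and w: "adj v w" "card (nb w) \<noteq> 2"
  shows "gain w \<le> 3" "adj v u \<Longrightarrow> card (nb u) = 2 \<Longrightarrow> gain w = (if twig_root w then 3 else 0)"
proof -
  have wv: "adj w v" using w sym by blast
  have vb: "\<not> bad v" using v3 not_bad_deg[of v] by auto
  have wb: "\<not> bad w" using w not_bad_deg by blast
  have p: "\<not> poor4 w"
    using almost_bad_deg3(1)[OF poor4_almost_bad[OF _ wv vb] v3] by (auto simp: poor4_def)
  show "gain w \<le> 3" using p wb w by (auto simp: gain_def)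
  assume u: "adj v u" "card (nb u) = 2"
  have "\<not> poor5 w" using almost_bad_deg3(2)[OF poor5_almost_bad[OF _ wv vb] v3 u(1)] u(2) by blast
  then show "gain w = (if twig_root w then 3 else 0)" using p wb w by (auto simp: gain_def)
qed

text \<open>The initial charge is 9. Without neighbours of degree 2 it covers three gains of at most
  3. One such neighbour leaves 3, and \<open>no_two_twigs\<close> allows only one twig root; two
  leave -3, which the third neighbour repays, taking nothing by \<open>no_adjacent_twigs\<close>;
  three are impossible.\<close>

lemma final_deg3:
  assumes v3: "card (nb v) = 3" shows "0 \<le> final v"
proof -
  have vb: "\<not> bad v" using v3 not_bad_deg[of v] by auto
  define S where "S = {u. adj v u \<and> card (nb u) = 2}"
  have SV: "S \<subseteq> nb v" by (auto simp: S_def)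
  have fS: "finite S" using finite_subset[OF SV fin_nb] .
  have S3: "card S \<le> 3" using card_mono[OF fin_nb SV] v3 by simp
  have fin: "final v = 9 - (\<Sum>w\<in>nb v. gain w) + gain v * int (card {w. adj v w \<and> 3 \<le> card (nb w)})"
    using v3 by (simp add: final_def)
  have split: "(\<Sum>w\<in>nb v. gain w) = 6 * int (card S) + (\<Sum>w\<in>nb v - S. gain w)"
  proof -
    have "(\<Sum>w\<in>nb v. gain w) = (\<Sum>w\<in>nb v - S. gain w) + (\<Sum>w\<in>S. gain w)"
      by (rule sum.subset_diff[OF SV fin_nb])
    moreover have "(\<Sum>w\<in>S. gain w) = (\<Sum>w\<in>S. 6)"
      by (rule sum.cong) (use bad_end_deg3[OF v3] in \<open>auto simp: S_def gain_def\<close>)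
    ultimately show ?thesis by simp
  qed
  have rest: "card (nb v - S) = 3 - card S" using card_Diff_subset[OF fS SV] v3 by simp
  have out: "adj v w" "card (nb w) \<noteq> 2" if "w \<in> nb v - S" for w using that by (auto simp: S_def)
  consider "card S = 0" | "card S = 1" | "card S = 2" | "card S = 3" using S3 by linarith
  then show ?thesis
  proof cases
    case 1
    have "(\<Sum>w\<in>nb v - S. gain w) \<le> (\<Sum>w\<in>nb v - S. 3)"
      by (rule sum_mono) (rule gain_nbr_deg3(1)[OF v3 out])
    also have "\<dots> = 9" using rest 1 by simp
    finally show ?thesis using fin split 1 in_nonneg[of v] by simp
  next
    case 2
    then obtain u where u: "S = {u}" by (rule card_1_singletonE)
    then have u': "adj v u" "card (nb u) = 2" by (auto simp: S_def)
    have "card (nb v - S) = 2" using rest 2 by simp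
    then obtain p q where pq: "nb v - S = {p, q}" "p \<noteq> q" unfolding card_2_iff by blast
    have p: "adj v p" "card (nb p) \<noteq> 2" and q: "adj v q" "card (nb q) \<noteq> 2" using out pq by auto
    have "\<not> (twig_root p \<and> twig_root q)"
    proof
      assume t: "twig_root p \<and> twig_root q"
      have v2: "card (nb v) \<noteq> 2" using v3 by simp
      obtain t1 t2 s1 s2 where T1: "twig v p t1 t2 s1 s2" using twig_root_twig[OF _ p(1) v2] t by blast
      obtain t3 t4 s3 s4 where T2: "twig v q t3 t4 s3 s4" using twig_root_twig[OF _ q(1) v2] t by blast
      show False using no_two_twigs[OF T1 T2 pq(2) v3 u'(1) _ _ u'(2)] u'(2) p(2) q(2) by blast
    qed
    then have "gain p + gain q \<le> 3"
      using gain_nbr_deg3(2)[OF v3 p u'] gain_nbr_deg3(2)[OF v3 q u'] by auto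
    then have "(\<Sum>w\<in>nb v - S. gain w) \<le> 3" unfolding pq using pq(2) by simp
    then show ?thesis using fin split 2 in_nonneg[of v] by simp
  next
    case 3
    then have t: "twig_root v" using v3 by (simp add: twig_root_def S_def)
    have gv: "gain v = 3" using t v3 vb by (auto simp: gain_def poor4_def)
    have "card (nb v - S) = 1" using rest 3 by simp
    then obtain x where x: "nb v - S = {x}" by (rule card_1_singletonE)
    have x': "adj v x" "card (nb x) \<noteq> 2" using out x by auto
    have xv: "adj x v" using x' sym by blast
    have "2 \<le> card (nb x)" using deg_ge2 adjV2[OF x'(1)] by blast
    then have "{w. adj v w \<and> 3 \<le> card (nb w)} = {x}"
      using x x'(2) unfolding S_def by fastforce
    then have inn: "gain v * int (card {w. adj v w \<and> 3 \<le> card (nb w)}) = 3" using gv by simp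
    have "S \<noteq> {}" using 3 by auto
    then obtain u where u: "adj v u" "card (nb u) = 2" by (auto simp: S_def)
    have v2: "card (nb v) \<noteq> 2" using v3 by simp
    have "\<not> twig_root x"
    proof
      assume tx: "twig_root x"
      obtain t1 t2 s1 s2 where T1: "twig x v t1 t2 s1 s2" using twig_root_twig[OF t xv x'(2)] by blast
      obtain t3 t4 s3 s4 where T2: "twig v x t3 t4 s3 s4" using twig_root_twig[OF tx x'(1) v2] by blast
      show False using no_adjacent_twigs[OF T1 T2] .
    qed
    then have "gain x = 0" using gain_nbr_deg3(2)[OF v3 x' u] by simp
    then show ?thesis using fin split 3 inn x by simp
  next
    case 4
    then have "S = nb v" using card_subset_eq[OF fin_nb SV] v3 by simp
    then have "\<And>u. adj v u \<Longrightarrow> card (nb u) = 2" using in_nb unfolding S_def by blast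
    then show ?thesis using deg3_not_all_deg2[OF v3] by blast
  qed
qed

lemma final_ge:
  assumes "3 \<le> card (nb v)"
  shows "21 * int (card (nb v)) - 54 - 12 * int (card (bad_nb v)) - (\<Sum>w\<in>{y. adj v y \<and> \<not> bad y}. gain w) \<le> final v"
  using assms sum_gain[of v] in_nonneg[of v] by (simp add: final_def)

lemma final_poor4: "poor4 v \<Longrightarrow> final v = -1"
  using final_almost_bad[of v] deg4_not_bad(1)[of v] by (simp add: poor4_def gain_def)

text \<open>The links leave 84 - 54 - 24 = 6 for the two other neighbours. Their gains exceed this
  only as 6 with any positive gain, as 5 with 3, or as 5 with 5. The excluded neighbourhoods rule
  out all but the last, which is the case of a center.\<close>

lemma final_two_bad:
  assumes v: "card (nb v) = 4" "card (bad_nb v) = 2"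
  shows "-4 \<le> final v" "\<not> center v \<Longrightarrow> 0 \<le> final v"
proof -
  have v2: "card (nb v) \<noteq> 2" and v4: "4 \<le> card (nb v)" using v by auto
  have vb: "\<not> bad v" using v2 not_bad_deg by blast
  have "card {y. adj v y \<and> \<not> bad y} = 2" using v by (simp add: card_nonbad)
  then obtain a b where ab: "{y. adj v y \<and> \<not> bad y} = {a, b}" "a \<noteq> b" unfolding card_2_iff by blast
  have a: "adj v a" "\<not> bad a" and b: "adj v b" "\<not> bad b" using ab by blast+
  have ab': "{y. adj v y \<and> \<not> bad y} = {b, a}" using ab by auto
  have oth: "bad w" if "adj v w" "w \<noteq> a" "w \<noteq> b" for w using ab that by blast
  have fin: "6 - (gain a + gain b) \<le> final v" using final_ge[of v] v ab by simp
  have dich: "gain p + gain q \<le> 6 \<or> poor4 p \<and> poor4 q"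
    if p: "adj v p" "\<not> bad p" and q: "adj v q" "\<not> bad q" and pq: "p \<noteq> q"
      and oth: "\<And>w. adj v w \<Longrightarrow> w \<noteq> p \<Longrightarrow> w \<noteq> q \<Longrightarrow> bad w" and le: "gain q \<le> gain p" for p q
  proof (rule ccontr)
    assume H: "\<not> ?thesis"
    have pv: "adj p v" and qv: "adj q v" using p q sym by blast+
    have q0: "0 < gain q" using H gain_bounds(2)[OF p(2)] by linarith
    have twb: False if h: "card (nb r) = 2" "twig_root s" "{r, s} = {p, q}" for r s
    proof -
      have r: "adj v r" and s: "adj v s" using h(3) p(1) q(1) by (auto simp: doubleton_eq_iff)
      obtain t1 t2 s1 s2 where tg: "twig v s t1 t2 s1 s2" using twig_root_twig[OF h(2) s v2] by blast
      show False by (rule no_deg2_twig_hub[OF v4 r h(1) tg]) (use oth h(3) in \<open>auto simp: doubleton_eq_iff\<close>)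
    qed
    have a2: False if "almost_bad r v" "card (nb s) = 2" "{r, s} = {p, q}" for r s
    proof -
      have s: "adj v s" using that(3) p(1) q(1) by (auto simp: doubleton_eq_iff)
      show False by (rule no_almost_bad_deg2_hub[OF v4 that(1) s that(2)]) (use oth that(3) in \<open>auto simp: doubleton_eq_iff\<close>)
    qed
    have at: False if h: "almost_bad r v" "twig_root s" "{r, s} = {p, q}" for r s
    proof -
      have s: "adj v s" using h(3) p(1) q(1) by (auto simp: doubleton_eq_iff)
      obtain t1 t2 s1 s2 where tg: "twig v s t1 t2 s1 s2" using twig_root_twig[OF h(2) s v2] by blast
      show False by (rule no_almost_bad_twig_hub[OF v4 h(1) tg]) (use oth h(3) in \<open>auto simp: doubleton_eq_iff\<close>)
    qed
    have Ap: "poor4 p \<Longrightarrow> almost_bad p v" "poor5 p \<Longrightarrow> almost_bad p v" using poor4_almost_bad[OF _ pv vb] poor5_almost_bad[OF _ pv vb] by auto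
    have Aq: "poor4 q \<Longrightarrow> almost_bad q v" "poor5 q \<Longrightarrow> almost_bad q v" using poor4_almost_bad[OF _ qv vb] poor5_almost_bad[OF _ qv vb] by auto
    have pq2: "{p, q} = {p, q}" "{q, p} = {p, q}" by auto
    have bn0: "bad_nb v \<noteq> {}" using v(2) by auto
    then obtain d where d: "bad d" "adj v d" using in_bad_nb by blast
    have qc: "card (nb q) = 2 \<or> poor4 q \<or> twig_root q \<or> poor5 q" using q0 q(2) by (auto simp: gain_def split: if_splits)
    show False
    proof (cases "card (nb p) = 2")
      case True
      have "card (nb q) \<noteq> 2"
      proof
        assume q2: "card (nb q) = 2"
        have "card (nb w) = 2" if "adj v w" for w using oth[OF that] bad_facts(3) True q2 by blast
        then show False using deg4_not_all_deg2[OF v(1) _ d] by blast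
      qed
      then show False using qc twb[OF True _ pq2(1)] a2[OF _ True pq2(2)] Aq by blast
    next
      case False
      then have q2: "card (nb q) \<noteq> 2" using le p(2) q(2) by (auto simp: gain_def split: if_splits)
      show False
      proof (cases "poor4 p")
        case True
        then have "\<not> poor4 q" using H by blast
        moreover have "\<not> twig_root q" using at[OF Ap(1)[OF True] _ pq2(1)] by blast
        ultimately show False using H True False q2 p(2) q(2) by (auto simp: gain_def split: if_splits)
      next
        case nP: False
        then have "gain p \<le> 3" using False p(2) by (auto simp: gain_def)
        then show False using H le by linarith
      qed
    qed
  qed
  have ga: "gain a + gain b \<le> 6 \<or> poor4 a \<and> poor4 b"
  proof (cases "gain b \<le> gain a")
    case True
    then show ?thesis using dich[OF a b ab(2) oth] by blast
  next
    case False
    then show ?thesis using dich[OF b a ab(2)[symmetric]] oth by auto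
  qed
  have P5: "gain w = 5" if "poor4 w" for w
    using that deg4_not_bad(1)[OF that] by (simp add: gain_def poor4_def)
  show "-4 \<le> final v" using ga fin P5 by auto
  assume "\<not> center v"
  then obtain y where y: "adj v y" "\<not> bad y" "\<not> poor4 y" using v unfolding center_def by blast
  then have "y = a \<or> y = b" using oth[OF y(1)] by blast
  then have "\<not> (poor4 a \<and> poor4 b)" using y(3) by blast
  then show "0 \<le> final v" using ga fin by linarith
qed

text \<open>The surplus of one unit per link pays for the links that come from \<open>T4\<close>. If
  d is the degree and b the number of bad neighbours, giving 6 to every other neighbour leaves 15d -
  54 - 6b, which is at least b except for d = 4, b = 1 and d = 5, b = 4.\<close>

lemma final_rest:
  assumes v4: "4 \<le> card (nb v)" and nT: "v \<notin> T4" shows "int (card (bad_nb v)) \<le> final v"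
proof -
  have lt: "card (bad_nb v) < card (nb v)" using bad_lt[OF v4] .
  have f: "21 * int (card (nb v)) - 54 - 12 * int (card (bad_nb v)) - 6 * int (card (nb v) - card (bad_nb v)) \<le> final v"
    using final_ge[of v] sum_gain_le[of v] v4 by linarith
  have di: "int (card (nb v) - card (bad_nb v)) = int (card (nb v)) - int (card (bad_nb v))" using lt by simp
  consider "card (nb v) = 4" | "card (nb v) = 5" | "6 \<le> card (nb v)" using v4 by linarith
  then show ?thesis
  proof cases
    case 1
    then have b: "card (bad_nb v) \<le> 1" using nT by (auto simp: T4_def)
    show ?thesis
    proof (cases "card (bad_nb v) = 0")
      case True
      then show ?thesis using f 1 by simp
    next
      case False
      then have b1: "card (bad_nb v) = 1" using b by linarith
      then obtain d where d: "bad_nb v = {d}" by (rule card_1_singletonE)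
      then have d': "bad d" "adj v d" using in_bad_nb by blast+
      have "card {y. adj v y \<and> \<not> bad y} = 3" using 1 b1 by (simp add: card_nonbad)
      then obtain p q r where pqr: "{y. adj v y \<and> \<not> bad y} = {p, q, r}" "p \<noteq> q" "p \<noteq> r" "q \<noteq> r"
        unfolding card_3_iff by blast
      have nbp: "\<not> bad p" "\<not> bad q" "\<not> bad r" using pqr by blast+
      have g: "gain w = 6 \<or> gain w \<le> 5" "gain w = 6 \<Longrightarrow> card (nb w) = 2" if "\<not> bad w" for w
        using that by (auto simp: gain_def split: if_splits)
      \<comment> \<open>A total of 17 instead of 18 saves the unit that is due: 84 - 54 - 12 - 17 =
        1.\<close>
      have "\<not> (gain p = 6 \<and> gain q = 6 \<and> gain r = 6)"
      proof
        assume "gain p = 6 \<and> gain q = 6 \<and> gain r = 6"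
        then have c: "card (nb p) = 2" "card (nb q) = 2" "card (nb r) = 2" using g nbp by auto
        have "card (nb w) = 2" if "adj v w" for w
        proof (cases "bad w")
          case True
          then show ?thesis using bad_facts(3) by blast
        next
          case False
          then have "w \<in> {p, q, r}" using that unfolding pqr(1)[symmetric] by simp
          then show ?thesis using c by blast
        qed
        then show False using deg4_not_all_deg2[OF 1 _ d'] by blast
      qed
      then have "gain p + gain q + gain r \<le> 17" using g(1)[OF nbp(1)] g(1)[OF nbp(2)] g(1)[OF nbp(3)] by linarith
      then have "(\<Sum>w\<in>{y. adj v y \<and> \<not> bad y}. gain w) \<le> 17" unfolding pqr(1) using pqr(2-4) by simp
      then show ?thesis using final_ge[of v] 1 b1 by simp
    qed
  next
    case 2
    show ?thesis
    proof (cases "card (bad_nb v) = 4")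
      case True
      then have v6: "poor5 v" using 2 by (simp add: poor5_def)
      have "gain v = 1" using v6 poor5_not_bad[OF v6] by (simp add: gain_def poor5_def poor4_def twig_root_def)
      then show ?thesis using final_almost_bad[OF v4] 2 True by simp
    next
      case False
      then have "card (bad_nb v) \<le> 3" using lt 2 by simp
      then show ?thesis using f di 2 by linarith
    qed
  next
    case 3
    then show ?thesis using f di lt by linarith
  qed
qed

text \<open>Clusters are disjoint subsets of \<open>T4\<close>, and each of them collapses from
  three vertices to its center, so every center saves two nodes.\<close>

lemma card_rep: "card (rep ` T4) + 2 * card {x. center x} \<le> card T4"
proof -
  define Q where "Q = {x. center x}"
  define C where "C = (\<Union>x\<in>Q. cluster x - {x})"
  have QT: "Q \<subseteq> T4" by (auto simp: Q_def T4_def center_def)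
  have fQ: "finite Q" using finite_subset[OF QT fin_T4] .
  have clT: "cluster x \<subseteq> T4" if "x \<in> Q" for x
  proof -
    have x: "center x" using that by (simp add: Q_def)
    obtain v y where vy: "cluster x = {x, v, y}" "poor4 v" "poor4 y" using centerE[OF x] by metis
    then show ?thesis using QT that by (auto simp: T4_def poor4_def)
  qed
  have c2: "card (cluster x - {x}) = 2" if "x \<in> Q" for x
  proof -
    have x: "center x" using that by (simp add: Q_def)
    obtain v y where vy: "cluster x = {x, v, y}" "x \<noteq> v" "x \<noteq> y" "v \<noteq> y" using centerE[OF x] by metis
    then have "cluster x - {x} = {v, y}" by auto
    then show ?thesis using vy by simp
  qed
  have "card C = (\<Sum>x\<in>Q. card (cluster x - {x}))"
    unfolding C_def
  proof (rule card_UN_disjoint[OF fQ])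
    show "\<forall>x\<in>Q. finite (cluster x - {x})"
      using finite_subset[OF clT fin_T4] by blast
    show "\<forall>x\<in>Q. \<forall>y\<in>Q. x \<noteq> y \<longrightarrow> (cluster x - {x}) \<inter> (cluster y - {y}) = {}"
    proof (intro ballI impI)
      fix x y assume xy: "x \<in> Q" "y \<in> Q" "x \<noteq> y"
      have "rep a = x \<and> rep a = y" if "a \<in> cluster x" "a \<in> cluster y" for a
        using cluster_facts(3)[of x a] cluster_facts(3)[of y a] that xy by (simp add: Q_def)
      then show "(cluster x - {x}) \<inter> (cluster y - {y}) = {}" using xy(3) by blast
    qed
  qed
  then have cC: "card C = 2 * card Q" using c2 by simp
  have CT: "C \<subseteq> T4" using clT by (auto simp: C_def)
  have "rep ` T4 \<subseteq> T4 - C"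
  proof
    fix n assume "n \<in> rep ` T4"
    then obtain a where a: "a \<in> T4" "n = rep a" by blast
    show "n \<in> T4 - C"
    proof (cases "center n")
      case True
      have "n \<notin> C"
      proof
        assume "n \<in> C"
        then obtain x where x: "center x" "n \<in> cluster x" "n \<noteq> x" by (auto simp: C_def Q_def)
        then have "poor4 n" by (auto simp: cluster_def center_def)
        then show False using center_not_poor4[OF True] by blast
      qed
      then show ?thesis using QT True by (auto simp: Q_def)
    next
      case False
      then have ra: "rep a = a" using rep_cases[of a] a by auto
      have "a \<notin> C"
      proof
        assume "a \<in> C"
        then obtain x where x: "center x" "a \<in> cluster x" "a \<noteq> x" by (auto simp: C_def Q_def)
        then show False using cluster_facts(3)[OF x(1,2)] ra by simp
      qed
      then show ?thesis using a ra by simp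
    qed
  qed
  then have "card (rep ` T4) \<le> card (T4 - C)" using fin_T4 by (intro card_mono) auto
  also have "\<dots> = card T4 - card C" using CT fin_T4 finite_subset by (intro card_Diff_subset) auto
  finally show ?thesis using cC card_mono[OF fin_T4 CT] by (simp add: Q_def)
qed

text \<open>A bad vertex has only one anchor, so the sets \<open>bad_nb v\<close> are
  disjoint.\<close>

lemma card_darts:
  assumes "finite S" "\<And>v. v \<in> S \<Longrightarrow> 4 \<le> card (nb v)"
  shows "card {d. bad d \<and> anchor d \<in> S} = (\<Sum>v\<in>S. card (bad_nb v))" "finite {d. bad d \<and> anchor d \<in> S}"
proof -
  have e: "anchor d = v" if "v \<in> S" "d \<in> bad_nb v" for v d using anchor_eq[of d v] that assms(2)[of v] by auto
  have "{d. bad d \<and> anchor d \<in> S} = (\<Union>v\<in>S. bad_nb v)"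
  proof
    show "{d. bad d \<and> anchor d \<in> S} \<subseteq> (\<Union>v\<in>S. bad_nb v)" using bad_adj(2) by auto
    show "(\<Union>v\<in>S. bad_nb v) \<subseteq> {d. bad d \<and> anchor d \<in> S}" using e by auto
  qed
  moreover have "card (\<Union>v\<in>S. bad_nb v) = (\<Sum>v\<in>S. card (bad_nb v))"
  proof (rule card_UN_disjoint[OF assms(1)])
    show "\<forall>v\<in>S. finite (bad_nb v)" by simp
    show "\<forall>v\<in>S. \<forall>w\<in>S. v \<noteq> w \<longrightarrow> bad_nb v \<inter> bad_nb w = {}" using e by (metis disjoint_iff)
  qed
  ultimately show "card {d. bad d \<and> anchor d \<in> S} = (\<Sum>v\<in>S. card (bad_nb v))" "finite {d. bad d \<and> anchor d \<in> S}"
    using assms(1) by auto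
qed

text \<open>Deficits occur only in \<open>T4\<close>: at most 1 for each vertex of \<open>P\<close>
  and 4 for each one of \<open>Q\<close>. The surplus of \<open>R\<close>, one unit per link end,
  makes up for them.\<close>

lemma charge_nonneg: "0 \<le> (\<Sum>v\<in>V. 21 * int (card (nb v)) - 54)"
proof -
  define P where "P = {v. poor4 v}"
  define Q where "Q = {x. center x}"
  define R where "R = {v \<in> V. 4 \<le> card (nb v) \<and> v \<notin> T4}"
  define O' where "O' = {v \<in> V. card (nb v) \<le> 3}"
  have T_deg4: "card (nb v) = 4" "card (bad_nb v) = 2 \<or> card (bad_nb v) = 3" if "v \<in> T4" for v
    using that bad_lt[of v] by (auto simp: T4_def)
  have TV: "T4 \<subseteq> V"
  proof
    fix v assume "v \<in> T4"
    then have "nb v \<noteq> {}" using T_deg4 by fastforce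
    then show "v \<in> V" using adjV by auto
  qed
  have PT: "P \<subseteq> T4" "Q \<subseteq> T4" by (auto simp: P_def Q_def T4_def poor4_def center_def)
  have fin: "finite R" "finite O'" "finite P" "finite Q"
    using finV fin_T4 PT finite_subset by (auto simp: R_def O'_def)
  have VU: "V = T4 \<union> (R \<union> O')" using TV by (auto simp: R_def O'_def)
  have dj: "T4 \<inter> (R \<union> O') = {}" "R \<inter> O' = {}" using T_deg4 by (auto simp: R_def O'_def)
  have "(\<Sum>v\<in>V. final v) = (\<Sum>v\<in>T4. final v) + ((\<Sum>v\<in>R. final v) + (\<Sum>v\<in>O'. final v))"
    using sum.union_disjoint[of T4 "R \<union> O'" final] sum.union_disjoint[of R O' final] dj fin fin_T4 VU by simp
  moreover have "0 \<le> (\<Sum>v\<in>O'. final v)"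
  proof (rule sum_nonneg)
    fix v assume "v \<in> O'"
    then have "card (nb v) = 2 \<or> card (nb v) = 3" using deg_ge2[of v] by (auto simp: O'_def)
    then show "0 \<le> final v" using final_deg2 final_deg3 by fastforce
  qed
  moreover have "(\<Sum>v\<in>R. int (card (bad_nb v))) \<le> (\<Sum>v\<in>R. final v)"
    by (rule sum_mono) (use final_rest in \<open>auto simp: R_def\<close>)
  moreover have "- int (card P) - 4 * int (card Q) \<le> (\<Sum>v\<in>T4. final v)"
  proof -
    have "(\<Sum>v\<in>T4. (if v \<in> P then -1 else 0) + (if v \<in> Q then -4 else (0::int))) \<le> (\<Sum>v\<in>T4. final v)"
    proof (rule sum_mono)
      fix v assume v: "v \<in> T4"
      show "(if v \<in> P then -1 else 0) + (if v \<in> Q then -4 else (0::int)) \<le> final v"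
        using T_deg4[OF v] final_poor4[of v] final_two_bad[of v] center_not_poor4[of v]
        by (auto simp: P_def Q_def poor4_def)
    qed
    moreover have "(\<Sum>v\<in>T4. (if v \<in> P then -1 else 0) + (if v \<in> Q then -4 else (0::int))) = - int (card P) - 4 * int (card Q)"
      using PT fin_T4 by (simp add: sum.distrib sum.If_cases Int_absorb1)
    ultimately show ?thesis by simp
  qed
  moreover have "int (card P) + 4 * int (card Q) \<le> (\<Sum>v\<in>R. int (card (bad_nb v)))"
  proof -
    \<comment> \<open>The link ends in \<open>T4\<close> whose link leaves \<open>T4\<close>;
      reversed, they are anchored in \<open>R\<close>, because ends of links have degree at least
      4.\<close>
    define X where "X = {d. bad d \<and> anchor d \<in> T4 \<and> anchor (partner d) \<notin> T4}"
    have T_deg4': "\<And>v. v \<in> T4 \<Longrightarrow> 4 \<le> card (nb v)" using T_deg4 by simp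
    note dT = card_darts[OF fin_T4 T_deg4']
    have R4: "\<And>v. v \<in> R \<Longrightarrow> 4 \<le> card (nb v)" by (simp add: R_def)
    note dR = card_darts[OF fin(1) R4]
    have "{d. bad d \<and> anchor d \<in> T4} = links \<union> X" "links \<inter> X = {}" by (auto simp: links_def X_def)
    moreover have fX: "finite X" using finite_subset[OF _ dT(2), of X] by (auto simp: X_def)
    ultimately have 1: "(\<Sum>v\<in>T4. card (bad_nb v)) = card links + card X"
      using dT(1) card_Un_disjoint[OF fin_links fX] by simp
    have "(\<Sum>v\<in>T4. card (bad_nb v)) = (\<Sum>v\<in>T4. 2 + (if v \<in> P then 1 else 0))"
    proof (rule sum.cong[OF refl])
      fix v assume "v \<in> T4"
      then show "card (bad_nb v) = 2 + (if v \<in> P then 1 else 0)" using T_deg4[of v] unfolding P_def poor4_def by auto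
    qed
    also have "\<dots> = 2 * card T4 + card P"
      unfolding sum.distrib using PT fin_T4 by (simp add: sum.If_cases Int_absorb1)
    finally have 2: "(\<Sum>v\<in>T4. card (bad_nb v)) = 2 * card T4 + card P" .
    have "card X = card (partner ` X)"
      by (rule card_image[symmetric], rule inj_on_inverseI[of _ partner]) (auto simp: X_def bad_facts(6))
    also have "\<dots> \<le> card {d. bad d \<and> anchor d \<in> R}"
    proof (rule card_mono[OF dR(2)])
      show "partner ` X \<subseteq> {d. bad d \<and> anchor d \<in> R}"
      proof
        fix u assume "u \<in> partner ` X"
        then obtain d where d: "bad d" "anchor (partner d) \<notin> T4" "u = partner d" by (auto simp: X_def)
        have bu: "bad u" using bad_facts(5) d by blast
        then show "u \<in> {d. bad d \<and> anchor d \<in> R}" using d bad_facts(7)[OF bu] anchor_V[OF bu] by (simp add: R_def)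
      qed
    qed
    finally have 3: "card X \<le> (\<Sum>v\<in>R. card (bad_nb v))" using dR(1) by simp
    have "card P + 4 * card Q \<le> (\<Sum>v\<in>R. card (bad_nb v))"
      using 1 2 3 links_le card_rep unfolding Q_def by linarith
    then have "int (card P + 4 * card Q) \<le> int (\<Sum>v\<in>R. card (bad_nb v))" by (rule of_nat_mono)
    then show ?thesis by simp
  qed
  ultimately have "0 \<le> (\<Sum>v\<in>V. final v)" by linarith
  then show ?thesis using sum_final by simp
qed

end

section \<open>The partition\<close>

text \<open>Cutting adjacency down to \<open>W\<close> makes each induced subgraph an instance of
  the locale.\<close>

definition gadj :: "'a sgraph \<Rightarrow> 'a set \<Rightarrow> 'a \<Rightarrow> 'a \<Rightarrow> bool" where
  "gadj G W x y \<longleftrightarrow> {x, y} \<in> edges G \<and> x \<in> W \<and> y \<in> W"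

lemma cycle_length_ge_girth: "is_cycle G p \<Longrightarrow> girth G \<le> enat (length p)"
  unfolding girth_def by (rule INF_lower) simp

lemma gadj_girth6:
  assumes G: "simple_graph G" and g: "girth G \<ge> 6" and W: "W \<subseteq> verts G"
  shows "girth6_graph W (gadj G W)"
proof -
  let ?a = "gadj G W"
  have ne: "\<not> ?a x x" for x using G by (auto simp: simple_graph_def gadj_def)
  have s: "?a x y \<Longrightarrow> ?a y x" for x y by (auto simp: gadj_def insert_commute)
  have d: "x \<noteq> y" if "?a x y" for x y using ne that by auto
  have v: "x \<in> verts G" "y \<in> verts G" "{x, y} \<in> edges G" if "?a x y" for x y using W that by (auto simp: gadj_def)
  have cyc: False if p: "is_cycle G p" "length p < 6" for p
  proof -
    have "6 \<le> enat (length p)" using cycle_length_ge_girth[OF p(1)] g by (rule order_trans[rotated])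
    then show False using p(2) by (simp add: numeral_eq_enat)
  qed
  have n3: False if h: "?a a b" "?a b c" "?a c a" for a b c
    using cyc[of "[a, b, c]"] h[THEN d] h[THEN v(1)] h[THEN v(3)] by (auto simp: is_cycle_def is_path_def)
  have n4: False if h: "?a a b" "?a b c" "?a c d" "?a d a" and "a \<noteq> c" "b \<noteq> d" for a b c d
    using cyc[of "[a, b, c, d]"] h[THEN d] h[THEN v(1)] h[THEN v(3)] that(5,6) by (auto simp: is_cycle_def is_path_def)
  have n5: False if h: "?a a b" "?a b c" "?a c d" "?a d e" "?a e a" for a b c d e
  proof -
    \<comment> \<open>If two vertices of the closed walk coincided, a closed walk of length 3 would
      remain.\<close>
    have "a \<noteq> c" using n3[of a d e] h by auto
    moreover have "a \<noteq> d" using n3[of a b c] h by auto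
    moreover have "b \<noteq> d" using n3[of a b e] h by auto
    moreover have "b \<noteq> e" using n3[of b c d] h by auto
    moreover have "c \<noteq> e" using n3[of a b c] h by auto
    ultimately show False
      using cyc[of "[a, b, c, d, e]"] h[THEN d] h[THEN v(1)] h[THEN v(3)] by (auto simp: is_cycle_def is_path_def)
  qed
  show ?thesis
  proof (unfold_locales, goal_cases)
    case 1 then show ?case using G W finite_subset by (auto simp: simple_graph_def)
  next
    case 2 then show ?case by (simp add: gadj_def)
  next
    case 3 then show ?case by (rule s)
  next
    case 4 then show ?case by (rule ne)
  next
    case 5 then show ?case by (rule n3)
  next
    case 6 then show ?case by (rule n4)
  next
    case 7 then show ?case by (rule n5)
  qed
qed

text \<open>\<open>valid\<close> inspects adjacency only between vertices of \<open>W'\<close>,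
  where both graphs agree. This turns colourings of smaller graphs into partial colourings of the
  critical one.\<close>

lemma valid_supergraph:
  assumes g: "girth6_graph W (gadj G W)" "girth6_graph W' (gadj G W')" and WW: "W' \<subseteq> W"
    and c: "girth6_graph.valid W' (gadj G W') c W'"
  shows "girth6_graph.valid W (gadj G W) c W'"
proof -
  interpret A: girth6_graph W "gadj G W" by (rule g)
  interpret B: girth6_graph W' "gadj G W'" by (rule g)
  have eq: "gadj G W x y = gadj G W' x y" if "x \<in> W'" "y \<in> W'" for x y
    using that WW by (auto simp: gadj_def)
  have ac: "A.acyc S" if S: "B.acyc S" "S \<subseteq> W'" for S
    unfolding A.acyc_def
  proof
    assume "\<exists>p. distinct p \<and> 3 \<le> length p \<and> set p \<subseteq> S \<and> successively (gadj G W) p \<and> gadj G W (last p) (hd p)"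
    then obtain p where p: "distinct p" "3 \<le> length p" "set p \<subseteq> S" "successively (gadj G W) p" "gadj G W (last p) (hd p)"
      by blast
    have "p \<noteq> []" using p(2) by auto
    then have "last p \<in> W'" "hd p \<in> W'" using p(3) S(2) last_in_set hd_in_set by blast+
    then have "gadj G W' (last p) (hd p)" using p(5) eq by simp
    moreover have "successively (gadj G W') p"
      by (rule successively_mono[OF p(4)]) (use p(3) S(2) in \<open>auto simp: gadj_def\<close>)
    ultimately show False using S(1) p(1-3) unfolding B.acyc_def by blast
  qed
  have "A.acyc {x \<in> W'. c x = Fo}" by (rule ac) (use c in \<open>auto simp: B.valid_def\<close>)
  then show ?thesis using c WW unfolding A.valid_def B.valid_def by (simp add: eq)
qed

lemma handshake:
  assumes G: "simple_graph G" and W: "W \<subseteq> verts G"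
  shows "(\<Sum>v\<in>W. card {x. gadj G W v x}) = 2 * card {e \<in> edges G. e \<subseteq> W}"
proof -
  let ?E = "{e \<in> edges G. e \<subseteq> W}"
  have fW: "finite W" using G W finite_subset by (auto simp: simple_graph_def)
  have fE: "finite ?E" by (rule finite_subset[of _ "Pow W"]) (use fW in auto)
  have c2: "card e = 2" if "e \<in> edges G" for e using G that by (auto simp: simple_graph_def)
  have "card {x. gadj G W v x} = card {e \<in> ?E. v \<in> e}" if v: "v \<in> W" for v
  proof (rule bij_betw_same_card[of "\<lambda>x. {v, x}"])
    have "inj_on (\<lambda>x. {v, x}) {x. gadj G W v x}" by (rule inj_onI) (auto simp: doubleton_eq_iff)
    moreover have "(\<lambda>x. {v, x}) ` {x. gadj G W v x} = {e \<in> ?E. v \<in> e}"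
    proof
      show "{e \<in> ?E. v \<in> e} \<subseteq> (\<lambda>x. {v, x}) ` {x. gadj G W v x}"
      proof
        fix e assume e: "e \<in> {e \<in> ?E. v \<in> e}"
        then obtain a b where "e = {a, b}" using c2[of e] unfolding card_2_iff by auto
        then obtain x where "e = {v, x}" using e by auto
        then show "e \<in> (\<lambda>x. {v, x}) ` {x. gadj G W v x}" using e v by (auto simp: gadj_def)
      qed
    qed (use v in \<open>auto simp: gadj_def\<close>)
    ultimately show "bij_betw (\<lambda>x. {v, x}) {x. gadj G W v x} {e \<in> ?E. v \<in> e}" by (simp add: bij_betw_def)
  qed
  then have "(\<Sum>v\<in>W. card {x. gadj G W v x}) = (\<Sum>v\<in>W. card {e \<in> ?E. v \<in> e})" by simp
  also have "\<dots> = 2 * card ?E"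
  proof (rule sum_multicount[OF fW fE], rule ballI)
    fix e assume e: "e \<in> ?E"
    then have "{v \<in> W. v \<in> e} = e" by auto
    then show "card {v \<in> W. v \<in> e} = 2" using c2 e by simp
  qed
  finally show ?thesis .
qed

lemma mad_bound:
  assumes G: "simple_graph G" and W: "W \<subseteq> verts G" "W \<noteq> {}"
  shows "2 * real (card {e \<in> edges G. e \<subseteq> W}) / real (card W) \<le> mad G"
proof -
  have sub: "is_subgraph (induced G W) G"
    using simple_graph_induced[OF G W(1)] W by (auto simp: is_subgraph_def induced_def)
  have V: "verts G \<noteq> {}" using W by auto
  have "2 * real (card (edges (induced G W))) / real (card (verts (induced G W))) \<le> mad G"
    unfolding mad_def if_not_P[OF V]
  proof (rule Max_ge[OF densities_finite_nonempty(1)[OF G V]], rule CollectI, intro exI conjI)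
    show "is_subgraph (induced G W) G" by (rule sub)
    show "verts (induced G W) \<noteq> {}" using W by (simp add: induced_def)
  qed simp
  then show ?thesis by (simp add: induced_def)
qed

text \<open>A vertex set of least size whose induced subgraph has no colouring is critical. With n
  vertices and e edges, nonnegative total charge reads 54n \<le> 42e, that is, average degree at
  least 18/7.\<close>

lemma colouring_exists:
  assumes G: "simple_graph G" and m: "mad G < 18 / 7" and g: "girth G \<ge> 6"
  shows "\<exists>c. girth6_graph.valid (verts G) (gadj G (verts G)) c (verts G)"
proof (rule ccontr)
  define P where "P W \<longleftrightarrow> W \<subseteq> verts G \<and> \<not> (\<exists>c. girth6_graph.valid W (gadj G W) c W)" for W
  assume "\<not> ?thesis"
  then have "P (verts G)" by (simp add: P_def)
  then obtain W where W: "P W" and min: "\<And>W'. P W' \<Longrightarrow> card W \<le> card W'"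
    using ex_has_least_nat[of P "verts G" card] by blast
  have WV: "W \<subseteq> verts G" using W by (simp add: P_def)
  have fW: "finite W" using G WV finite_subset by (auto simp: simple_graph_def)
  interpret A: girth6_graph W "gadj G W" by (rule gadj_girth6[OF G g WV])
  interpret critical_graph W "gadj G W"
  proof unfold_locales
    show "\<exists>c. A.valid c X" if X: "X \<subset> W" for X
    proof -
      have "card X < card W" using X fW by (rule psubset_card_mono[rotated])
      then have "\<not> P X" using min[of X] by linarith
      then obtain c where "girth6_graph.valid X (gadj G X) c X" using X WV by (auto simp: P_def)
      then show ?thesis
        using valid_supergraph[OF A.girth6_graph_axioms gadj_girth6[OF G g]] X WV by blast
    qed
    show "\<not> A.valid c W" for c using W by (simp add: P_def)
  qed
  have "W \<noteq> {}"
  proof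
    assume "W = {}"
    have "A.acyc {}" by (auto simp: A.acyc_def)
    then have "A.valid (\<lambda>_. Fo) W" unfolding A.valid_def using \<open>W = {}\<close> by simp
    then show False using W by (auto simp: P_def)
  qed
  have "0 \<le> (\<Sum>v\<in>W. 21 * int (card (A.nb v)) - 54)" by (rule charge_nonneg)
  also have "\<dots> = 21 * int (\<Sum>v\<in>W. card (A.nb v)) - 54 * int (card W)"
    by (simp add: sum_subtractf sum_distrib_left)
  also have "(\<Sum>v\<in>W. card (A.nb v)) = 2 * card {e \<in> edges G. e \<subseteq> W}"
    using handshake[OF G WV] by (simp add: A.nb_def)
  finally have "18 * card W \<le> 14 * card {e \<in> edges G. e \<subseteq> W}" by linarith
  then have "real (18 * card W) \<le> real (14 * card {e \<in> edges G. e \<subseteq> W})" by (rule of_nat_mono)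
  then have "18 * real (card W) \<le> 14 * real (card {e \<in> edges G. e \<subseteq> W})" by simp
  moreover have "0 < real (card W)" using \<open>W \<noteq> {}\<close> fW by (simp add: card_gt_0_iff)
  ultimately have "18 / 7 \<le> 2 * real (card {e \<in> edges G. e \<subseteq> W}) / real (card W)"
    by (simp add: field_simps)
  then show False using mad_bound[OF G WV \<open>W \<noteq> {}\<close>] m by linarith
qed

text \<open>A path of length at most 2 is a vertex, an edge, or two edges with a middle vertex
  \<open>z\<close>; all three are excluded, so every path has at least four vertices.\<close>

lemma graph_dist_gt2:
  assumes "x \<noteq> y" "{x, y} \<notin> edges H" "\<And>z. z \<in> verts H \<Longrightarrow> {x, z} \<in> edges H \<Longrightarrow> {z, y} \<notin> edges H"
  shows "graph_dist H x y > 2"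
proof -
  have "3 \<le> graph_dist H x y"
    unfolding graph_dist_def
  proof (rule INF_greatest)
    fix p assume "p \<in> {p. is_path H p \<and> hd p = x \<and> last p = y}"
    then have p: "p \<noteq> []" "set p \<subseteq> verts H" "successively (\<lambda>u v. {u, v} \<in> edges H) p" "hd p = x" "last p = y"
      by (auto simp: is_path_def)
    have "4 \<le> length p"
    proof (rule ccontr)
      assume "\<not> 4 \<le> length p"
      then have "length p = Suc 0 \<or> length p = Suc (Suc 0) \<or> length p = Suc (Suc (Suc 0))"
        using p(1) length_greater_0_conv[of p] by linarith
      then consider a where "p = [a]" | a b where "p = [a, b]" | a b c where "p = [a, b, c]"
        by (auto simp: length_Suc_conv)
      then show False by cases (use p assms in auto)
    qed
    then have "3 \<le> length p - 1" by simp
    then show "3 \<le> enat (length p - 1)" by (simp add: numeral_eq_enat)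
  qed
  moreover have "(2::enat) < 3" by simp
  ultimately show ?thesis by (metis order_less_le_trans)
qed

theorem lemma9:
  fixes G :: "'a sgraph"
  assumes "simple_graph G"
    and "mad G < 18 / 7"
    and "girth G \<ge> 6"
  shows "\<exists>F I1 I2.
    verts G = F \<union> I1 \<union> I2 \<and> F \<inter> I1 = {} \<and> F \<inter> I2 = {} \<and> I1 \<inter> I2 = {} \<and>
    is_forest (induced G F) \<and>
    independent_set G I1 \<and>
    (\<forall>x \<in> I1. \<forall>y \<in> I1. x \<noteq> y \<longrightarrow> graph_dist (induced G (F \<union> I1)) x y > 2) \<and>
    independent_set G I2 \<and>
    (\<forall>x \<in> I2. \<forall>y \<in> I2. x \<noteq> y \<longrightarrow> graph_dist G x y > 2)"
proof -
  let ?V = "verts G"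
  interpret girth6_graph ?V "gadj G ?V" by (rule gadj_girth6) (use assms in auto)
  obtain c where c: "valid c ?V" using colouring_exists[OF assms] by blast
  have edge: "gadj G ?V x y \<longleftrightarrow> {x, y} \<in> edges G" for x y
    using assms(1) by (auto simp: gadj_def simple_graph_def)
  define F where "F = {x \<in> ?V. c x = Fo}"
  define I1 where "I1 = {x \<in> ?V. c x = On}"
  define I2 where "I2 = {x \<in> ?V. c x = Tw}"
  have c1: "c x = Fo" if "x \<in> ?V" "y \<in> ?V" "{x, y} \<in> edges G" "c x = c y" for x y
    using c that unfolding valid_def edge by blast
  have c2: "c x = Fo \<or> c x = On \<and> c z = Tw"
    if "z \<in> ?V" "x \<in> ?V" "y \<in> ?V" "{z, x} \<in> edges G" "{z, y} \<in> edges G" "x \<noteq> y" "c x = c y" for x y z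
    using c that unfolding valid_def edge by blast
  have "?V = F \<union> I1 \<union> I2" unfolding F_def I1_def I2_def using hue.exhaust by blast
  moreover have "F \<inter> I1 = {}" "F \<inter> I2 = {}" "I1 \<inter> I2 = {}" by (auto simp: F_def I1_def I2_def)
  moreover have "is_forest (induced G F)"
    unfolding is_forest_def
  proof
    assume "\<exists>p. is_cycle (induced G F) p"
    then obtain p where p: "is_cycle (induced G F) p" by blast
    have "successively (gadj G ?V) p"
    proof (rule successively_mono)
      show "successively (\<lambda>u v. {u, v} \<in> edges (induced G F)) p" using p by (simp add: is_cycle_def is_path_def)
    qed (auto simp: edge induced_def)
    moreover have "acyc F" using c by (simp add: valid_def F_def)
    ultimately show False using p by (auto simp: acyc_def is_cycle_def is_path_def induced_def edge)
  qed
  moreover have "independent_set G I1" "independent_set G I2"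
  proof -
    have "{x, y} \<notin> edges G" if "x \<in> I1 \<and> y \<in> I1 \<or> x \<in> I2 \<and> y \<in> I2" for x y
      using c1[of x y] that by (auto simp: I1_def I2_def)
    then show "independent_set G I1" "independent_set G I2"
      by (auto simp: independent_set_def I1_def I2_def)
  qed
  moreover have "\<forall>x \<in> I1. \<forall>y \<in> I1. x \<noteq> y \<longrightarrow> graph_dist (induced G (F \<union> I1)) x y > 2"
  proof (intro ballI impI)
    fix x y assume h: "x \<in> I1" "y \<in> I1" "x \<noteq> y"
    show "graph_dist (induced G (F \<union> I1)) x y > 2"
    proof (rule graph_dist_gt2[OF h(3)])
      show "{x, y} \<notin> edges (induced G (F \<union> I1))" using c1[of x y] h by (auto simp: induced_def I1_def)
      fix z assume z: "z \<in> verts (induced G (F \<union> I1))" "{x, z} \<in> edges (induced G (F \<union> I1))"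
      \<comment> \<open>The middle vertex \<open>z\<close> lies in \<open>F \<union> I1\<close>, so
        the exception with \<open>c z = Tw\<close> does not arise.\<close>
      show "{z, y} \<notin> edges (induced G (F \<union> I1))"
        using c2[of z x y] z h by (auto simp: induced_def I1_def F_def insert_commute)
    qed
  qed
  moreover have "\<forall>x \<in> I2. \<forall>y \<in> I2. x \<noteq> y \<longrightarrow> graph_dist G x y > 2"
  proof (intro ballI impI)
    fix x y assume h: "x \<in> I2" "y \<in> I2" "x \<noteq> y"
    show "graph_dist G x y > 2"
    proof (rule graph_dist_gt2[OF h(3)])
      show "{x, y} \<notin> edges G" using c1[of x y] h by (auto simp: I2_def)
      fix z assume z: "z \<in> ?V" "{x, z} \<in> edges G"
      show "{z, y} \<notin> edges G"
        using c2[of z x y] z h by (auto simp: I2_def insert_commute)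
    qed
  qed
  ultimately show ?thesis by blast
qed

end
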